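(* Let $G$ be a finite simple graph which is gap free and claw free. Then for every integer $t \geq 3$, the squarefree monomial ideal $I_t(G)$ generated by the $t$-paths of $G$ is either the zero ideal or has linear minimal free resolution.
   Context: Let $K$ be a field and $S$ the polynomial ring over $K$ whose variables are the vertices of $G$. A $t$-path of $G$ is a sequence of $t$ distinct vertices $x_1,\dots,x_t$ with $x_ix_{i+1}$ an edge of $G$ for $1\le i\le t-1$, and $I_t(G)\subseteq S$ is the ideal generated by all monomials $x_1x_2\cdots x_t$ with $x_1,\dots,x_t$ a $t$-path. $G$ is gap free if there are no two vertex-disjoint edges $uv$, $xy$ of $G$ such that $G$ has no edge with one endpoint in $\{u,v\}$ and the other in $\{x,y\}$ (equivalently, the complement $G^c$ has no induced $4$-cycle). $G$ is claw free if it has no induced subgraph isomorphic to $K_{1,3}$. A monomial ideal $J$ generated in degree $d$ has linear minimal free resolution if $\operatorname{Tor}_i^S(J,K)_j=0$ for all $i\ge 1$ and all $j\neq i+d$ (equivalently, for $J \neq 0$, its Castelnuovo-Mumford regularity equals $d$). *)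

theory Defs
  imports
    "HOL-Library.Poly_Mapping"
    "HOL-Algebra.Ideal"
    "Graph_Theory.Graph_Theory"
    "Jordan_Normal_Form.Matrix_Kernel"
begin

section \<open>Graphs\<close>

text \<open>
  A finite simple graph is the locale \<^locale>\<open>graph\<close> of finite, loop-free, symmetric digraphs without
  parallel arcs: an undirected edge is a pair of opposite arcs.
\<close>

definition gap_free :: "('v, 'e) pre_digraph \<Rightarrow> bool" where
  "gap_free G \<longleftrightarrow> \<not> (\<exists>u v x y. u \<rightarrow>\<^bsub>G\<^esub> v \<and> x \<rightarrow>\<^bsub>G\<^esub> y \<and> {u, v} \<inter> {x, y} = {} \<and>
     \<not> (\<exists>a\<in>{u, v}. \<exists>b\<in>{x, y}. a \<rightarrow>\<^bsub>G\<^esub> b))"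

definition claw_free :: "('v, 'e) pre_digraph \<Rightarrow> bool" where
  "claw_free G \<longleftrightarrow> \<not> (\<exists>H. induced_subgraph H G \<and> K\<^bsub>1,3\<^esub> H)"

section \<open>Polynomials and path ideals\<close>

type_synonym ('v, 'k) mpoly = "('v \<Rightarrow>\<^sub>0 nat) \<Rightarrow>\<^sub>0 'k"

text \<open>The polynomial ring with coefficients in \<open>'k\<close> whose set of variables is exactly \<open>V\<close>.\<close>

definition poly_ring :: "'v set \<Rightarrow> ('v, 'k::field) mpoly ring" where
  "poly_ring V =
    \<lparr>carrier = {p. \<forall>m\<in>Poly_Mapping.keys p. Poly_Mapping.keys m \<subseteq> V},
     monoid.mult = (*), one = 1, ring.zero = 0, add = (+)\<rparr>"

definition var :: "'v \<Rightarrow> ('v, 'k::field) mpoly" where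
  "var x = Poly_Mapping.single (Poly_Mapping.single x 1) 1"

definition path_ideal :: "nat \<Rightarrow> ('v, 'e) pre_digraph \<Rightarrow> ('v, 'k::field) mpoly set" where
  "path_ideal t G =
    genideal (poly_ring (verts G)) {prod_list (map var p) |p. vpath p G \<and> length p = t}"

text \<open>Standard grading; the zero polynomial is homogeneous of every degree, and it is the only
  homogeneous polynomial of negative degree.\<close>

definition mon_degree :: "('v \<Rightarrow>\<^sub>0 nat) \<Rightarrow> nat" where
  "mon_degree m = (\<Sum>x\<in>Poly_Mapping.keys m. Poly_Mapping.lookup m x)"

definition homogeneous :: "('v, 'k::field) mpoly \<Rightarrow> int \<Rightarrow> bool" where
  "homogeneous p d \<longleftrightarrow> (\<forall>m\<in>Poly_Mapping.keys p. int (mon_degree m) = d)"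

section \<open>Graded free resolutions\<close>

text \<open>
  Data of an augmented complex of finitely generated graded free modules over the polynomial
  ring \<open>S\<close>:
  \<open>F\<^sub>i\<close> has the basis \<open>e\<^sub>0, e\<^sub>1, \<dots>\<close> with degrees listed in \<open>gens F i\<close>, that is,
  \<open>F\<^sub>i\<close> is the direct sum of the \<open>S(-d)\<close> for \<open>d\<close> in \<open>gens F i\<close>; \<open>diff F i\<close> is the matrix of
  \<open>F\<^sub>i\<^sub>+\<^sub>1 \<rightarrow> F\<^sub>i\<close>; and \<open>aug F\<close> is the row of the augmentation \<open>F\<^sub>0 \<rightarrow> S\<close>.
\<close>

record (overloaded) ('v, 'k::zero) free_complex =
  gens :: "nat \<Rightarrow> int list"
  diff :: "nat \<Rightarrow> ('v, 'k) mpoly mat"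
  aug :: "('v, 'k) mpoly vec"

abbreviation rk :: "('v, 'k::zero) free_complex \<Rightarrow> nat \<Rightarrow> nat" where
  "rk F i \<equiv> length (gens F i)"

definition free_module :: "'v set \<Rightarrow> nat \<Rightarrow> ('v, 'k::field) mpoly vec set" where
  "free_module V n = {v \<in> carrier_vec n. \<forall>b<n. v $ b \<in> carrier (poly_ring V)}"

text \<open>All maps are homogeneous of degree 0, and
  \<open>\<cdots> \<rightarrow> F\<^sub>1 \<rightarrow> F\<^sub>0 \<rightarrow> J \<rightarrow> 0\<close> is exact.\<close>

definition graded_free_resolution ::
    "'v set \<Rightarrow> ('v, 'k::field) mpoly set \<Rightarrow> ('v, 'k) free_complex \<Rightarrow> bool" where
  "graded_free_resolution V J F \<longleftrightarrow>
     aug F \<in> free_module V (rk F 0) \<and>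
     (\<forall>b<rk F 0. homogeneous (aug F $ b) (gens F 0 ! b)) \<and>
     (\<forall>i. diff F i \<in> carrier_mat (rk F i) (rk F (Suc i))) \<and>
     (\<forall>i. \<forall>a<rk F i. \<forall>b<rk F (Suc i).
        diff F i $$ (a, b) \<in> carrier (poly_ring V) \<and>
        homogeneous (diff F i $$ (a, b)) (gens F (Suc i) ! b - gens F i ! a)) \<and>
     (\<lambda>v. aug F \<bullet> v) ` free_module V (rk F 0) = J \<and>
     {v \<in> free_module V (rk F 0). aug F \<bullet> v = 0}
       = (\<lambda>w. diff F 0 *\<^sub>v w) ` free_module V (rk F 1) \<and>
     (\<forall>i. {v \<in> free_module V (rk F (Suc i)). diff F i *\<^sub>v v = 0\<^sub>v (rk F i)}
       = (\<lambda>w. diff F (Suc i) *\<^sub>v w) ` free_module V (rk F (Suc (Suc i))))"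

section \<open>Tor with coefficients in the residue field\<close>

text \<open>
  The residue field \<open>K\<close> is \<open>S\<close> modulo the ideal of the variables, so that the matrices of
  \<open>F \<otimes> K\<close> are those of \<open>F\<close> with every entry replaced by its constant coefficient, and
  \<open>F\<^sub>i \<otimes> K\<close> in degree \<open>j\<close> is spanned by the basis elements of \<open>F\<^sub>i\<close> of degree \<open>j\<close>.
\<close>

definition residue_mat :: "('v, 'k::field) mpoly mat \<Rightarrow> 'k mat" where
  "residue_mat A = map_mat (\<lambda>p. Poly_Mapping.lookup p 0) A"

definition residue_chains :: "('v, 'k::field) free_complex \<Rightarrow> nat \<Rightarrow> int \<Rightarrow> 'k vec set" where
  "residue_chains F i j =
    {u \<in> carrier_vec (rk F i). \<forall>b<rk F i. u $ b \<noteq> 0 \<longrightarrow> gens F i ! b = j}"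

definition residue_cycles :: "('v, 'k::field) free_complex \<Rightarrow> nat \<Rightarrow> int \<Rightarrow> 'k vec set" where
  "residue_cycles F i j = (case i of 0 \<Rightarrow> residue_chains F 0 j
     | Suc n \<Rightarrow> residue_chains F (Suc n) j \<inter> mat_kernel (residue_mat (diff F n)))"

definition residue_boundaries :: "('v, 'k::field) free_complex \<Rightarrow> nat \<Rightarrow> int \<Rightarrow> 'k vec set" where
  "residue_boundaries F i j = (\<lambda>w. residue_mat (diff F i) *\<^sub>v w) ` residue_chains F (Suc i) j"

definition residue_homology ::
    "('v, 'k::field) free_complex \<Rightarrow> nat \<Rightarrow> int \<Rightarrow> 'k vec set set" where
  "residue_homology F i j = residue_cycles F i j //
     {(u, w). u \<in> residue_cycles F i j \<and> w \<in> residue_cycles F i j \<and>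
        u - w \<in> residue_boundaries F i j}"

text \<open>
  \<open>Tor V J i j\<close> is (the underlying set of) the degree \<open>j\<close> part of \<open>Tor\<^sub>i(J, K)\<close> over the polynomial
  ring in the variables \<open>V\<close>, computed from a chosen graded free resolution of \<open>J\<close>. For \<open>V\<close> finite
  and \<open>J\<close> a homogeneous ideal such a resolution exists, and the choice does not matter up to
  isomorphism.
\<close>

definition Tor :: "'v set \<Rightarrow> ('v, 'k::field) mpoly set \<Rightarrow> nat \<Rightarrow> int \<Rightarrow> 'k vec set set" where
  "Tor V J i j = residue_homology (SOME F. graded_free_resolution V J F) i j"

text \<open>For an ideal \<open>J\<close> generated in degree \<open>d\<close>. A vector space is zero iff it has just one element.\<close>

definition linear_minimal_free_resolution ::
    "'v set \<Rightarrow> nat \<Rightarrow> ('v, 'k::field) mpoly set \<Rightarrow> bool" where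
  "linear_minimal_free_resolution V d J \<longleftrightarrow>
     (\<forall>i\<ge>1. \<forall>j. j \<noteq> int i + int d \<longrightarrow> is_singleton (Tor V J i j))"

end

(*
A family F of squarefree monomials has linear quotients if its members can be ordered such that
for A before B some B - p + s with s in A - B comes before B. Then every colon ideal
(earlier monomials) : B is generated by variables. More generally, a list of homogeneous vectors of
the same degree over the polynomial ring whose successive colon ideals are generated by variables
has a syzygy module that is generated, in one degree more, by a list of the same kind. Iterating this
gives a linear free resolution L. If F is any other graded free resolution of the same ideal, the
identity of F is homotopic to a composite F -> L -> F of graded chain maps, and after tensoring with
the residue field this composite vanishes in the degrees in which L has no generators.

The vertex sets of the t-paths have linear quotients for the following reason. Isolated vertices lie
on no t-path. If the remaining graph has no independent triple, its complement H has no triangle and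
no 4-cycle, and a t-set carries a path unless it spans a star in H; a lexicographic order works, in
which the subsets of neighbourhoods of H come last and, among the sets with minimal vertex x, the
H-neighbours of x come last. If it has an independent triple, it is a split graph: the complement of
a maximum independent set I of minimal total degree is a clique. Then the sets are ordered by the
number of their vertices in I first.
*)

theory Submission
  imports Defs "HOL-Library.Product_Lexorder" "HOL-Library.Function_Algebras"
begin

section \<open>Linear quotients\<close>

text \<open>An exchange of p for s in a set B outside all neighbourhoods of H fails when the new set
  is a star or lies in a neighbourhood, because such sets are forbidden or come later. If two
  choices of p fail for the same s, then B has three elements and together with s it carries a path
  on four vertices of H. This is the obstacle behind the special order: once the H-neighbours of the
  minimal vertex come last, s cannot precede both of these p.

  For a split graph, sets with fewer vertices in I come first because a clique vertex can always
  replace a vertex of I on a path. Only exchanges between sets with the same clique part are left.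
  By the claw condition a clique vertex has at most two neighbours in I, which leaves three
  situations: a vertex of I that sees the whole clique is moved into it; if the vertices of I have
  disjoint neighbourhoods, a t-set is traceable iff each of its vertices in I has a neighbour in it
  and at most two have only one; otherwise I has at most three vertices and the two sets differ by a
  single exchange.\<close>

text \<open>A derivation records the order, with \<open>B\<close> as the last member. The exchange
  condition cannot hold for \<open>A = B\<close>, so \<open>B\<close> is always new.\<close>

inductive linear_quotients :: "'a set set \<Rightarrow> bool" where
  empty: "linear_quotients {}"
| insert: "linear_quotients F \<Longrightarrow>
    (\<And>A. A \<in> F \<Longrightarrow> \<exists>s\<in>A - B. \<exists>p\<in>B. insert s (B - {p}) \<in> F) \<Longrightarrow> linear_quotients (insert B F)"

text \<open>The members are added in the order of increasing \<open>key\<close>. The induction runs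
  over sets that are closed under smaller keys, so a swapped set whose key is below that of
  \<open>B\<close> has already been added.\<close>

lemma linear_quotients_key:
  fixes key :: "'a set \<Rightarrow> 'b::linorder"
  assumes "finite F" and inj: "inj_on key F"
    and ex: "\<And>A B. \<lbrakk>A \<in> F; B \<in> F; key A < key B\<rbrakk> \<Longrightarrow>
      \<exists>s\<in>A - B. \<exists>p\<in>B. insert s (B - {p}) \<in> F \<and> key (insert s (B - {p})) < key B"
  shows "linear_quotients F"
proof -
  have "\<lbrakk>S \<subseteq> F; \<And>A B. \<lbrakk>A \<in> F; B \<in> S; key A < key B\<rbrakk> \<Longrightarrow> A \<in> S\<rbrakk> \<Longrightarrow> linear_quotients S"
    if "finite S" for S
    using that
  proof (induction rule: finite_ranking_induct[where f = key])
    case empty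
    show ?case by (rule linear_quotients.empty)
  next
    case (insert B S)
    note sub = insert.prems(1) and down = insert.prems(2)
    show ?case
    proof (cases "B \<in> S")
      case True
      then show ?thesis using insert.IH sub down by (simp add: insert_absorb)
    next
      case False
      have lt: "key A < key B" if "A \<in> S" for A
        using insert(2)[OF that] inj_onD[OF inj, of A B] that sub False by force
      have "A \<in> S" if "A \<in> F" "C \<in> S" "key A < key C" for A C
      proof -
        have "A \<in> insert B S" using down that by blast
        moreover have "A \<noteq> B" using lt[OF that(2)] that(3) by auto
        ultimately show ?thesis by simp
      qed
      then have "linear_quotients S" using insert.IH sub by blast
      moreover have "\<exists>s\<in>A - B. \<exists>p\<in>B. insert s (B - {p}) \<in> S" if "A \<in> S" for A
      proof -
        have "A \<in> F" "B \<in> F" using that sub by auto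
        from ex[OF this lt[OF that]] obtain s p where sp: "s \<in> A - B" "p \<in> B"
          "insert s (B - {p}) \<in> F" "key (insert s (B - {p})) < key B" by blast
        moreover have "insert s (B - {p}) \<in> insert B S" by (rule down[OF sp(3) insertI1 sp(4)])
        moreover have "insert s (B - {p}) \<noteq> B" using sp(1) by blast
        ultimately show ?thesis by blast
      qed
      ultimately show ?thesis by (rule linear_quotients.insert)
    qed
  qed
  from this[OF \<open>finite F\<close>] show ?thesis by simp
qed

section \<open>Comparison of finite sets by binary weights\<close>

text \<open>For injective \<open>w\<close> this is a binary expansion: comparing weights means
  comparing sets at their difference of largest \<open>w\<close>. The values are integers so that a
  sign can reverse the order.\<close>

definition weight :: "('a \<Rightarrow> nat) \<Rightarrow> 'a set \<Rightarrow> int" where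
  "weight w A = (\<Sum>v\<in>A. 2 ^ w v)"

lemma sum_power2_less:
  assumes "inj_on w X" "\<And>v. v \<in> X \<Longrightarrow> w v < n"
  shows "(\<Sum>v\<in>X. (2::int) ^ w v) < 2 ^ n"
proof -
  have "(\<Sum>v\<in>X. (2::int) ^ w v) = (\<Sum>i\<in>w ` X. 2 ^ i)"
    using assms(1) by (simp add: sum.reindex)
  also have "\<dots> \<le> (\<Sum>i<n. 2 ^ i)"
    by (rule sum_mono2) (use assms(2) in auto)
  also have "\<dots> < 2 ^ n"
    by (induction n) auto
  finally show ?thesis .
qed

text \<open>The powers of two over \<open>B - A\<close> have distinct exponents below
  \<open>w s\<close>, so their sum stays below the single power at \<open>s\<close>.\<close>

lemma weight_less:
  assumes "finite A" "finite B" "inj_on w (A \<union> B)"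
    and s: "s \<in> A - B" "\<And>v. v \<in> B - A \<Longrightarrow> w v < w s"
  shows "weight w B < weight w A"
proof -
  have "inj_on w (B - A)" using assms(3) by (rule inj_on_subset) auto
  then have "weight w (B - A) < 2 ^ w s"
    unfolding weight_def using s(2) by (rule sum_power2_less)
  also have "2 ^ w s \<le> weight w (A - B)"
    unfolding weight_def using s(1) assms(1)
    by (intro member_le_sum[of s "A - B" "\<lambda>v. 2 ^ w v"]) auto
  finally have "weight w (B - A) < weight w (A - B)" .
  moreover have "weight w A = weight w (A \<inter> B) + weight w (A - B)"
    unfolding weight_def by (rule sum.Int_Diff) fact
  moreover have "weight w B = weight w (B \<inter> A) + weight w (B - A)"
    unfolding weight_def by (rule sum.Int_Diff) fact
  ultimately show ?thesis by (simp add: Int_commute)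
qed

text \<open>The element of the symmetric difference with the largest exponent must lie in
  \<open>A\<close>; in \<open>B\<close> it would make \<open>B\<close> the heavier set.\<close>

lemma weight_first_difference:
  assumes fin: "finite A" "finite B" and inj: "inj_on w (A \<union> B)"
    and le: "weight w B \<le> weight w A" and "A \<noteq> B"
  obtains s where "s \<in> A - B" "\<And>v. v \<in> B - A \<Longrightarrow> w v < w s"
proof -
  let ?D = "(A - B) \<union> (B - A)"
  have "finite ?D" "?D \<noteq> {}" using fin \<open>A \<noteq> B\<close> by auto
  then have "Max (w ` ?D) \<in> w ` ?D" by (intro Max_in) auto
  then obtain s where s: "s \<in> ?D" and eq: "w s = Max (w ` ?D)" by force
  have max: "w v \<le> w s" if "v \<in> ?D" for v
    unfolding eq using that \<open>finite ?D\<close> by (intro Max_ge) auto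
  have lt: "w v < w s" if "v \<in> ?D" "v \<noteq> s" for v
  proof -
    have "w v \<noteq> w s" using inj_onD[OF inj, of v s] that s by blast
    then show ?thesis using max[OF that(1)] by simp
  qed
  have "s \<in> A"
  proof (rule ccontr)
    assume "s \<notin> A"
    then have "s \<in> B - A" using s by blast
    moreover have "w v < w s" if "v \<in> A - B" for v using lt[of v] that \<open>s \<notin> A\<close> by blast
    moreover have "inj_on w (B \<union> A)" using inj by (simp add: Un_commute)
    ultimately have "weight w A < weight w B" using weight_less[OF fin(2,1)] by blast
    then show False using le by simp
  qed
  show ?thesis
  proof
    show "s \<in> A - B" using s \<open>s \<in> A\<close> by blast
    show "w v < w s" if "v \<in> B - A" for v using lt[of v] that \<open>s \<in> A\<close> by blast
  qed
qed

lemma weight_swap: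
  assumes "finite B" "inj_on w (insert s B)" "s \<notin> B" "p \<in> B" "w p < w s"
  shows "weight w B < weight w (insert s (B - {p}))"
proof (rule weight_less)
  show "inj_on w (insert s (B - {p}) \<union> B)" using assms(2) by (rule inj_on_subset) auto
  show "s \<in> insert s (B - {p}) - B" using assms by simp
  show "w v < w s" if "v \<in> B - insert s (B - {p})" for v using that assms(5) by auto
qed (use assms(1) in auto)

lemma weight_inj:
  assumes "finite A" "finite B" "inj_on w (A \<union> B)" "weight w A = weight w B"
  shows "A = B"
proof (rule ccontr)
  assume "A \<noteq> B"
  then obtain s where "s \<in> A - B" "\<And>v. v \<in> B - A \<Longrightarrow> w v < w s"
    using weight_first_difference[OF assms(1-3)] assms(4) by auto
  then have "weight w B < weight w A" using weight_less[OF assms(1-3)] by blast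
  then show False using assms by simp
qed

section \<open>Graphs of girth at least five\<close>

text \<open>\<open>H\<close> stands for the complement of the given graph. \<open>quad\<close>
  excludes 4-cycles in the form that two vertices have at most one common neighbour.\<close>

locale girth_five =
  fixes V :: "'a set" and H :: "'a \<Rightarrow> 'a \<Rightarrow> bool" and t :: nat
  assumes fin: "finite V"
    and HV: "H u v \<Longrightarrow> u \<in> V"
    and sym: "H u v \<Longrightarrow> H v u"
    and irr: "\<not> H u u"
    and tri: "H u v \<Longrightarrow> H v w \<Longrightarrow> \<not> H u w"
    and quad: "\<lbrakk>H a u; H b u; H a v; H b v\<rbrakk> \<Longrightarrow> a = b \<or> u = v"
    and t3: "t \<ge> 3"
begin

text \<open>The centre has no neighbour inside \<open>W\<close> in the complementary graph, so no
  path of that graph covers \<open>W\<close> once it has two vertices.\<close>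

definition star :: "'a set \<Rightarrow> bool" where
  "star W \<longleftrightarrow> (\<exists>c\<in>W. \<forall>u\<in>W - {c}. H c u)"

text \<open>In contrast to \<open>star\<close>, the centre lies outside \<open>W\<close>, because
  \<open>H\<close> is irreflexive.\<close>

definition leaf :: "'a set \<Rightarrow> bool" where
  "leaf W \<longleftrightarrow> (\<exists>c. \<forall>u\<in>W. H c u)"

definition nonstars :: "'a set set" where
  "nonstars = {W. W \<subseteq> V \<and> card W = t \<and> \<not> star W}"

text \<open>Two vertices of \<open>C\<close> have the common neighbour \<open>c\<close> and are
  therefore not adjacent, so only \<open>q\<close> can be the centre of the star. Then
  \<open>q\<close> and \<open>c\<close> share the neighbours \<open>u\<close> and \<open>v\<close>,
  or, if \<open>q\<close> is one of these, a triangle arises.\<close>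

lemma star_insert_leaf:
  assumes "star (insert q C)" "\<forall>u\<in>C. H c u" "u \<in> C" "v \<in> C" "u \<noteq> v"
  shows "q = c"
proof -
  obtain e where e: "e \<in> insert q C" "\<forall>u\<in>insert q C - {e}. H e u"
    using assms(1) unfolding star_def by blast
  have "e = q"
  proof (rule ccontr)
    assume "e \<noteq> q"
    then have "e \<in> C" using e by blast
    moreover obtain w where "w \<in> C" "w \<noteq> e" using assms(3-5) by metis
    ultimately have "H e w" "H c e" "H c w" using e assms(2) by auto
    then show False using tri by blast
  qed
  show ?thesis
  proof (cases "q = u \<or> q = v")
    case True
    then obtain w where "w \<in> C" "w \<noteq> q" "H c q" using assms(2-5) by metis
    then have "H q w" "H c w" using e \<open>e = q\<close> assms(2) by auto
    then show ?thesis using \<open>H c q\<close> tri by blast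
  next
    case False
    then have "H q u" "H q v" using e \<open>e = q\<close> assms by auto
    then show ?thesis using quad[of q u c v] assms by blast
  qed
qed

text \<open>\<open>C\<close> is the common part of two swaps that bring in \<open>s\<close>, and
  \<open>good\<close> speaks of the set before the swap. Two neighbourhoods have the same centre,
  and in a mixed pair the centre of the star is the centre of the neighbourhood; both contradict
  \<open>good\<close>. Two stars have distinct adjacent centres in \<open>C\<close>, and a third
  vertex of \<open>C\<close> would close a triangle.\<close>

lemma bad_pair:
  assumes pq: "p \<notin> C" "q \<notin> C" "p \<noteq> q" and s: "s \<in> C"
    and two: "u \<in> C" "v \<in> C" "u \<noteq> v"
    and badq: "star (insert q C) \<or> leaf (insert q C)"
    and badp: "star (insert p C) \<or> leaf (insert p C)"
    and good: "\<not> star (insert p (insert q (C - {s})))" "\<not> leaf (insert p (insert q (C - {s})))"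
  obtains a where "C = {s, a}" "a \<noteq> s" "H s a" "H q s \<and> H a p \<or> H q a \<and> H s p"
proof -
  have mixed: False
    if h: "star (insert x C)" "leaf (insert y C)"
      "\<not> star (insert x (insert y (C - {s})))" for x y
  proof -
    obtain c where c: "\<forall>u\<in>insert y C. H c u" using h(2) unfolding leaf_def by blast
    then have "x = c" using star_insert_leaf[OF h(1) _ two] by blast
    then show False using c h(3) unfolding star_def by blast
  qed
  show ?thesis
  proof (cases "leaf (insert q C)")
    case leafq: True
    show ?thesis
    proof (cases "leaf (insert p C)")
      case True
      then obtain c d where cd: "\<forall>u\<in>insert q C. H c u" "\<forall>u\<in>insert p C. H d u"
        using leafq unfolding leaf_def by blast
      then have "c = d" using quad[of c u d v] two by blast
      then have "leaf (insert p (insert q (C - {s})))" unfolding leaf_def using cd by blast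
      then show ?thesis using good by blast
    next
      case False
      then show ?thesis using mixed[of p q] leafq badp good(1) by blast
    qed
  next
    case False
    then have starq: "star (insert q C)" using badq by blast
    show ?thesis
    proof (cases "leaf (insert p C)")
      case True
      then show ?thesis using mixed[of q p] starq good(1) by (simp add: insert_commute)
    next
      case False
      then have starp: "star (insert p C)" using badp by blast
      obtain e where e: "e \<in> insert q C" "\<forall>u\<in>insert q C - {e}. H e u"
        using starq unfolding star_def by blast
      obtain d where d: "d \<in> insert p C" "\<forall>u\<in>insert p C - {d}. H d u"
        using starp unfolding star_def by blast
      have eC: "e \<in> C"
      proof (rule ccontr)
        assume "e \<notin> C"
        then have "\<forall>u\<in>C. H q u" using e pq by auto
        moreover have "p = q" using star_insert_leaf[OF starp calculation two] .
        ultimately show False using pq by blast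
      qed
      have dC: "d \<in> C"
      proof (rule ccontr)
        assume "d \<notin> C"
        then have "\<forall>u\<in>C. H p u" using d pq by auto
        moreover have "q = p" using star_insert_leaf[OF starq calculation two] .
        ultimately show False using pq by blast
      qed
      \<comment> \<open>A common centre would also serve the original set: from outside if it is
        \<open>s\<close>, and as the centre of a star otherwise.\<close>
      have "e \<noteq> d"
      proof
        assume "e = d"
        then have all: "\<forall>u\<in>insert p (insert q C) - {e}. H e u" using e d by blast
        show False
        proof (cases "e = s")
          case True
          then have "leaf (insert p (insert q (C - {s})))"
            unfolding leaf_def using all pq s by blast
          then show False using good by blast
        next
          case False
          then have "star (insert p (insert q (C - {s})))"
            unfolding star_def using all eC by blast
          then show False using good by blast
        qed
      qed
      have Hed: "H e d" using e dC \<open>e \<noteq> d\<close> by blast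
      have Ced: "C = {e, d}"
      proof (rule ccontr)
        assume "C \<noteq> {e, d}"
        then obtain w where w: "w \<in> C" "w \<noteq> e" "w \<noteq> d" using eC dC by blast
        then have "H e w" "H d w" using e d by auto
        then show False using tri[OF Hed, of w] by blast
      qed
      have Hq: "H e q" using e pq eC by auto
      have Hp: "H d p" using d pq dC by auto
      have "s = e \<or> s = d" using s Ced by blast
      then show ?thesis
      proof
        assume "s = e"
        then show ?thesis using that[of d] Ced Hed Hq Hp \<open>e \<noteq> d\<close> sym by blast
      next
        assume "s = d"
        then show ?thesis using that[of e] Ced Hed Hq Hp \<open>e \<noteq> d\<close> sym by blast
      qed
    qed
  qed
qed

lemma card_ge_two:
  assumes "card C \<ge> 2"
  shows "\<exists>u v. u \<in> C \<and> v \<in> C \<and> u \<noteq> v"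
proof (rule ccontr)
  assume "\<not> ?thesis"
  moreover have "finite C" using assms card.infinite by fastforce
  ultimately have "card C \<le> Suc 0" using card_le_Suc0_iff_eq[of C] by blast
  then show False using assms by simp
qed

text \<open>Both swapped sets contain \<open>insert s (B - {p, q})\<close>, which has two elements
  because \<open>t \<ge> 3\<close>; so \<open>bad_pair\<close> applies with this set as
  \<open>C\<close>.\<close>

lemma bad_swaps:
  assumes B: "B \<in> nonstars" "\<not> leaf B" and s: "s \<notin> B" and pq: "p \<in> B" "q \<in> B" "p \<noteq> q"
    and bad: "\<And>r. r \<in> {p, q} \<Longrightarrow> star (insert s (B - {r})) \<or> leaf (insert s (B - {r}))"
  obtains a where "B = {a, p, q}" "a \<noteq> p" "a \<noteq> q" "H s a" "H q s \<and> H a p \<or> H q a \<and> H s p"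
proof -
  define C where "C = insert s (B - {p, q})"
  have [simp]: "finite B" and cB: "card B \<ge> 3" and "\<not> star B"
    using B fin t3 finite_subset unfolding nonstars_def by auto
  have "card C \<ge> 2"
    unfolding C_def using s pq cB by (simp add: card_Diff_subset)
  then obtain u v where uv: "u \<in> C" "v \<in> C" "u \<noteq> v" using card_ge_two by blast
  have eqs: "insert s (B - {p}) = insert q C" "insert s (B - {q}) = insert p C"
    "insert p (insert q (C - {s})) = B"
    unfolding C_def using s pq by auto
  have "p \<notin> C" "q \<notin> C" "s \<in> C" unfolding C_def using pq s by auto
  then obtain a where a: "C = {s, a}" "a \<noteq> s" "H s a" "H q s \<and> H a p \<or> H q a \<and> H s p"
  proof (rule bad_pair[OF _ _ pq(3) _ uv])
    show "star (insert q C) \<or> leaf (insert q C)" using bad[of p] eqs by simp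
    show "star (insert p C) \<or> leaf (insert p C)" using bad[of q] eqs by simp
    show "\<not> star (insert p (insert q (C - {s})))" "\<not> leaf (insert p (insert q (C - {s})))"
      using \<open>\<not> star B\<close> B(2) eqs by simp_all
  qed
  have "B = {a, p, q}" using eqs(3) a(1,2) by auto
  moreover have "a \<noteq> p" "a \<noteq> q" using a(1) \<open>p \<notin> C\<close> \<open>q \<notin> C\<close> by auto
  ultimately show ?thesis using that a by blast
qed

lemma edge_plus_isolated:
  assumes "H x y" "\<not> H p x" "\<not> H p y" "p \<noteq> x" "p \<noteq> y"
  shows "\<not> star {x, y, p} \<and> \<not> leaf {x, y, p}"
proof
  show "\<not> star {x, y, p}"
    unfolding star_def using assms sym by blast
  show "\<not> leaf {x, y, p}"
    unfolding leaf_def using assms(1) tri sym by blast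
qed

text \<open>If two swaps fail, \<open>s\<close> and \<open>B\<close> form a path in \<open>H\<close>
  with \<open>a\<close> as an inner vertex. Giving up \<open>a\<close> leaves an edge and a vertex
  isolated from it, since chords would create short cycles; this is neither a star nor contained in
  a neighbourhood.\<close>

lemma some_good_swap:
  assumes B: "B \<in> nonstars" "\<not> leaf B" and s: "s \<notin> B"
  obtains p where "p \<in> B" "\<not> star (insert s (B - {p}))" "\<not> leaf (insert s (B - {p}))"
proof -
  have "card B \<ge> 2" using B t3 unfolding nonstars_def by auto
  then obtain p q where pq: "p \<in> B" "q \<in> B" "p \<noteq> q" using card_ge_two by blast
  show ?thesis
  proof (cases "\<forall>r\<in>{p, q}. star (insert s (B - {r})) \<or> leaf (insert s (B - {r}))")
    case False
    then show ?thesis using that pq by blast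
  next
    case True
    then obtain a where a: "B = {a, p, q}" "a \<noteq> p" "a \<noteq> q" "H s a"
      "H q s \<and> H a p \<or> H q a \<and> H s p"
      using bad_swaps[OF B s pq] by blast
    have "insert s (B - {a}) = {s, p, q}" using a by auto
    moreover have "\<not> star {s, p, q} \<and> \<not> leaf {s, p, q}"
      using a(5)
    proof
      assume h: "H q s \<and> H a p"
      have "s \<noteq> p" using s a(1) by auto
      moreover have "\<not> H p s" using h a(4) tri sym by blast
      moreover have "\<not> H p q" using quad[of p q s a] h a(3,4) sym \<open>s \<noteq> p\<close> by blast
      ultimately have "\<not> star {s, q, p} \<and> \<not> leaf {s, q, p}"
        using edge_plus_isolated[of s q p] h sym pq(3) by blast
      then show ?thesis by (simp add: insert_commute)
    next
      assume h: "H q a \<and> H s p"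
      have "s \<noteq> q" using s a(1) by auto
      moreover have "\<not> H q s" using h a(4) tri sym by blast
      moreover have "\<not> H q p" using quad[of q p s a] h a(2,4) sym \<open>s \<noteq> q\<close> by blast
      ultimately show ?thesis
        using edge_plus_isolated[of s p q] h pq(3) by blast
    qed
    ultimately show ?thesis using that[of a] a(1) by simp
  qed
qed

section \<open>The order on the sets that are not stars\<close>

text \<open>The third component of \<open>key\<close> compares sets in a vertex order that depends
  on the set itself, but only through its smallest vertex. It matters only when the second
  components agree, and then the two orders are the same.\<close>

lemma linear_quotients_nonstars: "linear_quotients nonstars"
proof -
  obtain f :: "'a \<Rightarrow> nat" and N where "f ` V = {i. i < N}" and finj: "inj_on f V"
    using finite_imp_inj_to_nat_seg[OF fin] by blast
  then have fN: "v \<in> V \<Longrightarrow> f v < N" for v by blast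
  define mn where "mn W = Min (f ` W)" for W
  define x where "x W = inv_into V f (mn W)" for W
  \<comment> \<open>Vertex numbers are below \<open>N\<close>, so adding \<open>N\<close> moves all
    H-neighbours of \<open>c\<close> behind the other vertices.\<close>
  define pos where "pos c v = f v + (if H c v then N else 0)" for c v
  \<comment> \<open>Reversing \<open>pos\<close> gives earlier vertices larger exponents; the
    negated weight in \<open>key\<close> then puts sets with earlier vertices first.\<close>
  define w where "w c v = 2 * N - pos c v" for c v
  define key where "key W = (if leaf W then 1 else 0::nat, mn W, - weight (w (x W)) W)" for W
  have pos_less: "pos c v < 2 * N" if "v \<in> V" for c v
    using fN[OF that] unfolding pos_def by auto
  have w_less: "w c p < w c s \<longleftrightarrow> pos c s < pos c p" if "p \<in> V" "s \<in> V" for c p s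
    using pos_less[OF that(1), of c] pos_less[OF that(2), of c] unfolding w_def by linarith
  have winj: "inj_on (w c) V" for c
  proof (rule inj_onI)
    fix u v assume uv: "u \<in> V" "v \<in> V" "w c u = w c v"
    then have "pos c u = pos c v" using pos_less[of u c] pos_less[of v c] unfolding w_def by linarith
    then have "f u = f v" using fN[OF uv(1)] fN[OF uv(2)] unfolding pos_def by (auto split: if_splits)
    then show "u = v" using finj uv by (auto dest: inj_onD)
  qed
  have sub: "W \<subseteq> V" "finite W" "W \<noteq> {}" "card W = t" if "W \<in> nonstars" for W
    using that fin t3 finite_subset unfolding nonstars_def by auto
  have xW: "x W \<in> W" "f (x W) = mn W" if "W \<in> nonstars" for W
  proof -
    have "mn W \<in> f ` W" unfolding mn_def using sub[OF that] by (intro Min_in) auto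
    then obtain v where "v \<in> W" "mn W = f v" by blast
    moreover have "x W = v" unfolding x_def calculation(2)
      using finj sub(1)[OF that] \<open>v \<in> W\<close> by (intro inv_into_f_f) auto
    ultimately show "x W \<in> W" "f (x W) = mn W" by simp_all
  qed
  have mn_le: "mn W \<le> f v" if "W \<in> nonstars" "v \<in> W" for W v
    unfolding mn_def using sub[OF that(1)] that(2) by (intro Min_le) auto
  have mn_eqI: "mn W = f v" if "W \<in> nonstars" "v \<in> W" "\<And>u. u \<in> W \<Longrightarrow> f v \<le> f u" for W v
    unfolding mn_def using sub[OF that(1)] that(2,3) by (intro Min_eqI) auto
  show ?thesis
  proof (rule linear_quotients_key[where key = key])
    have "nonstars \<subseteq> Pow V" unfolding nonstars_def by auto
    then show "finite nonstars" using fin finite_subset by blast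
    show "inj_on key nonstars"
    proof (rule inj_onI)
      fix A B assume A: "A \<in> nonstars" and B: "B \<in> nonstars" and "key A = key B"
      then have "mn A = mn B" "weight (w (x A)) A = weight (w (x B)) B" unfolding key_def by auto
      then have "weight (w (x A)) A = weight (w (x A)) B" unfolding x_def by simp
      moreover have "inj_on (w (x A)) (A \<union> B)"
        by (rule inj_on_subset[OF winj]) (use sub(1)[OF A] sub(1)[OF B] in blast)
      ultimately show "A = B" by (intro weight_inj[OF sub(2)[OF A] sub(2)[OF B]])
    qed
    fix A B assume A: "A \<in> nonstars" and B: "B \<in> nonstars" and less: "key A < key B"
    have swap: "insert s (B - {p}) \<in> nonstars"
      if "s \<in> V" "s \<notin> B" "p \<in> B" "\<not> star (insert s (B - {p}))" for s p
    proof -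
      have "card (insert s (B - {p})) = t"
        using that sub[OF B] t3 by simp
      then show ?thesis unfolding nonstars_def using that sub(1)[OF B] by auto
    qed
    \<comment> \<open>The smallest vertex of \<open>A\<close> precedes all of \<open>B\<close>, so
      any admissible swap that brings it in lowers the minimum.\<close>
    have first: "\<exists>s\<in>A - B. mn A = f s \<and>
        (\<forall>p\<in>B. insert s (B - {p}) \<in> nonstars \<longrightarrow> mn (insert s (B - {p})) < mn B)"
      if "mn A < mn B"
    proof (intro bexI conjI ballI impI)
      show "mn A = f (x A)" using xW[OF A] by simp
      show "x A \<in> A - B" using xW[OF A] mn_le[OF B, of "x A"] that by auto
      fix p assume "p \<in> B" "insert (x A) (B - {p}) \<in> nonstars"
      then have "mn (insert (x A) (B - {p})) \<le> f (x A)" by (intro mn_le) auto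
      then show "mn (insert (x A) (B - {p})) < mn B" using xW[OF A] that by simp
    qed
    \<comment> \<open>Here \<open>s\<close> is the first difference in the order belonging to the
      common minimum. A vertex behind \<open>s\<close> is not this minimum, so giving it up keeps
      the minimum and hence the order in which weights are compared.\<close>
    have second: "\<exists>s\<in>A - B. (\<forall>p\<in>B - A. pos (x B) s < pos (x B) p) \<and>
        (\<forall>p\<in>B. pos (x B) s < pos (x B) p \<longrightarrow> p \<noteq> x B \<and> (insert s (B - {p}) \<in> nonstars \<longrightarrow>
          (mn (insert s (B - {p})), - weight (w (x (insert s (B - {p})))) (insert s (B - {p})))
          < (mn B, - weight (w (x B)) B)))"
      if eq: "mn A = mn B" and le: "weight (w (x B)) B \<le> weight (w (x A)) A"
    proof -
      have xeq: "x A = x B" using eq unfolding x_def by simp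
      have "A \<noteq> B" using less by auto
      have "inj_on (w (x B)) (A \<union> B)"
        by (rule inj_on_subset[OF winj]) (use sub(1)[OF A] sub(1)[OF B] in blast)
      moreover have "weight (w (x B)) B \<le> weight (w (x B)) A" using le xeq by simp
      ultimately obtain s where s: "s \<in> A - B" and lt: "\<And>v. v \<in> B - A \<Longrightarrow> w (x B) v < w (x B) s"
        using weight_first_difference[OF sub(2)[OF A] sub(2)[OF B] _ _ \<open>A \<noteq> B\<close>] by blast
      have sV: "s \<in> V" using s sub(1)[OF A] by auto
      have "\<forall>p\<in>B - A. pos (x B) s < pos (x B) p"
        using lt w_less sV sub(1)[OF B] by blast
      moreover have "p \<noteq> x B \<and> (insert s (B - {p}) \<in> nonstars \<longrightarrow>
          (mn (insert s (B - {p})), - weight (w (x (insert s (B - {p})))) (insert s (B - {p})))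
          < (mn B, - weight (w (x B)) B))"
        if p: "p \<in> B" "pos (x B) s < pos (x B) p" for p
      proof (intro conjI impI)
        have "mn B \<le> f s" using mn_le[OF A, of s] s eq by simp
        then have "pos (x B) (x B) \<le> pos (x B) s"
          using xW[OF B] irr unfolding pos_def by simp
        then show "p \<noteq> x B" using p by auto
        let ?B = "insert s (B - {p})"
        assume B': "?B \<in> nonstars"
        have "mn ?B = f (x B)"
          using xW[OF B] \<open>p \<noteq> x B\<close> mn_le[OF B] \<open>mn B \<le> f s\<close> by (intro mn_eqI[OF B']) auto
        then have "mn ?B = mn B" using xW[OF B] by simp
        then have "x ?B = x B" unfolding x_def by simp
        moreover have "weight (w (x B)) B < weight (w (x B)) ?B"
        proof (rule weight_swap)
          show "inj_on (w (x B)) (insert s B)"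
            using winj sV sub(1)[OF B] inj_on_subset by blast
          show "w (x B) p < w (x B) s" using w_less p sV sub(1)[OF B] by blast
        qed (use s p sub[OF B] in auto)
        ultimately show "(mn ?B, - weight (w (x ?B)) ?B) < (mn B, - weight (w (x B)) B)"
          using \<open>mn ?B = mn B\<close> by simp
      qed
      ultimately show ?thesis using s by blast
    qed
    show "\<exists>s\<in>A - B. \<exists>p\<in>B. insert s (B - {p}) \<in> nonstars \<and> key (insert s (B - {p})) < key B"
    proof (cases "leaf B")
      case leafB: True
      then obtain c where c: "\<And>u. u \<in> B \<Longrightarrow> H c u" unfolding leaf_def by blast
      have two: "\<exists>u v. u \<in> B - {p} \<and> v \<in> B - {p} \<and> u \<noteq> v" if "p \<in> B" for p
        using that sub[OF B] t3 by (intro card_ge_two) simp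
      have inside: "\<not> star (insert s (B - {p}))" if "s \<noteq> c" "p \<in> B" for s p
        using star_insert_leaf[of s "B - {p}" c] two[OF that(2)] c that(1) by blast
      show ?thesis
      proof (cases "\<exists>s\<in>A - B. s \<noteq> c \<and> \<not> H c s")
        case True
        \<comment> \<open>Leaving all neighbourhoods lowers the first component of the key, so any
          vertex of \<open>B\<close> may be given up. Two remaining vertices determine the centre
          \<open>c\<close>, which \<open>s\<close> does not have as a neighbour.\<close>
        then obtain s where s: "s \<in> A - B" "s \<noteq> c" "\<not> H c s" by blast
        have "x B \<in> B" using xW[OF B] by simp
        let ?B = "insert s (B - {x B})"
        have "?B \<in> nonstars"
          using swap[of s "x B"] inside[OF s(2) \<open>x B \<in> B\<close>] s sub(1)[OF A] \<open>x B \<in> B\<close> by auto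
        moreover have "\<not> leaf ?B"
        proof
          assume "leaf ?B"
          then obtain d where d: "\<And>u. u \<in> ?B \<Longrightarrow> H d u" unfolding leaf_def by blast
          obtain u v where "u \<in> B - {x B}" "v \<in> B - {x B}" "u \<noteq> v"
            using two[OF \<open>x B \<in> B\<close>] by blast
          then have "c = d" using quad[of c u d v] c d by blast
          then show False using d[of s] s by simp
        qed
        ultimately show ?thesis
          using s(1) \<open>x B \<in> B\<close> leafB unfolding key_def by auto
      next
        case False
        \<comment> \<open>Now every vertex of \<open>A\<close> other than \<open>c\<close> is a
          neighbour of \<open>c\<close>, so \<open>c\<close> would be the centre of a star. Without
          \<open>c\<close>, all swaps stay inside this one neighbourhood and are automatically
          admissible.\<close>
        have "c \<notin> A"
        proof
          assume "c \<in> A"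
          then have "star A" unfolding star_def using False c by blast
          then show False using A unfolding nonstars_def by blast
        qed
        then have cA: "H c u" if "u \<in> A" for u using False c that \<open>c \<notin> A\<close> by (metis DiffI)
        then have "leaf A" unfolding leaf_def by blast
        have good: "insert s (B - {p}) \<in> nonstars \<and> leaf (insert s (B - {p}))"
          if "s \<in> A - B" "p \<in> B" for s p
        proof
          have "s \<noteq> c" using that \<open>c \<notin> A\<close> by auto
          then show "insert s (B - {p}) \<in> nonstars"
            using swap[of s p] inside[of s p] that sub(1)[OF A] by auto
          show "leaf (insert s (B - {p}))" unfolding leaf_def using c cA that by blast
        qed
        have "mn A < mn B \<or> mn A = mn B \<and> weight (w (x B)) B \<le> weight (w (x A)) A"
          using less leafB \<open>leaf A\<close> unfolding key_def by auto
        then consider "mn A < mn B" | "mn A = mn B" "weight (w (x B)) B \<le> weight (w (x A)) A"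
          by blast
        then show ?thesis
        proof cases
          case 1
          then obtain s where s: "s \<in> A - B"
            "\<forall>p\<in>B. insert s (B - {p}) \<in> nonstars \<longrightarrow> mn (insert s (B - {p})) < mn B"
            using first by blast
          have "x B \<in> B" using xW[OF B] by simp
          then have "insert s (B - {x B}) \<in> nonstars" "leaf (insert s (B - {x B}))"
            "mn (insert s (B - {x B})) < mn B" using good s by blast+
          then have "key (insert s (B - {x B})) < key B" using leafB unfolding key_def by simp
          then show ?thesis using s(1) \<open>x B \<in> B\<close> \<open>insert s (B - {x B}) \<in> nonstars\<close> by blast
        next
          case 2
          from second[OF 2] obtain s where s: "s \<in> A - B"
            "\<forall>p\<in>B - A. pos (x B) s < pos (x B) p"
            "\<forall>p\<in>B. pos (x B) s < pos (x B) p \<longrightarrow> insert s (B - {p}) \<in> nonstars \<longrightarrow>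
              (mn (insert s (B - {p})), - weight (w (x (insert s (B - {p})))) (insert s (B - {p})))
              < (mn B, - weight (w (x B)) B)"
            by blast
          have "B - A \<noteq> {}"
            using card_subset_eq[OF sub(2)[OF A], of B] sub(4)[OF A] sub(4)[OF B] s(1) by auto
          then obtain p where p: "p \<in> B - A" by blast
          let ?B = "insert s (B - {p})"
          have "?B \<in> nonstars" "leaf ?B" using good s(1) p by blast+
          moreover have "(mn ?B, - weight (w (x ?B)) ?B) < (mn B, - weight (w (x B)) B)"
            using s p \<open>?B \<in> nonstars\<close> by blast
          ultimately have "key ?B < key B" using leafB unfolding key_def by simp
          then show ?thesis using s(1) p \<open>?B \<in> nonstars\<close> by blast
        qed
      qed
    next
      case nleafB: False
      then have "\<not> leaf A" using less unfolding key_def by (auto split: if_splits)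
      have "mn A < mn B \<or> mn A = mn B \<and> weight (w (x B)) B \<le> weight (w (x A)) A"
        using \<open>\<not> leaf A\<close> less nleafB unfolding key_def by auto
      then consider "mn A < mn B" | "mn A = mn B" "weight (w (x B)) B \<le> weight (w (x A)) A"
        by blast
      then show ?thesis
      proof cases
        case 1
        then obtain s where s: "s \<in> A - B"
          "\<forall>p\<in>B. insert s (B - {p}) \<in> nonstars \<longrightarrow> mn (insert s (B - {p})) < mn B"
          using first by blast
        obtain p where p: "p \<in> B" "\<not> star (insert s (B - {p}))" "\<not> leaf (insert s (B - {p}))"
          using some_good_swap[OF B nleafB, of s] s(1) by blast
        have B': "insert s (B - {p}) \<in> nonstars" using swap[of s p] s(1) p sub(1)[OF A] by blast
        then have "key (insert s (B - {p})) < key B" using s(2) p nleafB unfolding key_def by simp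
        then show ?thesis using s(1) p B' by blast
      next
        case 2
        from second[OF 2] obtain s where s: "s \<in> A - B"
          and sp: "\<forall>p\<in>B - A. pos (x B) s < pos (x B) p"
          and after: "\<And>p. p \<in> B \<Longrightarrow> pos (x B) s < pos (x B) p \<Longrightarrow> p \<noteq> x B \<and> (insert s (B - {p}) \<in> nonstars \<longrightarrow>
            (mn (insert s (B - {p})), - weight (w (x (insert s (B - {p})))) (insert s (B - {p})))
            < (mn B, - weight (w (x B)) B))"
          by blast
        have by_swap: ?thesis
          if p: "p \<in> B" "pos (x B) s < pos (x B) p" and g: "\<not> star (insert s (B - {p}))"
            "\<not> leaf (insert s (B - {p}))" for p
        proof -
          let ?B = "insert s (B - {p})"
          have B': "?B \<in> nonstars" using swap[of s p] s p g sub(1)[OF A] by blast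
          then have "key ?B < key B" using after[OF p] g nleafB unfolding key_def by simp
          then show ?thesis using s p B' by blast
        qed
        have "B - A \<noteq> {}"
          using card_subset_eq[OF sub(2)[OF A], of B] sub(4)[OF A] sub(4)[OF B] s(1) by auto
        then obtain p where p: "p \<in> B" "p \<notin> A" by blast
        have sp': "pos (x B) s < pos (x B) p" using sp p by blast
        \<comment> \<open>If \<open>p\<close> is the only vertex of \<open>B\<close> behind
          \<open>s\<close>, then \<open>B - A = {p}\<close> and the swap produces \<open>A\<close>
          itself. Otherwise a second candidate \<open>q\<close> is available, which need not lie
          outside \<open>A\<close>.\<close>
        show ?thesis
        proof (cases "\<exists>q\<in>B - {p}. pos (x B) s < pos (x B) q")
          case True
          then obtain q where q: "q \<in> B" "p \<noteq> q" "pos (x B) s < pos (x B) q" by blast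
          show ?thesis
          proof (rule ccontr)
            assume no: "\<not> ?thesis"
            have "s \<notin> B" using s by blast
            moreover have "star (insert s (B - {r})) \<or> leaf (insert s (B - {r}))" if "r \<in> {p, q}" for r
              using that no by_swap[OF p(1) sp'] by_swap[OF q(1,3)] by blast
            ultimately obtain a where a: "B = {a, p, q}" "H s a" "H q s \<and> H a p \<or> H q a \<and> H s p"
              using bad_swaps[OF B nleafB _ p(1) q(1,2)] by blast
            \<comment> \<open>Neither \<open>p\<close> nor \<open>q\<close> is the minimum, so it is
              \<open>a\<close>. Since \<open>s\<close> is an H-neighbour of \<open>a\<close>, it
              belongs to the vertices moved back by \<open>N\<close>; then \<open>p\<close> and
              \<open>q\<close> behind it are H-neighbours of \<open>a\<close> as well, and one of
              them closes a triangle with \<open>s\<close>.\<close>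
            have xa: "x B = a" using xW[OF B] a(1) after[OF p(1) sp'] after[OF q(1,3)] by auto
            have *: "\<not> pos a s < pos a v" if "\<not> H a v" "v \<in> V" for v
              using that fN[OF that(2)] sym[OF a(2)] unfolding pos_def by simp
            have "p \<in> V" "q \<in> V" using p q sub(1)[OF B] by auto
            have "\<not> H a q \<or> \<not> H a p" using a(2,3) tri sym by blast
            then show False using * \<open>p \<in> V\<close> \<open>q \<in> V\<close> sp' q(3) xa by blast
          qed
        next
          case False
          have "B - A = {p}" using False sp p by blast
          moreover have "card B = card (B \<inter> A) + card (B - A)"
            using sub(2)[OF B] by (rule card_Int_Diff)
          ultimately have "card (A \<inter> B) + 1 = t" using sub(4)[OF B] by (simp add: Int_commute)
          moreover have "card A = card (A \<inter> B) + card (A - B)"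
            using sub(2)[OF A] by (rule card_Int_Diff)
          ultimately have "card (A - B) = 1" using sub(4)[OF A] by simp
          then have "A - B = {s}" using s by (metis card_1_singletonE singletonD)
          then have AB: "insert s (B - {p}) = A" using \<open>B - A = {p}\<close> s by blast
          then show ?thesis using A less s p by auto
        qed
      qed
    qed
  qed
qed

end

section \<open>Paths in split graphs\<close>

definition path_on :: "('a \<Rightarrow> 'a \<Rightarrow> bool) \<Rightarrow> 'a list \<Rightarrow> bool" where
  "path_on E p \<longleftrightarrow> distinct p \<and> successively E p"

definition traceable :: "('a \<Rightarrow> 'a \<Rightarrow> bool) \<Rightarrow> 'a set \<Rightarrow> bool" where
  "traceable E W \<longleftrightarrow> (\<exists>p. path_on E p \<and> set p = W)"

locale simple_graph =
  fixes V :: "'a set" and E :: "'a \<Rightarrow> 'a \<Rightarrow> bool"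
  assumes fin: "finite V"
    and EV: "E u v \<Longrightarrow> u \<in> V"
    and sym: "E u v \<Longrightarrow> E v u"
    and irr: "\<not> E u u"

locale split_graph = simple_graph +
  fixes Q I :: "'a set" and t :: nat
  assumes V: "V = Q \<union> I" "Q \<inter> I = {}"
    and clique: "\<lbrakk>u \<in> Q; v \<in> Q; u \<noteq> v\<rbrakk> \<Longrightarrow> E u v"
    and indep: "\<lbrakk>u \<in> I; v \<in> I\<rbrakk> \<Longrightarrow> \<not> E u v"
    and t2: "t \<ge> 2"
begin

definition traceables :: "'a set set" where
  "traceables = {W. W \<subseteq> V \<and> card W = t \<and> traceable E W}"

lemma traceable_subset_clique:
  assumes "W \<subseteq> Q"
  shows "traceable E W"
proof -
  have "finite W" using assms V fin finite_subset by blast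
  then obtain p where p: "set p = W" "distinct p" using finite_distinct_list by blast
  then have "successively E p"
    using assms clique unfolding successively_conv_nth
    by (metis Suc_lessD lessI n_not_Suc_n nth_eq_iff_index_eq nth_mem subsetD)
  then show ?thesis unfolding traceable_def path_on_def using p by blast
qed

lemma nbr_in_Q: "\<lbrakk>x \<in> I; E x y\<rbrakk> \<Longrightarrow> y \<in> Q"
  using indep EV sym V by blast

text \<open>The neighbours of \<open>x\<close> on the path lie in the clique, so \<open>q\<close>
  can take its place.\<close>

lemma traceable_swap_clique:
  assumes W: "W \<subseteq> V" "traceable E W" and x: "x \<in> W" "x \<in> I" and q: "q \<in> Q" "q \<notin> W"
  shows "traceable E (insert q (W - {x}))"
proof -
  obtain p where p: "distinct p" "successively E p" "set p = W"
    using W unfolding traceable_def path_on_def by blast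
  define f where "f v = (if v = x then q else v)" for v
  have "distinct (map f p)"
    using p q unfolding f_def distinct_map by (auto intro!: inj_onI split: if_splits)
  moreover have "successively E (map f p)"
    unfolding successively_map
  proof (rule successively_mono[OF p(2)])
    fix u v assume uv: "u \<in> set p" "v \<in> set p" "E u v"
    consider "u = x" | "v = x" | "u \<noteq> x" "v \<noteq> x" by blast
    then show "E (f u) (f v)"
    proof cases
      case 1
      then have "v \<in> Q" "v \<noteq> x" "v \<noteq> q" using nbr_in_Q[OF x(2)] uv irr p q by blast+
      then show ?thesis using 1 clique q unfolding f_def by auto
    next
      case 2
      then have "u \<in> Q" "u \<noteq> x" "u \<noteq> q" using nbr_in_Q[OF x(2)] uv irr p q sym by blast+
      then show ?thesis using 2 clique q unfolding f_def by auto
    next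
      case 3
      then show ?thesis using uv unfolding f_def by simp
    qed
  qed
  moreover have "set (map f p) = insert q (W - {x})"
    using p x unfolding f_def by auto
  ultimately show ?thesis unfolding traceable_def path_on_def by blast
qed

text \<open>If \<open>A\<close> offers a new clique vertex and \<open>B\<close> has a vertex in
  \<open>I\<close>, their swap lowers the first component of the key. Otherwise \<open>A\<close> and
  \<open>B\<close> either lie in the clique, where every set is traceable, or have the same clique
  part, which is the case left to \<open>exchange\<close>.\<close>

lemma linear_quotients_traceables:
  assumes exchange: "\<And>A B s. \<lbrakk>A \<in> traceables; B \<in> traceables; A \<inter> Q = B \<inter> Q; s \<in> A - B\<rbrakk> \<Longrightarrow>
    \<exists>p\<in>B - A. insert s (B - {p}) \<in> traceables"
  shows "linear_quotients traceables"
proof -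
  obtain f :: "'a \<Rightarrow> nat" where finj: "inj_on f V"
    using finite_imp_inj_to_nat_seg[OF fin] by blast
  define key where "key W = (card (W \<inter> I), - weight f W)" for W
  have sub: "W \<subseteq> V" "finite W" "card W = t" if "W \<in> traceables" for W
    using that fin finite_subset unfolding traceables_def by auto
  have finj2: "inj_on f (A \<union> B)" if "A \<in> traceables" "B \<in> traceables" for A B
    by (rule inj_on_subset[OF finj]) (use sub(1)[OF that(1)] sub(1)[OF that(2)] in blast)
  have split: "card W = card (W \<inter> I) + card (W \<inter> Q)" if "W \<subseteq> V" "finite W" for W
  proof -
    have "W - I = W \<inter> Q" using that V by blast
    then show ?thesis using card_Int_Diff[OF that(2), of I] by simp
  qed
  have swap_card: "card (insert s (B - {p})) = t" if "B \<in> traceables" "s \<notin> B" "p \<in> B" for B s p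
    using sub[OF that(1)] that t2 by simp
  have swap_weight: "weight f B < weight f (insert s (B - {p}))"
    if "B \<in> traceables" "s \<in> V" "s \<notin> B" "p \<in> B" "f p < f s" for B s p
    by (rule weight_swap[OF sub(2)[OF that(1)] _ that(3-5)], rule inj_on_subset[OF finj])
      (use that(2) sub(1)[OF that(1)] in auto)
  show ?thesis
  proof (rule linear_quotients_key[where key = key])
    have "traceables \<subseteq> Pow V" unfolding traceables_def by auto
    then show "finite traceables" using fin finite_subset by blast
    show "inj_on key traceables"
    proof (rule inj_onI)
      fix A B assume AB: "A \<in> traceables" "B \<in> traceables" "key A = key B"
      then show "A = B"
        using weight_inj[OF sub(2) sub(2) finj2] unfolding key_def by simp
    qed
    fix A B assume A: "A \<in> traceables" and B: "B \<in> traceables" and less: "key A < key B"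
    show "\<exists>s\<in>A - B. \<exists>p\<in>B. insert s (B - {p}) \<in> traceables \<and> key (insert s (B - {p})) < key B"
    proof (cases "(A - B) \<inter> Q = {} \<or> B \<inter> I = {}")
      case False
      then obtain q x where q: "q \<in> A" "q \<notin> B" "q \<in> Q" and x: "x \<in> B" "x \<in> I" by blast
      let ?B = "insert q (B - {x})"
      have "traceable E ?B"
        using B x q traceable_swap_clique[of B x q] unfolding traceables_def by auto
      moreover have "?B \<subseteq> V" using sub(1)[OF B] q(3) V by blast
      ultimately have "?B \<in> traceables"
        unfolding traceables_def using swap_card[OF B q(2) x(1)] by simp
      moreover have "card (?B \<inter> I) < card (B \<inter> I)"
        by (rule psubset_card_mono) (use sub(2)[OF B] q x V in auto)
      ultimately show ?thesis using q x unfolding key_def by auto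
    next
      case True
      have le: "card (A \<inter> I) \<le> card (B \<inter> I)" using less unfolding key_def by auto
      \<comment> \<open>Without a new clique vertex \<open>A\<close> has at most as many clique
        vertices as \<open>B\<close>, hence at least as many in \<open>I\<close>; the keys give the
        other inequality.\<close>
      have cardI: "card (A \<inter> I) = card (B \<inter> I)"
      proof (cases "B \<inter> I = {}")
        case True
        then show ?thesis using le by simp
      next
        case False
        then have "A \<inter> Q \<subseteq> B \<inter> Q" using True by blast
        then have "card (A \<inter> Q) \<le> card (B \<inter> Q)" using sub(2)[OF B] by (intro card_mono) auto
        then show ?thesis using le split[OF sub(1,2)[OF A]] split[OF sub(1,2)[OF B]]
            sub(3)[OF A] sub(3)[OF B] by simp
      qed
      then have w: "weight f B < weight f A" using less unfolding key_def by simp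
      then obtain s where s: "s \<in> A - B" and lt: "\<And>v. v \<in> B - A \<Longrightarrow> f v < f s"
        using weight_first_difference[OF sub(2)[OF A] sub(2)[OF B] finj2[OF A B] less_imp_le[OF w]]
          less by blast
      have sV: "s \<in> V" using s sub(1)[OF A] by blast
      have "\<exists>p\<in>B - A. insert s (B - {p}) \<in> traceables \<and> card (insert s (B - {p}) \<inter> I) = card (B \<inter> I)"
      proof (cases "B \<inter> I = {}")
        case True
        then have "A \<inter> I = {}" using cardI sub(2)[OF A] by simp
        then have AQ: "A \<subseteq> Q" "B \<subseteq> Q" using True sub(1)[OF A] sub(1)[OF B] V by blast+
        have "B - A \<noteq> {}"
          using card_subset_eq[OF sub(2)[OF A], of B] sub(3)[OF A] sub(3)[OF B] s by auto
        then obtain p where p: "p \<in> B - A" by blast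
        have "insert s (B - {p}) \<subseteq> Q" using AQ s by blast
        then have "insert s (B - {p}) \<in> traceables" "insert s (B - {p}) \<inter> I = {}"
          using traceable_subset_clique swap_card[OF B, of s p] s p V unfolding traceables_def by auto
        then show ?thesis using p True by auto
      next
        case False
        then have "A \<inter> Q \<subseteq> B \<inter> Q" using \<open>(A - B) \<inter> Q = {} \<or> B \<inter> I = {}\<close> by blast
        moreover have "card (A \<inter> Q) = card (B \<inter> Q)"
          using cardI split[OF sub(1,2)[OF A]] split[OF sub(1,2)[OF B]] sub(3)[OF A] sub(3)[OF B] by simp
        ultimately have eq: "A \<inter> Q = B \<inter> Q"
          using card_subset_eq[of "B \<inter> Q" "A \<inter> Q"] sub(2)[OF B] by simp
        obtain p where p: "p \<in> B - A" "insert s (B - {p}) \<in> traceables"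
          using exchange[OF A B eq s] by blast
        have "s \<in> I" "p \<in> I" using s p eq sub(1)[OF A] sub(1)[OF B] V by blast+
        then have "insert s (B - {p}) \<inter> I = insert s (B \<inter> I - {p})" by blast
        moreover have "card (insert s (B \<inter> I - {p})) = card (B \<inter> I)"
          using s p \<open>p \<in> I\<close> sub(2)[OF B] False
          by (metis DiffE IntI Int_iff card_Suc_Diff1 card_insert_disjoint finite_Diff finite_Int)
        ultimately show ?thesis using p by auto
      qed
      then obtain p where p: "p \<in> B - A" "insert s (B - {p}) \<in> traceables"
        "card (insert s (B - {p}) \<inter> I) = card (B \<inter> I)" by blast
      moreover have "weight f B < weight f (insert s (B - {p}))"
        using swap_weight[OF B sV _ _ lt[OF p(1)]] s p(1) by blast
      ultimately have "key (insert s (B - {p})) < key B" unfolding key_def by simp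
      then show ?thesis using s p by blast
    qed
  qed
qed

end

lemma path_on_append:
  assumes "path_on E xs" "path_on E ys" "set xs \<inter> set ys = {}"
    "xs \<noteq> [] \<Longrightarrow> ys \<noteq> [] \<Longrightarrow> E (last xs) (hd ys)"
  shows "path_on E (xs @ ys)"
  using assms unfolding path_on_def by (auto simp: successively_append_iff)

lemma path_on_nbr:
  assumes p: "path_on E p" "length p \<ge> 2" and sym: "\<And>u v. E u v \<Longrightarrow> E v u" and x: "x \<in> set p"
  shows "\<exists>y\<in>set p. E x y"
proof -
  have adj: "E (p ! i) (p ! Suc i)" if "Suc i < length p" for i
    using p(1) successively_nth[of E p i] that unfolding path_on_def by simp
  obtain i where i: "i < length p" "x = p ! i" using x by (metis in_set_conv_nth)
  show ?thesis
  proof (cases "Suc i < length p")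
    case True
    then show ?thesis using adj i nth_mem by blast
  next
    case False
    then obtain j where j: "i = Suc j" using i p(2) by (cases i) auto
    then have "E x (p ! j)" "p ! j \<in> set p" using adj[of j] i sym by simp_all
    then show ?thesis by blast
  qed
qed

context split_graph
begin

text \<open>\<open>A - B\<close> and \<open>B - A\<close> are disjoint subsets of \<open>I\<close>
  of equal size, so each is a single vertex and the swap produces \<open>A\<close>.\<close>

lemma linear_quotients_card_I_le_3:
  assumes "card I \<le> 3"
  shows "linear_quotients traceables"
proof (rule linear_quotients_traceables)
  fix A B s assume AB: "A \<in> traceables" "B \<in> traceables" and eq: "A \<inter> Q = B \<inter> Q" and s: "s \<in> A - B"
  have sub: "A \<subseteq> V" "B \<subseteq> V" "finite A" "finite B" "card A = card B"
    using AB fin finite_subset unfolding traceables_def by auto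
  have finI: "finite I" using fin V by simp
  have cD: "card (A - B) = card (B - A)"
    using card_Int_Diff[OF sub(3), of B] card_Int_Diff[OF sub(4), of A] sub(5) by (simp add: Int_commute)
  have AI: "A - B \<subseteq> I" "B - A \<subseteq> I" using sub eq V by blast+
  have "card (A - B) + card (B - A) = card ((A - B) \<union> (B - A))"
    using sub by (intro card_Un_disjoint[symmetric]) auto
  also have "\<dots> \<le> card I" using AI finI by (intro card_mono) auto
  finally have "card (A - B) \<le> 1" using assms cD by simp
  moreover have "card (A - B) \<noteq> 0" using s sub by auto
  ultimately have 1: "card (A - B) = 1" "card (B - A) = 1" using cD by simp_all
  obtain a where a: "A - B = {a}" using 1(1) by (rule card_1_singletonE)
  obtain p where p: "B - A = {p}" using 1(2) by (rule card_1_singletonE)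
  have "x \<in> A \<and> x \<notin> B \<longleftrightarrow> x = s" for x using a s by auto
  moreover have "x \<in> B \<and> x \<notin> A \<longleftrightarrow> x = p" for x using p by auto
  ultimately have "insert s (B - {p}) = A" by auto
  then show "\<exists>p\<in>B - A. insert s (B - {p}) \<in> traceables" using p AB by auto
qed

section \<open>Traceable sets when the vertices of \<open>I\<close> have disjoint
  neighbourhoods\<close>

definition nbrs :: "'a set \<Rightarrow> 'a \<Rightarrow> 'a set" where
  "nbrs R x = {q \<in> R. E x q}"

text \<open>The end points lie in the clique, so that disjoint blocks can be concatenated.\<close>

definition block :: "'a set \<Rightarrow> 'a list \<Rightarrow> bool" where
  "block W p \<longleftrightarrow> path_on E p \<and> set p = W \<and> (p \<noteq> [] \<longrightarrow> hd p \<in> Q \<and> last p \<in> Q)"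

lemma block_clique:
  assumes "R \<subseteq> Q"
  shows "\<exists>p. block R p"
  using traceable_subset_clique[OF assms] assms
  unfolding traceable_def block_def by (metis hd_in_set last_in_set subsetD)

text \<open>By \<open>uniq\<close> the neighbourhoods are disjoint, so each vertex of
  \<open>J\<close> can be placed between two neighbours of its own. Clique edges join these triples
  with each other and with the rest of \<open>R\<close>.\<close>

lemma block_exists:
  assumes uniq: "\<And>q x y. \<lbrakk>q \<in> Q; x \<in> I; y \<in> I; E x q; E y q\<rbrakk> \<Longrightarrow> x = y"
    and "finite J" "J \<subseteq> I" "R \<subseteq> Q" "\<And>x. x \<in> J \<Longrightarrow> card (nbrs R x) \<ge> 2"
  shows "\<exists>p. block (J \<union> R) p"
  using assms(2-)
proof (induction J arbitrary: R rule: finite_induct)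
  case empty
  then show ?case using block_clique by auto
next
  case (insert x J)
  have "card (nbrs R x) \<ge> 2" using insert by simp
  then obtain a T where "nbrs R x = insert a T" "a \<notin> T" "card T \<ge> 1"
    by (metis card_le_Suc_iff Suc_1 One_nat_def)
  then obtain b where ab: "a \<in> R" "b \<in> R" "a \<noteq> b" "E x a" "E x b"
    unfolding nbrs_def by (metis (mono_tags, lifting) One_nat_def all_not_in_conv card.empty
      insertCI mem_Collect_eq not_one_le_zero)
  have xI: "x \<in> I" and abQ: "a \<in> Q" "b \<in> Q" using insert.prems ab by auto
  have "card (nbrs (R - {a, b}) y) \<ge> 2" if "y \<in> J" for y
  proof -
    have "y \<in> I" "y \<noteq> x" using that insert by auto
    then have "nbrs (R - {a, b}) y = nbrs R y"
      unfolding nbrs_def using uniq abQ xI ab(4,5) by blast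
    then show ?thesis using insert.prems(3)[of y] that by simp
  qed
  then obtain p where p: "block (J \<union> (R - {a, b})) p"
    using insert.IH[of "R - {a, b}"] insert.prems by auto
  have "path_on E ([a, x, b] @ p)"
  proof (rule path_on_append)
    have "x \<noteq> a" "x \<noteq> b" using xI abQ V by auto
    then show "path_on E [a, x, b]" unfolding path_on_def using ab sym by auto
    show "path_on E p" using p unfolding block_def by simp
    show "set [a, x, b] \<inter> set p = {}"
      using p insert.hyps insert.prems xI abQ V unfolding block_def by auto
    assume "p \<noteq> []"
    then have "hd p \<in> set p" by simp
    then have "hd p \<in> Q" "hd p \<in> J \<union> (R - {a, b})" using p \<open>p \<noteq> []\<close> unfolding block_def by blast+
    moreover have "b \<notin> J" using abQ(2) insert.prems(1) V(2) by blast
    ultimately have "hd p \<noteq> b" by auto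
    then show "E (last [a, x, b]) (hd p)" using clique[OF abQ(2) \<open>hd p \<in> Q\<close>] \<open>hd p \<noteq> b\<close> by auto
  qed
  moreover have "set ([a, x, b] @ p) = insert x J \<union> R"
    using p ab(1,2) unfolding block_def by auto
  moreover have "hd ([a, x, b] @ p) \<in> Q" "last ([a, x, b] @ p) \<in> Q"
    using p abQ unfolding block_def by auto
  ultimately show ?case unfolding block_def by blast
qed

definition pendant :: "'a set \<Rightarrow> 'a set" where
  "pendant R = {x \<in> I. card (nbrs R x) = 1}"

text \<open>Path neighbours of a vertex of \<open>I\<close> lie in the clique, and an inner vertex
  has two of them. So a vertex with only one available neighbour must be an end of the path.\<close>

lemma traceable_imp:
  assumes W: "W \<subseteq> V" "card W \<ge> 2" "traceable E W"
  shows "\<forall>x\<in>W \<inter> I. nbrs (W \<inter> Q) x \<noteq> {}" "card (W \<inter> pendant (W \<inter> Q)) \<le> 2"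
proof -
  obtain p where p: "distinct p" "successively E p" "set p = W"
    using W unfolding traceable_def path_on_def by blast
  have len: "length p \<ge> 2" using W(2) p distinct_card by fastforce
  have adj: "E (p ! i) (p ! Suc i)" if "Suc i < length p" for i
    using successively_nth[OF p(2) that] .
  have nb: "y \<in> nbrs (W \<inter> Q) x" if "x \<in> I" "E x y" "y \<in> W" for x y
    using nbr_in_Q that unfolding nbrs_def by blast
  show "\<forall>x\<in>W \<inter> I. nbrs (W \<inter> Q) x \<noteq> {}"
    using path_on_nbr[of E p] p len sym nb unfolding path_on_def by blast
  have "W \<inter> pendant (W \<inter> Q) \<subseteq> {hd p, last p}"
  proof
    fix x assume x: "x \<in> W \<inter> pendant (W \<inter> Q)"
    then obtain i where i: "i < length p" "x = p ! i" using p by (metis Int_iff in_set_conv_nth)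
    have xI: "x \<in> I" "card (nbrs (W \<inter> Q) x) = 1" using x unfolding pendant_def by auto
    show "x \<in> {hd p, last p}"
    proof (cases "i = 0 \<or> Suc i = length p")
      case True
      have "p \<noteq> []" using len by auto
      have "i = length p - 1" if "Suc i = length p" using that by simp
      then show ?thesis using True i(2) \<open>p \<noteq> []\<close> by (auto simp: hd_conv_nth last_conv_nth)
    next
      case False
      then obtain j where j: "i = Suc j" by (cases i) auto
      have "E x (p ! j)" using adj[of j] i j sym by simp
      moreover have "p ! j \<in> W" using i j p(3) nth_mem[of j p] by simp
      ultimately have "p ! j \<in> nbrs (W \<inter> Q) x" using nb xI by blast
      moreover have "p ! Suc i \<in> nbrs (W \<inter> Q) x"
        using nb[of x "p ! Suc i"] adj[of i] xI i False p(3) nth_mem[of "Suc i" p] by simp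
      moreover have "p ! j \<noteq> p ! Suc i"
        using p(1) i j False by (simp add: nth_eq_iff_index_eq)
      ultimately show ?thesis using xI(2) by (metis card_1_singletonE singletonD)
    qed
  qed
  then have "card (W \<inter> pendant (W \<inter> Q)) \<le> card {hd p, last p}" by (intro card_mono) auto
  also have "\<dots> \<le> 2" by (simp add: card_insert_if)
  finally show "card (W \<inter> pendant (W \<inter> Q)) \<le> 2" .
qed

text \<open>The pendant vertices become ends of the path, each attached through its neighbour. The
  remaining vertices form a block, whose ends in the clique can be joined to these
  neighbours.\<close>

lemma traceableI:
  assumes uniq: "\<And>q x y. \<lbrakk>q \<in> Q; x \<in> I; y \<in> I; E x q; E y q\<rbrakk> \<Longrightarrow> x = y"
    and W: "W \<subseteq> V" and nonempty: "\<forall>x\<in>W \<inter> I. nbrs (W \<inter> Q) x \<noteq> {}"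
    and two: "card (W \<inter> pendant (W \<inter> Q)) \<le> 2"
  shows "traceable E W"
proof -
  define R where "R = W \<inter> Q"
  define P where "P = W \<inter> pendant R"
  define J where "J = W \<inter> I - P"
  have fW: "finite W" using W fin finite_subset by blast
  have fR: "finite R" using fW unfolding R_def by simp
  have fJ: "finite J" using fW unfolding J_def by simp
  have PI: "P \<subseteq> W \<inter> I" unfolding P_def pendant_def by auto
  have WJ: "W = J \<union> R \<union> P" using PI W V unfolding J_def R_def by blast
  have J2: "card (nbrs R x) \<ge> 2" if "x \<in> J" for x
  proof -
    have "nbrs R x \<noteq> {}" "card (nbrs R x) \<noteq> 1"
      using that nonempty unfolding J_def P_def R_def pendant_def by auto
    moreover have "finite (nbrs R x)" using fR unfolding nbrs_def by simp
    ultimately have "card (nbrs R x) \<noteq> 0" "card (nbrs R x) \<noteq> 1" by auto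
    then show ?thesis by linarith
  qed
  have nbr: "\<exists>a\<in>R. E x a" if "x \<in> P" for x
    using that nonempty PI unfolding nbrs_def R_def by blast
  \<comment> \<open>Taking away neighbours of pendant vertices costs the vertices of
    \<open>J\<close> nothing, because a clique vertex sees only one vertex of
    \<open>I\<close>.\<close>
  have minus: "\<exists>p. block (J \<union> (R - S)) p" if S: "S \<subseteq> Q" "\<forall>a\<in>S. \<exists>x\<in>P. E x a" for S
  proof (rule block_exists[OF uniq fJ])
    show "J \<subseteq> I" unfolding J_def by blast
    show "R - S \<subseteq> Q" unfolding R_def by blast
    fix x assume x: "x \<in> J"
    have "nbrs (R - S) x = nbrs R x"
    proof -
      have "\<not> E x a" if a: "a \<in> S" for a
      proof
        assume "E x a"
        moreover obtain y where "y \<in> P" "E y a" using S(2) a by blast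
        moreover have "a \<in> Q" "x \<in> I" "y \<in> I" using a S(1) x \<open>y \<in> P\<close> PI unfolding J_def by blast+
        ultimately have "x = y" using uniq by blast
        then show False using \<open>y \<in> P\<close> x unfolding J_def by blast
      qed
      then show ?thesis unfolding nbrs_def by blast
    qed
    then show "card (nbrs (R - S) x) \<ge> 2" using J2[OF x] by simp
  qed auto
  have disj: "x \<notin> R" "x \<notin> J" if "x \<in> P" for x
    using that PI V unfolding R_def J_def by blast+
  have RQ: "R \<subseteq> Q" and JI: "J \<inter> Q = {}" using V unfolding R_def J_def by blast+
  have cons: "path_on E (x # a # p)"
    if "x \<in> P" "a \<in> R" "E x a" "block (J \<union> T) p" "T \<subseteq> R - {a}" for x a p T
  proof -
    have "path_on E ([x, a] @ p)"
    proof (rule path_on_append)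
      show "path_on E [x, a]" using that irr unfolding path_on_def by auto
      show "path_on E p" using that unfolding block_def by simp
      show "set [x, a] \<inter> set p = {}"
        using that disj[OF that(1)] RQ JI unfolding block_def by auto
      assume "p \<noteq> []"
      then have "hd p \<in> Q" "hd p \<in> J \<union> T" using that unfolding block_def by auto
      moreover have "hd p \<noteq> a" using calculation that RQ JI by auto
      ultimately show "E (last [x, a]) (hd p)" using clique that RQ by auto
    qed
    then show ?thesis by simp
  qed
  have fP: "finite P" using fW unfolding P_def by simp
  have "card P \<le> 2" using two unfolding P_def R_def .
  then consider "card P = 0" | "card P = 1" | "card P = 2" by linarith
  then show ?thesis
  proof cases
    case 1
    then have "P = {}" using fP by simp
    then show ?thesis
      using minus[of "{}"] WJ unfolding traceable_def block_def by auto
  next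
    case 2
    then obtain x where x: "P = {x}" by (rule card_1_singletonE)
    obtain a where a: "a \<in> R" "E x a" using nbr x by blast
    obtain p where p: "block (J \<union> (R - {a})) p" using minus[of "{a}"] a x RQ by auto
    have "path_on E (x # a # p)" using cons[OF _ a p] x by blast
    moreover have "set (x # a # p) = W" using p a x WJ unfolding block_def by auto
    ultimately show ?thesis unfolding traceable_def by blast
  next
    case 3
    then obtain x y where xy: "P = {x, y}" "x \<noteq> y" by (auto simp: card_2_iff)
    obtain a where a: "a \<in> R" "E x a" using nbr xy by blast
    obtain b where b: "b \<in> R" "E y b" using nbr xy by blast
    have "a \<noteq> b" using uniq[of a x y] a b xy PI RQ by blast
    obtain p where p: "block (J \<union> (R - {a, b})) p" using minus[of "{a, b}"] a b xy RQ by auto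
    have "path_on E (x # a # p)" using cons[OF _ a p] xy by blast
    moreover have "path_on E [b, y]" using b sym irr unfolding path_on_def by auto
    moreover have "set (x # a # p) \<inter> set [b, y] = {}"
      using p a b xy \<open>a \<noteq> b\<close> disj[of x] disj[of y] RQ JI unfolding block_def by auto
    moreover have "E (last (x # a # p)) (hd [b, y])"
    proof -
      have "last (x # a # p) \<in> Q"
        using p a RQ unfolding block_def by auto
      moreover have "last (x # a # p) \<noteq> b"
        using \<open>set (x # a # p) \<inter> set [b, y] = {}\<close> by (metis Int_iff empty_iff last_in_set list.set_intros(1) list.simps(3))
      ultimately show ?thesis using clique b RQ by auto
    qed
    ultimately have "path_on E ((x # a # p) @ [b, y])" by (intro path_on_append) auto
    moreover have "set ((x # a # p) @ [b, y]) = W" using p a b xy WJ unfolding block_def by auto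
    ultimately show ?thesis unfolding traceable_def by blast
  qed
qed

text \<open>\<open>A\<close> and \<open>B\<close> have the same clique part and hence the same
  pendant vertices \<open>D\<close>, and every vertex of \<open>I\<close> in either set has a
  neighbour there. By \<open>traceableI\<close> an exchange can therefore fail only by creating a
  third pendant vertex.\<close>

lemma linear_quotients_disjoint_nbrs:
  assumes uniq: "\<And>q x y. \<lbrakk>q \<in> Q; x \<in> I; y \<in> I; E x q; E y q\<rbrakk> \<Longrightarrow> x = y"
  shows "linear_quotients traceables"
proof (rule linear_quotients_traceables)
  fix A B s assume AB: "A \<in> traceables" "B \<in> traceables" and eq: "A \<inter> Q = B \<inter> Q" and s: "s \<in> A - B"
  have sub: "A \<subseteq> V" "B \<subseteq> V" "finite A" "finite B" "card A = t" "card B = t"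
    "traceable E A" "traceable E B"
    using AB fin finite_subset unfolding traceables_def by auto
  define D where "D = pendant (B \<inter> Q)"
  have A2: "\<forall>x\<in>A \<inter> I. nbrs (B \<inter> Q) x \<noteq> {}" "card (A \<inter> D) \<le> 2"
    using traceable_imp[of A] sub t2 eq unfolding D_def by auto
  have B2: "\<forall>x\<in>B \<inter> I. nbrs (B \<inter> Q) x \<noteq> {}" "card (B \<inter> D) \<le> 2"
    using traceable_imp[of B] sub t2 unfolding D_def by auto
  have sI: "s \<in> I" using s eq sub V by blast
  have "B - A \<noteq> {}" using card_subset_eq[OF sub(3), of B] sub s by auto
  then obtain p0 where p0: "p0 \<in> B - A" by blast
  have "\<exists>p\<in>B - A. card (insert s (B - {p}) \<inter> D) \<le> 2"
  proof (cases "s \<in> D")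
    case False
    then have "insert s (B - {p0}) \<inter> D \<subseteq> B \<inter> D" by blast
    then have "card (insert s (B - {p0}) \<inter> D) \<le> card (B \<inter> D)"
      using sub(4) by (intro card_mono) auto
    then show ?thesis using B2(2) p0 by force
  next
    case True
    show ?thesis
    proof (cases "card (B \<inter> D) \<le> 1")
      case True
      have "insert s (B - {p0}) \<inter> D \<subseteq> insert s (B \<inter> D)" by blast
      then have "card (insert s (B - {p0}) \<inter> D) \<le> card (insert s (B \<inter> D))"
        using sub(4) by (intro card_mono) auto
      also have "\<dots> \<le> 2" using True sub(4) by (simp add: card_insert_if)
      finally show ?thesis using p0 by blast
    next
      case False
      \<comment> \<open>Otherwise \<open>A\<close> would contain both pendant vertices of
        \<open>B\<close> and also \<open>s\<close>. Trading one pendant vertex for another keeps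
        their number.\<close>
      have "\<exists>p. p \<in> B - A \<and> p \<in> D"
      proof (rule ccontr)
        assume "\<not> ?thesis"
        then have "insert s (B \<inter> D) \<subseteq> A \<inter> D" using s True by blast
        then have "card (insert s (B \<inter> D)) \<le> card (A \<inter> D)" using sub(3) by (intro card_mono) auto
        then show False using s sub(4) False A2(2) by simp
      qed
      then obtain p where p: "p \<in> B - A" "p \<in> D" by blast
      have "insert s (B - {p}) \<inter> D = insert s (B \<inter> D - {p})" using \<open>s \<in> D\<close> by blast
      moreover have "card (insert s (B \<inter> D - {p})) = card (B \<inter> D)"
        using s p sub(4) False by simp
      ultimately have "card (insert s (B - {p}) \<inter> D) \<le> 2" using B2(2) by simp
      then show ?thesis using p by blast
    qed
  qed
  then obtain p where p: "p \<in> B - A" "card (insert s (B - {p}) \<inter> D) \<le> 2" by blast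
  let ?B = "insert s (B - {p})"
  have pI: "p \<in> I" using p eq sub V by blast
  have BQ: "?B \<inter> Q = B \<inter> Q" using sI pI V by blast
  have "?B \<subseteq> V" using s sub by blast
  moreover have "card ?B = t" using s p sub t2 by simp
  moreover have "traceable E ?B"
  proof (rule traceableI[OF uniq])
    show "?B \<subseteq> V" by fact
    show "\<forall>x\<in>?B \<inter> I. nbrs (?B \<inter> Q) x \<noteq> {}" using A2(1) B2(1) s BQ sI by auto
    show "card (?B \<inter> pendant (?B \<inter> Q)) \<le> 2" using p(2) BQ unfolding D_def by simp
  qed auto
  ultimately show "\<exists>p\<in>B - A. insert s (B - {p}) \<in> traceables" using p unfolding traceables_def by blast
qed

end

section \<open>Gap free and claw free graphs\<close>

locale gap_claw_free_graph = simple_graph +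
  assumes gap: "\<lbrakk>E u v; E x y; u \<noteq> x; u \<noteq> y; v \<noteq> x; v \<noteq> y\<rbrakk> \<Longrightarrow> E u x \<or> E u y \<or> E v x \<or> E v y"
    and claw: "\<lbrakk>E c x; E c y; E c z; x \<noteq> y; x \<noteq> z; y \<noteq> z\<rbrakk> \<Longrightarrow> E x y \<or> E x z \<or> E y z"
    and nonisolated: "v \<in> V \<Longrightarrow> \<exists>u. E v u"
begin

definition paths :: "nat \<Rightarrow> 'a set set" where
  "paths t = {W. W \<subseteq> V \<and> card W = t \<and> traceable E W}"

definition H :: "'a \<Rightarrow> 'a \<Rightarrow> bool" where
  "H u v \<longleftrightarrow> u \<in> V \<and> v \<in> V \<and> u \<noteq> v \<and> \<not> E u v"

definition independent :: "'a set \<Rightarrow> bool" where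
  "independent S \<longleftrightarrow> S \<subseteq> V \<and> (\<forall>x\<in>S. \<forall>y\<in>S. \<not> E x y)"

section \<open>Graphs without an independent triple\<close>

text \<open>Suppose a longest path misses \<open>v\<close>. Then \<open>v\<close> sees neither end,
  so the ends are adjacent and the path closes to a cycle. Opening the cycle at a neighbour of
  \<open>v\<close> would give a longer path, so \<open>v\<close> sees no vertex of the path at all.
  An edge at \<open>v\<close> and an edge of the path then form a gap.\<close>

lemma traceable_of_no_isolated:
  assumes triple: "\<And>x y z. \<lbrakk>x \<in> V; y \<in> V; z \<in> V; x \<noteq> y; x \<noteq> z; y \<noteq> z\<rbrakk> \<Longrightarrow> E x y \<or> E x z \<or> E y z"
    and W: "W \<subseteq> V" "W \<noteq> {}" and iso: "\<And>c. c \<in> W \<Longrightarrow> \<exists>u\<in>W. E c u"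
  shows "traceable E W"
proof -
  have fW: "finite W" using W fin finite_subset by blast
  let ?P = "\<lambda>p. path_on E p \<and> set p \<subseteq> W"
  have bound: "\<forall>p. ?P p \<longrightarrow> length p < Suc (card W)"
    using fW unfolding path_on_def by (metis card_mono distinct_card less_Suc_eq_le)
  obtain c u where cu: "c \<in> W" "u \<in> W" "E c u" using W(2) iso by blast
  then have "?P [c, u]" using irr unfolding path_on_def by auto
  then obtain p where p: "?P p" and max: "\<And>q. ?P q \<Longrightarrow> length q \<le> length p"
    using ex_has_greatest_nat[of ?P "[c, u]" length "Suc (card W)"] bound by auto
  have len: "length p \<ge> 2" using max[OF \<open>?P [c, u]\<close>] by simp
  then have ne: "p \<noteq> []" by auto
  have "set p = W"
  proof (rule ccontr)
    assume "set p \<noteq> W"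
    then obtain v where v: "v \<in> W" "v \<notin> set p" using p by blast
    have anti: "\<not> E v u" if v: "v \<in> W" "v \<notin> set p" and u: "u \<in> set p" for u v
    proof
      assume vu: "E v u"
      have nhd: "\<not> E v (hd p)"
      proof
        assume "E v (hd p)"
        then have "path_on E ([v] @ p)" using p v by (intro path_on_append) (auto simp: path_on_def)
        then show False using max[of "[v] @ p"] p v by simp
      qed
      have nlast: "\<not> E (last p) v"
      proof
        assume "E (last p) v"
        then have "path_on E (p @ [v])" using p v by (intro path_on_append) (auto simp: path_on_def)
        then show False using max[of "p @ [v]"] p v by simp
      qed
      have "hd p \<noteq> last p"
        using p len ne unfolding path_on_def
        by (simp add: hd_conv_nth last_conv_nth nth_eq_iff_index_eq)
      moreover have "hd p \<in> W" "last p \<in> W" "hd p \<noteq> v" "last p \<noteq> v"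
        using p ne v by (metis hd_in_set last_in_set subsetD)+
      ultimately have cyc: "E (last p) (hd p)"
        using triple[of v "hd p" "last p"] nhd nlast v W sym by blast
      obtain xs ys where xs: "p = xs @ u # ys" using u by (meson split_list)
      have pu: "path_on E (u # ys)" "path_on E xs"
        using p unfolding xs path_on_def by (auto simp: successively_append_iff)
      have "path_on E ((u # ys) @ xs)"
      proof (rule path_on_append[OF pu])
        show "set (u # ys) \<inter> set xs = {}" using p unfolding xs path_on_def by auto
        assume "xs \<noteq> []"
        then show "E (last (u # ys)) (hd xs)" using cyc unfolding xs by simp
      qed
      then have "path_on E ([v] @ (u # ys) @ xs)"
      proof (rule path_on_append[rotated])
        show "path_on E [v]" unfolding path_on_def by simp
        show "set [v] \<inter> set ((u # ys) @ xs) = {}" using v unfolding xs by auto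
        show "E (last [v]) (hd ((u # ys) @ xs))" using vu by simp
      qed
      moreover have "set ([v] @ (u # ys) @ xs) \<subseteq> W" using p v unfolding xs by auto
      ultimately show False using max[of "[v] @ (u # ys) @ xs"] unfolding xs by simp
    qed
    \<comment> \<open>This neighbour is off the path too, and the same argument separates it from
      the path.\<close>
    obtain v' where v': "v' \<in> W" "E v v'" using iso v by blast
    have "v' \<notin> set p" using anti v v' by blast
    obtain x y ys where xy: "p = x # y # ys" using len by (metis Suc_le_length_iff numeral_2_eq_2)
    then have "E x y" using p unfolding path_on_def by simp
    then show False
      using gap[OF v'(2) \<open>E x y\<close>] anti[OF v] anti[OF v'(1) \<open>v' \<notin> set p\<close>] v \<open>v' \<notin> set p\<close> xy by auto
  qed
  then show ?thesis unfolding traceable_def using p by blast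
qed

lemma linear_quotients_no_triple:
  assumes triple: "\<And>x y z. \<lbrakk>x \<in> V; y \<in> V; z \<in> V; x \<noteq> y; x \<noteq> z; y \<noteq> z\<rbrakk> \<Longrightarrow> E x y \<or> E x z \<or> E y z"
    and t: "t \<ge> 3"
  shows "linear_quotients (paths t)"
proof -
  interpret H: girth_five V H t
  proof
    show "finite V" by (rule fin)
    show "t \<ge> 3" by (rule t)
    fix u v w a b
    show "H u v \<Longrightarrow> u \<in> V" "\<not> H u u" unfolding H_def by auto
    show "H u v \<Longrightarrow> H v u" unfolding H_def using sym by blast
    show "H u v \<Longrightarrow> H v w \<Longrightarrow> \<not> H u w" unfolding H_def using triple by blast
    assume h: "H a u" "H b u" "H a v" "H b v"
    show "a = b \<or> u = v"
    proof (rule ccontr)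
      assume neq: "\<not> ?thesis"
      \<comment> \<open>The diagonals of a 4-cycle of \<open>H\<close> are edges of the graph, as
        \<open>H\<close> has no triangle; together they form a gap.\<close>
      then have "E a b" "E u v"
        using h triple[of a b u] triple[of a u v] sym unfolding H_def by blast+
      then show False using gap[of a b u v] h unfolding H_def by blast
    qed
  qed
  \<comment> \<open>A set fails to be a star exactly when each of its vertices has a neighbour
    inside it.\<close>
  have "H.nonstars = paths t"
  proof -
    have "H.star W \<longleftrightarrow> \<not> traceable E W" if W: "W \<subseteq> V" "card W = t" for W
    proof
      assume "H.star W"
      then obtain c where c: "c \<in> W" "\<And>u. u \<in> W - {c} \<Longrightarrow> H c u" unfolding H.star_def by blast
      show "\<not> traceable E W"
      proof
        assume "traceable E W"
        then obtain p where p: "path_on E p" "set p = W" unfolding traceable_def by blast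
        then have "length p = t" using W(2) distinct_card unfolding path_on_def by metis
        then obtain y where "y \<in> W" "E c y" using path_on_nbr[OF p(1) _ sym, of c] p(2) c(1) t by auto
        then show False using c(2)[of y] irr unfolding H_def by blast
      qed
    next
      assume nt: "\<not> traceable E W"
      show "H.star W"
      proof (rule ccontr)
        assume ns: "\<not> H.star W"
        have iso: "\<exists>u\<in>W. E c u" if c: "c \<in> W" for c
        proof -
          obtain u where u: "u \<in> W - {c}" "\<not> H c u" using ns c unfolding H.star_def by blast
          then have "E c u" using subsetD[OF W(1)] c unfolding H_def by auto
          then show ?thesis using u by blast
        qed
        have "traceable E W"
        proof (rule traceable_of_no_isolated[OF _ W(1)])
          show "W \<noteq> {}" using W t by auto
          show "\<exists>u\<in>W. E c u" if "c \<in> W" for c using that by (rule iso)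
        qed (rule triple)
        then show False using nt by blast
      qed
    qed
    then show ?thesis unfolding H.nonstars_def paths_def by blast
  qed
  then show ?thesis using H.linear_quotients_nonstars by simp
qed

section \<open>Graphs with an independent triple are split graphs\<close>

definition deg :: "'a \<Rightarrow> nat" where
  "deg v = card {u. E v u}"

lemma finite_nbrs: "finite {u. E v u}"
proof (rule finite_subset[OF _ fin])
  show "{u. E v u} \<subseteq> V" using EV sym by blast
qed

text \<open>Let \<open>u\<close> and \<open>v\<close> be nonadjacent. If each has a neighbour in
  \<open>I\<close> that the other lacks, these two edges form a gap. Otherwise the neighbours of
  \<open>v\<close> in \<open>I\<close> are among those of \<open>u\<close>. Maximality of
  \<open>I\<close> and claws settle this except when \<open>v\<close> has a single neighbour
  \<open>x\<close> in \<open>I\<close>; then exchanging \<open>x\<close> for \<open>v\<close> would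
  lower the total degree, which is what \<open>min\<close> is for.\<close>

lemma complement_clique:
  assumes I: "independent I" and three: "card I \<ge> 3"
    and max: "\<And>J. independent J \<Longrightarrow> card J \<le> card I"
    and min: "\<And>J. \<lbrakk>independent J; card J = card I\<rbrakk> \<Longrightarrow> sum deg I \<le> sum deg J"
    and uv: "u \<in> V - I" "v \<in> V - I" "u \<noteq> v"
  shows "E u v"
proof (rule ccontr)
  assume "\<not> E u v"
  have fI: "finite I" using I fin finite_subset unfolding independent_def by blast
  have IV: "I \<subseteq> V" and ind: "\<And>x y. x \<in> I \<Longrightarrow> y \<in> I \<Longrightarrow> \<not> E x y"
    using I unfolding independent_def by auto
  have at_least: "\<exists>x\<in>I. E v x" if "v \<in> V - I" for v
  proof (rule ccontr)
    assume "\<not> ?thesis"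
    then have "independent (insert v I)"
      using I that irr sym unfolding independent_def by blast
    then have "card (insert v I) \<le> card I" by (rule max)
    then show False using that fI by simp
  qed
  have at_most: "x = y \<or> x = z \<or> y = z" if "x \<in> I" "y \<in> I" "z \<in> I" "E v x" "E v y" "E v z" for v x y z
    using claw[of v x y z] that ind by blast
  \<comment> \<open>The edge \<open>w z\<close> must be joined to \<open>u y\<close> and to
    \<open>v y\<close>, and only edges from \<open>w\<close> to \<open>u\<close> and
    \<open>v\<close> can do this; then \<open>w\<close> is the centre of a claw with
    \<open>u\<close>, \<open>v\<close>, \<open>z\<close>.\<close>
  have common: False
    if "\<not> E u v" "u \<noteq> v" "z \<in> I" "\<not> E u z" "\<not> E v z" "E w z" "y \<in> I" "E u y" "E v y" "\<not> E w y"
    for u v w y z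
  proof -
    have "w \<noteq> u" "w \<noteq> v" "z \<noteq> y" using that by auto
    moreover have "z \<noteq> u" "z \<noteq> v" "w \<noteq> y" using that ind sym by blast+
    ultimately have "E w u" "E w v"
      using gap[of w z u y] gap[of w z v y] that ind sym by blast+
    then show False using claw[of w u v z] that \<open>z \<noteq> u\<close> \<open>z \<noteq> v\<close> by blast
  qed
  have nested: False
    if nuv: "\<not> E u v" and uv: "u \<in> V - I" "v \<in> V - I" "u \<noteq> v" and sub: "\<And>x. x \<in> I \<Longrightarrow> E v x \<Longrightarrow> E u x" for u v
  proof -
    obtain x where x: "x \<in> I" "E v x" using at_least uv by blast
    then have ux: "E u x" using sub by blast
    show False
    proof (cases "\<exists>y\<in>I. y \<noteq> x \<and> E u y")
      case False
      \<comment> \<open>\<open>x\<close> is the only neighbour in \<open>I\<close> of both vertices,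
        so exchanging it for the two of them enlarges \<open>I\<close>.\<close>
      let ?J = "insert u (insert v (I - {x}))"
      have "independent ?J"
        using False nuv uv sub I sym irr unfolding independent_def by blast
      then have "card ?J \<le> card I" by (rule max)
      moreover have "card ?J = Suc (card I)"
        using uv x fI three by simp
      ultimately show False by simp
    next
      case True
      then obtain y where y: "y \<in> I" "y \<noteq> x" "E u y" by blast
      have "\<not> I \<subseteq> {x, y}"
      proof
        assume "I \<subseteq> {x, y}"
        then have "card I \<le> card {x, y}" by (intro card_mono) auto
        then show False using three y by simp
      qed
      then obtain z where z: "z \<in> I" "z \<noteq> x" "z \<noteq> y" by blast
      obtain w where wz: "E w z" using nonisolated z IV sym by blast
      have uz: "\<not> E u z" using at_most[of x y z u] x y z ux by blast
      then have vz: "\<not> E v z" using sub z by blast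
      show False
      proof (cases "E w x")
        case False
        then show False using common[OF nuv uv(3) z(1) uz vz wz x(1) ux x(2)] by blast
      next
        case wx: True
        have wy: "\<not> E w y" using at_most[of x y z w] x y z wx wz by blast
        show False
        proof (cases "E v y")
          case True
          then show False using common[OF nuv uv(3) z(1) uz vz wz y(1,3)] wy by blast
        next
          case vy: False
          have vonly: "x' = x" if "x' \<in> I" "E v x'" for x'
            using at_most[of x y x' u] that sub ux x y vy by blast
          have wnu: "w \<noteq> u" and wnv: "w \<noteq> v" using wz uz vz by auto
          have dI: "z \<noteq> u" "z \<noteq> v" "y \<noteq> u" "y \<noteq> v" "x \<noteq> u" "x \<noteq> v" using z y x uv by auto
          have wny: "w \<noteq> y" using wz z y ind by blast
          have wu: "E w u" using gap[of w z u y] wz y(3) wnu wny dI z(3) wy uz ind[of z y] z y sym by blast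
          have nwv: "\<not> E w v" using claw[of w u v z] wu wz nuv uz vz uv(3) dI by blast
          have "\<not> E y x" "\<not> E z x" "\<not> E z y" using ind x y z by auto
          \<comment> \<open>Suppose \<open>r\<close> does not see \<open>x\<close>. If it does not
            see \<open>z\<close> either, the gap condition joins it to \<open>w\<close>, giving a
            claw at \<open>w\<close>. If it sees \<open>z\<close>, there is a claw at
            \<open>r\<close>, with \<open>y\<close> or with \<open>u\<close> as one of its
            leaves.\<close>
          have nb: "E x r" if vr: "E v r" and rx: "r \<noteq> x" for r
          proof (rule ccontr)
            assume nxr: "\<not> E x r"
            have rI: "r \<notin> I" using vonly vr rx by blast
            then have rd: "r \<noteq> y" "r \<noteq> z" using y z by auto
            have "r \<noteq> u" "r \<noteq> w" "r \<noteq> v" using vr nuv nwv sym irr by blast+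
            show False
            proof (cases "E r z")
              case False
              then have "E w r"
                using gap[of w z v r] wz vr wnv \<open>r \<noteq> w\<close> dI rd nwv vz sym by blast
              then show False
                using claw[of w z x r] wz wx z(2) rd rx False nxr \<open>\<not> E z x\<close> sym by blast
            next
              case rz: True
              show False
              proof (cases "E r y")
                case True
                then show False
                  using claw[of r y z v] rz vr dI z(3) \<open>\<not> E z y\<close> vy vz sym by blast
              next
                case False
                then have "E r u"
                  using gap[of r v u y] vr y(3) \<open>r \<noteq> u\<close> rd uv(3) dI nuv vy sym by blast
                then show False using claw[of r u v z] rz vr uv(3) dI nuv uz vz sym by blast
              qed
            qed
          qed
          let ?J = "insert v (I - {x})"
          have "independent ?J"
            using vonly uv I sym irr unfolding independent_def by blast
          moreover have "card ?J = card I"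
            using uv x fI three by simp
          ultimately have "sum deg I \<le> sum deg ?J" by (rule min)
          moreover have "sum deg I = deg x + sum deg (I - {x})" using fI x by (simp add: sum.remove)
          moreover have "sum deg ?J = deg v + sum deg (I - {x})" using fI uv by simp
          ultimately have "deg x \<le> deg v" by simp
          \<comment> \<open>Passing from the neighbours of \<open>x\<close> to those of
            \<open>v\<close> loses \<open>u\<close> and \<open>v\<close> and gains at most
            \<open>x\<close>.\<close>
          moreover have "deg v < deg x"
          proof -
            have "{r. E v r} \<subseteq> insert x ({r. E x r} - {u, v})"
              using nb nuv irr sym by blast
            then have "deg v \<le> card (insert x ({r. E x r} - {u, v}))"
              unfolding deg_def using finite_nbrs by (intro card_mono) auto
            also have "\<dots> \<le> Suc (card ({r. E x r} - {u, v}))" by (rule card_insert_le_m1) auto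
            also have "card ({r. E x r} - {u, v}) = deg x - 2"
              unfolding deg_def using ux x(2) sym uv(3) by (subst card_Diff_subset) auto
            finally have "deg v \<le> Suc (deg x - 2)" .
            moreover have "card {u, v} \<le> deg x"
              unfolding deg_def using ux x(2) sym finite_nbrs by (intro card_mono) auto
            ultimately show ?thesis using uv(3) by simp
          qed
          ultimately show False by simp
        qed
      qed
    qed
  qed
  show False
  proof (cases "(\<forall>x\<in>I. E v x \<longrightarrow> E u x) \<or> (\<forall>x\<in>I. E u x \<longrightarrow> E v x)")
    case True
    then show False
      using nested[of u v] nested[of v u] uv \<open>\<not> E u v\<close> sym by blast
  next
    case False
    then obtain x y where "x \<in> I" "E v x" "\<not> E u x" "y \<in> I" "E u y" "\<not> E v y" by blast
    then show False
      using gap[of u y v x] uv \<open>\<not> E u v\<close> ind sym by blast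
  qed
qed

text \<open>After a vertex that sees the whole clique and disjoint neighbourhoods are dealt with,
  some clique vertex has two neighbours in \<open>I\<close>. The claw condition makes every clique
  vertex see at least one of such a pair, which bounds the size of \<open>I\<close>.\<close>

lemma linear_quotients_triple:
  assumes xyz: "x \<in> V" "y \<in> V" "z \<in> V" "x \<noteq> y" "x \<noteq> z" "y \<noteq> z" "\<not> E x y" "\<not> E x z" "\<not> E y z"
    and t: "t \<ge> 3"
  shows "linear_quotients (paths t)"
proof -
  have "{J. independent J} \<subseteq> Pow V" unfolding independent_def by auto
  then have fin_ind: "finite {J. independent J}" using fin finite_subset by blast
  have "independent {x, y, z}" unfolding independent_def using xyz irr sym by blast
  \<comment> \<open>The lexicographic minimum maximises the cardinality first and then minimises the
    total degree.\<close>
  then obtain I where "is_arg_min (\<lambda>J. (- int (card J), sum deg J)) (\<lambda>J. J \<in> {J. independent J}) I"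
    using ex_is_arg_min_if_finite[OF fin_ind] by blast
  then have I: "independent I" and
    opt: "\<And>J. independent J \<Longrightarrow> \<not> (- int (card J), sum deg J) < (- int (card I), sum deg I)"
    unfolding is_arg_min_def by auto
  have max: "card J \<le> card I" if "independent J" for J
    using opt[OF that] by auto
  have min: "sum deg I \<le> sum deg J" if "independent J" "card J = card I" for J
    using opt[OF that(1)] that(2) by auto
  have "card {x, y, z} = 3" using xyz by simp
  then have three: "card I \<ge> 3" using max[OF \<open>independent {x, y, z}\<close>] by simp
  define Q where "Q = V - I"
  have IV: "I \<subseteq> V" and ind: "\<And>x y. x \<in> I \<Longrightarrow> y \<in> I \<Longrightarrow> \<not> E x y"
    using I unfolding independent_def by auto
  have clique: "E u v" if "u \<in> Q" "v \<in> Q" "u \<noteq> v" for u v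
    using complement_clique[OF I three max min] that unfolding Q_def by blast
  have fI: "finite I" using IV fin finite_subset by blast
  have at_most: "x = y \<or> x = z \<or> y = z" if "x \<in> I" "y \<in> I" "z \<in> I" "E v x" "E v y" "E v z" for v x y z
    using claw[of v x y z] that ind by blast
  interpret S: split_graph V E Q I t
    by unfold_locales (use IV clique ind t in \<open>auto simp: Q_def\<close>)
  have S: "S.traceables = paths t" unfolding S.traceables_def paths_def ..
  show ?thesis
  proof (cases "\<exists>x\<in>I. \<forall>q\<in>Q. E x q")
    case True
    \<comment> \<open>Every clique vertex spends one of its at most two neighbours on
      \<open>x\<close>. With \<open>x\<close> moved into the clique, the neighbourhoods of the
      others are disjoint.\<close>
    then obtain x where x: "x \<in> I" "\<And>q. q \<in> Q \<Longrightarrow> E x q" by blast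
    interpret S2: split_graph V E "insert x Q" "I - {x}" t
      by unfold_locales (use IV clique ind t x sym in \<open>auto simp: Q_def\<close>)
    have "linear_quotients S2.traceables"
    proof (rule S2.linear_quotients_disjoint_nbrs)
      fix q y z assume "q \<in> insert x Q" "y \<in> I - {x}" "z \<in> I - {x}" "E y q" "E z q"
      then show "y = z" using at_most[of x y z q] x ind sym by blast
    qed
    then show ?thesis unfolding S2.traceables_def paths_def .
  next
    case not_all: False
    show ?thesis
    proof (cases "\<forall>q\<in>Q. \<forall>x\<in>I. \<forall>y\<in>I. E x q \<longrightarrow> E y q \<longrightarrow> x = y")
      case True
      have "linear_quotients S.traceables"
        by (rule S.linear_quotients_disjoint_nbrs) (use True in blast)
      then show ?thesis using S by simp
    next
      case False
      \<comment> \<open>Otherwise \<open>q\<close> would be the centre of a claw with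
        \<open>x\<close>, \<open>y\<close> and \<open>r\<close>.\<close>
      have pair: "E r x \<or> E r y" if "q \<in> Q" "r \<in> Q" "x \<in> I" "y \<in> I" "x \<noteq> y" "E q x" "E q y" for q r x y
      proof (cases "r = q")
        case False
        have "r \<noteq> x" "r \<noteq> y" using that unfolding Q_def by auto
        then show ?thesis using claw[of q x y r] that clique[of q r] False ind sym by blast
      qed (use that in blast)
      have "card I \<le> 3"
      proof (rule ccontr)
        assume "\<not> card I \<le> 3"
        then have more: "\<exists>w\<in>I. w \<notin> S" if "card S \<le> 3" "finite S" for S
          using that card_mono[of S I] by (meson le_trans subsetI)
        have Qnbr: "\<exists>p\<in>Q. E p z" if z: "z \<in> I" for z
        proof -
          obtain p where p: "E z p" using nonisolated z IV by blast
          then have "p \<in> V - I" using EV sym ind z by blast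
          then show ?thesis using p sym unfolding Q_def by blast
        qed
        \<comment> \<open>A clique vertex that misses \<open>x\<close> realises the third pair
          \<open>y\<close>, \<open>z\<close>. A clique vertex next to a fourth vertex
          \<open>w\<close> must meet all three pairs, which gives it three neighbours in
          \<open>I\<close>.\<close>
        have key: False
          if q: "q \<in> Q" "E q x" "E q y" and x: "x \<in> I" and y: "y \<in> I" "x \<noteq> y"
            and z: "z \<in> I" "z \<noteq> x" "z \<noteq> y" and p: "p \<in> Q" "E p z" "E p x" for q p x y z
        proof -
          obtain q' where q': "q' \<in> Q" "\<not> E q' x" using not_all x sym by blast
          then have "E q' y" "E q' z" using pair[of q q' x y] pair[of p q' x z] q p x y z by blast+
          obtain w where w: "w \<in> I" "w \<notin> {x, y, z}" using more[of "{x, y, z}"] y(2) z(2,3) by auto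
          obtain r where r: "r \<in> Q" "E r w" using Qnbr w by blast
          have "E r x \<or> E r y" "E r x \<or> E r z" "E r y \<or> E r z"
            using pair[of q r x y] pair[of p r x z] pair[of q' r y z] q p q' x y z r
              \<open>E q' y\<close> \<open>E q' z\<close> by blast+
          then show False
            using at_most[of w x y r] at_most[of w x z r] at_most[of w y z r] w r x y z by blast
        qed
        obtain q x y where q: "q \<in> Q" "x \<in> I" "y \<in> I" "x \<noteq> y" "E q x" "E q y"
          using False sym by blast
        obtain z where z: "z \<in> I" "z \<notin> {x, y}" using more[of "{x, y}"] q(4) by auto
        obtain p where p: "p \<in> Q" "E p z" using Qnbr z by blast
        have "E p x \<or> E p y" using pair[of q p x y] q p by blast
        then show False using key[of q x y z p] key[of q y x z p] q z p by blast
      qed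
      then show ?thesis using S.linear_quotients_card_I_le_3 S by simp
    qed
  qed
qed

theorem linear_quotients_paths:
  assumes "t \<ge> 3"
  shows "linear_quotients (paths t)"
  using linear_quotients_triple[OF _ _ _ _ _ _ _ _ _ assms] linear_quotients_no_triple[OF _ assms]
  by blast

end

section \<open>Polynomials and squarefree monomial ideals\<close>

definition polys :: "'v set \<Rightarrow> ('v, 'k::field) mpoly set" where
  "polys V = {p. \<forall>m\<in>Poly_Mapping.keys p. Poly_Mapping.keys m \<subseteq> V}"

lemma carrier_poly_ring: "carrier (poly_ring V) = polys V"
  unfolding poly_ring_def polys_def by simp

lemma keys_add_nat:
  fixes a b :: "'v \<Rightarrow>\<^sub>0 nat"
  shows "Poly_Mapping.keys (a + b) = Poly_Mapping.keys a \<union> Poly_Mapping.keys b"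
  by (auto simp: in_keys_iff lookup_add)

lemma polys_zero: "0 \<in> polys V"
  unfolding polys_def by simp

lemma polys_one: "1 \<in> polys V"
  unfolding polys_def by simp

lemma polys_add: "\<lbrakk>p \<in> polys V; q \<in> polys V\<rbrakk> \<Longrightarrow> p + q \<in> polys V"
  unfolding polys_def using Poly_Mapping.keys_add[of p q] by blast

lemma keys_uminus: "Poly_Mapping.keys (- p) = Poly_Mapping.keys (p :: 'a \<Rightarrow>\<^sub>0 'b::ab_group_add)"
  by (auto simp: in_keys_iff)

lemma polys_uminus: "p \<in> polys V \<Longrightarrow> - p \<in> polys V"
  unfolding polys_def by (simp add: keys_uminus)

lemma polys_minus: "\<lbrakk>p \<in> polys V; q \<in> polys V\<rbrakk> \<Longrightarrow> p - q \<in> polys V"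
  using polys_add[of p V "- q"] polys_uminus[of q V] by simp

lemma polys_mult:
  assumes "p \<in> polys V" "q \<in> polys V"
  shows "p * q \<in> polys V"
  unfolding polys_def
proof safe
  fix m x assume m: "m \<in> Poly_Mapping.keys (p * q)" and x: "x \<in> Poly_Mapping.keys m"
  obtain a b where "m = a + b" "a \<in> Poly_Mapping.keys p" "b \<in> Poly_Mapping.keys q"
    using m keys_mult[of p q] by blast
  then show "x \<in> V" using assms x unfolding polys_def by (auto simp: keys_add_nat)
qed

lemma polys_sum: "(\<And>i. i \<in> A \<Longrightarrow> f i \<in> polys V) \<Longrightarrow> sum f A \<in> polys V"
  by (induction A rule: infinite_finite_induct) (auto intro: polys_zero polys_add)

lemma mon_degree_superset:
  assumes "finite A" "Poly_Mapping.keys m \<subseteq> A"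
  shows "mon_degree m = (\<Sum>x\<in>A. Poly_Mapping.lookup m x)"
  unfolding mon_degree_def using assms
  by (intro sum.mono_neutral_left) (auto simp: in_keys_iff)

lemma mon_degree_add: "mon_degree (a + b) = mon_degree a + mon_degree b"
proof -
  let ?A = "Poly_Mapping.keys a \<union> Poly_Mapping.keys b"
  have "mon_degree m = (\<Sum>x\<in>?A. Poly_Mapping.lookup m x)" if "m \<in> {a, b, a + b}" for m
    using that by (intro mon_degree_superset) (auto simp: keys_add_nat)
  then show ?thesis by (simp add: lookup_add sum.distrib)
qed

lemma mon_degree_zero [simp]: "mon_degree 0 = 0"
  unfolding mon_degree_def by simp

lemma homogeneous_zero [simp]: "homogeneous 0 d"
  unfolding homogeneous_def by simp

lemma homogeneous_one: "homogeneous 1 0"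
  unfolding homogeneous_def by simp

lemma homogeneous_add: "\<lbrakk>homogeneous p d; homogeneous q d\<rbrakk> \<Longrightarrow> homogeneous (p + q) d"
  unfolding homogeneous_def using Poly_Mapping.keys_add[of p q] by blast

lemma homogeneous_uminus: "homogeneous p d \<Longrightarrow> homogeneous (- p) d"
  unfolding homogeneous_def by (simp add: keys_uminus)

lemma homogeneous_minus: "\<lbrakk>homogeneous p d; homogeneous q d\<rbrakk> \<Longrightarrow> homogeneous (p - q) d"
  using homogeneous_add[of p d "- q"] homogeneous_uminus[of q d] by simp

lemma homogeneous_mult:
  assumes "homogeneous p d" "homogeneous q e"
  shows "homogeneous (p * q) (d + e)"
  unfolding homogeneous_def
proof
  fix m assume m: "m \<in> Poly_Mapping.keys (p * q)"
  then obtain a b where "m = a + b" "a \<in> Poly_Mapping.keys p" "b \<in> Poly_Mapping.keys q"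
    using keys_mult[of p q] by blast
  then show "int (mon_degree m) = d + e"
    using assms unfolding homogeneous_def by (simp add: mon_degree_add)
qed

lemma homogeneous_sum: "(\<And>i. i \<in> A \<Longrightarrow> homogeneous (f i) d) \<Longrightarrow> homogeneous (sum f A) d"
  by (induction A rule: infinite_finite_induct) (auto intro: homogeneous_add)

section \<open>Homogeneous components and constant coefficients\<close>

definition restrict_keys :: "('a \<Rightarrow> bool) \<Rightarrow> ('a \<Rightarrow>\<^sub>0 'b::zero) \<Rightarrow> ('a \<Rightarrow>\<^sub>0 'b)" where
  "restrict_keys P p = Abs_poly_mapping (\<lambda>m. if P m then Poly_Mapping.lookup p m else 0)"

lemma lookup_restrict_keys:
  "Poly_Mapping.lookup (restrict_keys P p) m = (if P m then Poly_Mapping.lookup p m else 0)"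
proof -
  have "finite {m. (if P m then Poly_Mapping.lookup p m else 0) \<noteq> 0}"
    by (rule finite_subset[OF _ finite_keys[of p]]) (auto simp: in_keys_iff)
  then show ?thesis unfolding restrict_keys_def by (simp add: Abs_poly_mapping_inverse)
qed

lemma keys_restrict_keys: "Poly_Mapping.keys (restrict_keys P p) = {m \<in> Poly_Mapping.keys p. P m}"
  by (auto simp: in_keys_iff lookup_restrict_keys split: if_splits)

lemma restrict_keys_split:
  fixes p :: "'a \<Rightarrow>\<^sub>0 'b::ab_group_add"
  shows "p = restrict_keys P p + restrict_keys (\<lambda>m. \<not> P m) p"
  by (rule poly_mapping_eqI) (simp add: lookup_add lookup_restrict_keys)

lemma restrict_keys_add:
  fixes p :: "'a \<Rightarrow>\<^sub>0 'b::ab_group_add"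
  shows "restrict_keys P (p + q) = restrict_keys P p + restrict_keys P q"
  by (rule poly_mapping_eqI) (simp add: lookup_add lookup_restrict_keys)

lemma restrict_keys_all: "(\<And>m. m \<in> Poly_Mapping.keys p \<Longrightarrow> P m) \<Longrightarrow> restrict_keys P p = p"
  by (rule poly_mapping_eqI) (auto simp: lookup_restrict_keys in_keys_iff)

lemma restrict_keys_none: "(\<And>m. m \<in> Poly_Mapping.keys p \<Longrightarrow> \<not> P m) \<Longrightarrow> restrict_keys P p = 0"
  by (rule poly_mapping_eqI) (auto simp: lookup_restrict_keys in_keys_iff)

lemma restrict_keys_sum:
  fixes f :: "'c \<Rightarrow> 'a \<Rightarrow>\<^sub>0 'b::ab_group_add"
  shows "restrict_keys P (sum f A) = (\<Sum>i\<in>A. restrict_keys P (f i))"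
  proof -
  have "restrict_keys P (0 :: 'a \<Rightarrow>\<^sub>0 'b) = 0" by (rule restrict_keys_none) simp
  then show ?thesis by (induction A rule: infinite_finite_induct) (auto simp: restrict_keys_add)
qed

definition hcomp :: "int \<Rightarrow> ('v, 'k::field) mpoly \<Rightarrow> ('v, 'k) mpoly" where
  "hcomp d = restrict_keys (\<lambda>m. int (mon_degree m) = d)"

lemma homogeneous_hcomp: "homogeneous (hcomp d p) d"
  unfolding homogeneous_def hcomp_def by (simp add: keys_restrict_keys)

lemma hcomp_homogeneous: "homogeneous p d \<Longrightarrow> hcomp d p = p"
  unfolding homogeneous_def hcomp_def by (rule restrict_keys_all) simp

lemma polys_restrict_keys: "p \<in> polys V \<Longrightarrow> restrict_keys P p \<in> polys V"
  unfolding polys_def by (simp add: keys_restrict_keys)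

lemma polys_hcomp: "p \<in> polys V \<Longrightarrow> hcomp d p \<in> polys V"
  unfolding hcomp_def by (rule polys_restrict_keys)

lemma hcomp_sum: "hcomp d (sum f A) = (\<Sum>i\<in>A. hcomp d (f i))"
  unfolding hcomp_def by (rule restrict_keys_sum)

text \<open>The monomials of \<open>b\<close> outside degree \<open>d\<close> cannot reach degree
  \<open>d + e\<close> when multiplied by monomials of degree \<open>e\<close>.\<close>

lemma hcomp_mult_homogeneous:
  assumes f: "homogeneous f e"
  shows "hcomp (d + e) (f * b) = f * hcomp d b"
proof -
  define r where "r = restrict_keys (\<lambda>m. int (mon_degree m) \<noteq> d) b"
  have b: "b = hcomp d b + r" unfolding r_def hcomp_def by (rule restrict_keys_split)
  have "hcomp (d + e) (f * r) = 0"
    unfolding hcomp_def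
  proof (rule restrict_keys_none)
    fix m assume m: "m \<in> Poly_Mapping.keys (f * r)"
    then obtain a c where "m = a + c" "a \<in> Poly_Mapping.keys f" "c \<in> Poly_Mapping.keys r"
      using keys_mult[of f r] by blast
    then show "int (mon_degree m) \<noteq> d + e"
      using f unfolding homogeneous_def r_def by (simp add: keys_restrict_keys mon_degree_add)
  qed
  moreover have "hcomp (d + e) (f * hcomp d b) = f * hcomp d b"
    using homogeneous_mult[OF f homogeneous_hcomp[of d b]]
    by (intro hcomp_homogeneous) (simp add: add.commute)
  moreover have "f * b = f * hcomp d b + f * r"
    by (subst b) (simp add: distrib_left)
  ultimately show ?thesis unfolding hcomp_def by (simp add: restrict_keys_add)
qed

lemma lookup_single_zero_mult:
  fixes q :: "('v, 'k::field) mpoly"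
  shows "Poly_Mapping.lookup (Poly_Mapping.single 0 c * q) m = c * Poly_Mapping.lookup q m"
proof -
  have "Poly_Mapping.single 0 c * q = Poly_Mapping.map ((*) c) q"
    by (rule mult_map_scale_conv_mult[symmetric])
  then show ?thesis by (simp add: Poly_Mapping.map.rep_eq when_def)
qed

text \<open>Exponents are natural numbers, so a product of two monomials is constant only if both
  factors are. This is the multiplicativity of the map to the residue field.\<close>

lemma lookup_mult_zero:
  fixes p q :: "('v, 'k::field) mpoly"
  shows "Poly_Mapping.lookup (p * q) 0 = Poly_Mapping.lookup p 0 * Poly_Mapping.lookup q 0"
proof -
  define r where "r = restrict_keys (\<lambda>m. m \<noteq> 0) p"
  have p: "p = Poly_Mapping.single 0 (Poly_Mapping.lookup p 0) + r"
    unfolding r_def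
    by (rule poly_mapping_eqI) (auto simp: lookup_add lookup_restrict_keys lookup_single when_def)
  have "0 \<notin> Poly_Mapping.keys (r * q)"
  proof
    assume "0 \<in> Poly_Mapping.keys (r * q)"
    then obtain a b where ab: "0 = a + b" "a \<in> Poly_Mapping.keys r"
      using keys_mult[of r q] by blast
    then have "Poly_Mapping.keys a = {}" using keys_add_nat[of a b] by simp
    then have "a = 0" by (auto intro!: poly_mapping_eqI simp: in_keys_iff)
    then show False using ab(2) unfolding r_def by (simp add: keys_restrict_keys)
  qed
  then have "Poly_Mapping.lookup (r * q) 0 = 0" by (simp add: in_keys_iff)
  moreover have "p * q = Poly_Mapping.single 0 (Poly_Mapping.lookup p 0) * q + r * q"
    by (subst p) (simp add: distrib_right)
  ultimately show ?thesis by (simp add: lookup_add lookup_single_zero_mult)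
qed

section \<open>Squarefree monomials and the ideals they generate\<close>

definition expo :: "'v set \<Rightarrow> ('v \<Rightarrow>\<^sub>0 nat)" where
  "expo A = (\<Sum>x\<in>A. Poly_Mapping.single x 1)"

definition sqmon :: "'v set \<Rightarrow> ('v, 'k::field) mpoly" where
  "sqmon A = Poly_Mapping.single (expo A) 1"

lemma lookup_expo: "finite A \<Longrightarrow> Poly_Mapping.lookup (expo A) x = (if x \<in> A then 1 else 0)"
  unfolding expo_def by (simp add: lookup_sum lookup_single when_def)

lemma keys_expo: "finite A \<Longrightarrow> Poly_Mapping.keys (expo A) = A"
  by (auto simp: in_keys_iff lookup_expo split: if_splits)

lemma mon_degree_expo: "finite A \<Longrightarrow> mon_degree (expo A) = card A"
  unfolding mon_degree_def by (simp add: keys_expo lookup_expo)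

lemma homogeneous_sqmon: "finite A \<Longrightarrow> homogeneous (sqmon A) (int (card A))"
  unfolding homogeneous_def sqmon_def by (simp add: mon_degree_expo)

lemma polys_sqmon: "\<lbrakk>finite A; A \<subseteq> V\<rbrakk> \<Longrightarrow> sqmon A \<in> polys V"
  unfolding polys_def sqmon_def by (simp add: keys_expo)

lemma var_eq_sqmon: "var x = sqmon {x}"
  unfolding var_def sqmon_def expo_def by simp

lemma sqmon_insert: "\<lbrakk>finite A; x \<notin> A\<rbrakk> \<Longrightarrow> sqmon (insert x A) = var x * sqmon A"
  unfolding var_def sqmon_def expo_def by (simp add: mult_single)

lemma prod_list_var: "distinct p \<Longrightarrow> prod_list (map var p) = sqmon (set p)"
proof (induction p)
  case Nil
  show ?case by (simp add: sqmon_def expo_def)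
qed (simp add: sqmon_insert)

lemma lookup_mult_single:
  fixes c :: "('v, 'k::field) mpoly"
  shows "Poly_Mapping.lookup (c * Poly_Mapping.single k 1) (m + k) = Poly_Mapping.lookup c m"
proof -
  have "Poly_Mapping.lookup (c * Poly_Mapping.single k 1) (m + k) =
    (\<Sum>l. Poly_Mapping.lookup c l * (\<Sum>q. Poly_Mapping.lookup (Poly_Mapping.single k (1::'k)) q when m + k = l + q))"
    by (simp add: lookup_mult)
  also have "(\<lambda>l. \<Sum>q. Poly_Mapping.lookup (Poly_Mapping.single k (1::'k)) q when m + k = l + q) =
    (\<lambda>l. 1 when l = m)"
  proof
    fix l
    have "(\<Sum>q. Poly_Mapping.lookup (Poly_Mapping.single k (1::'k)) q when m + k = l + q) =
      (\<Sum>q. (1 when m + k = l + q) when q = k)"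
      by (rule Sum_any.cong) (auto simp: lookup_single when_def)
    then show "(\<Sum>q. Poly_Mapping.lookup (Poly_Mapping.single k (1::'k)) q when m + k = l + q) = (1 when l = m)"
      by (auto simp: when_def)
  qed
  finally show ?thesis by (simp add: mult_when)
qed

lemma keys_mult_sqmon:
  fixes c :: "('v, 'k::field) mpoly"
  shows "Poly_Mapping.keys (c * sqmon A) = (\<lambda>m. m + expo A) ` Poly_Mapping.keys c"
proof (intro equalityI subsetI)
  fix m assume "m \<in> Poly_Mapping.keys (c * sqmon A)"
  then show "m \<in> (\<lambda>m. m + expo A) ` Poly_Mapping.keys c"
    using keys_mult[of c "sqmon A"] unfolding sqmon_def by auto
next
  fix m assume "m \<in> (\<lambda>m. m + expo A) ` Poly_Mapping.keys c"
  then show "m \<in> Poly_Mapping.keys (c * sqmon A)"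
    unfolding sqmon_def by (auto simp: in_keys_iff lookup_mult_single)
qed

text \<open>The ideal generated by the squarefree monomials with supports in \<open>F\<close>.\<close>

definition mono_ideal :: "'v set \<Rightarrow> 'v set set \<Rightarrow> ('v, 'k::field) mpoly set" where
  "mono_ideal V F = {p \<in> polys V. \<forall>m\<in>Poly_Mapping.keys p. \<exists>A\<in>F. A \<subseteq> Poly_Mapping.keys m}"

lemma mono_ideal_zero: "0 \<in> mono_ideal V F"
  unfolding mono_ideal_def by (simp add: polys_zero)

lemma mono_ideal_add: "\<lbrakk>p \<in> mono_ideal V F; q \<in> mono_ideal V F\<rbrakk> \<Longrightarrow> p + q \<in> mono_ideal V F"
  unfolding mono_ideal_def using Poly_Mapping.keys_add[of p q] polys_add by blast

lemma mono_ideal_mult: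
  assumes "p \<in> polys V" "q \<in> mono_ideal V F"
  shows "p * q \<in> mono_ideal V F"
proof -
  have "\<exists>A\<in>F. A \<subseteq> Poly_Mapping.keys m" if m: "m \<in> Poly_Mapping.keys (p * q)" for m
  proof -
    obtain a b where ab: "m = a + b" "b \<in> Poly_Mapping.keys q" using m keys_mult[of p q] by blast
    then obtain A where "A \<in> F" "A \<subseteq> Poly_Mapping.keys b" using assms unfolding mono_ideal_def by blast
    then show ?thesis using ab(1) keys_add_nat[of a b] by auto
  qed
  then show ?thesis using assms polys_mult unfolding mono_ideal_def by blast
qed

lemma mono_ideal_uminus: "p \<in> mono_ideal V F \<Longrightarrow> - p \<in> mono_ideal V F"
  unfolding mono_ideal_def by (simp add: keys_uminus polys_uminus)

lemma sqmon_in_mono_ideal: "\<lbrakk>A \<in> F; finite A; A \<subseteq> V\<rbrakk> \<Longrightarrow> sqmon A \<in> mono_ideal V F"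
  unfolding mono_ideal_def using polys_sqmon by (auto simp: sqmon_def keys_expo)

lemma mono_ideal_empty: "mono_ideal V {} = {0}"
proof -
  have "p = 0" if "Poly_Mapping.keys p = {}" for p :: "('v, 'k::field) mpoly"
    using that by (auto intro!: poly_mapping_eqI simp: in_keys_iff)
  then show ?thesis unfolding mono_ideal_def by (auto simp: polys_zero)
qed

lemma mono_ideal_mono: "F \<subseteq> F' \<Longrightarrow> mono_ideal V F \<subseteq> mono_ideal V F'"
  unfolding mono_ideal_def by blast

lemma sqmon_factor:
  fixes p :: "('v, 'k::field) mpoly"
  assumes p: "p \<in> polys V" and A: "finite A" "\<And>m. m \<in> Poly_Mapping.keys p \<Longrightarrow> A \<subseteq> Poly_Mapping.keys m"
  shows "\<exists>c\<in>polys V. p = c * sqmon A"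
proof
  let ?c = "\<Sum>m\<in>Poly_Mapping.keys p. Poly_Mapping.single (m - expo A) (Poly_Mapping.lookup p m)"
  \<comment> \<open>Subtraction of exponents is truncated; it is exact here because \<open>A\<close>
    lies in the support of every monomial of \<open>p\<close>.\<close>
  have eq: "m - expo A + expo A = m" if "m \<in> Poly_Mapping.keys p" for m
  proof (rule poly_mapping_eqI)
    fix x
    show "Poly_Mapping.lookup (m - expo A + expo A) x = Poly_Mapping.lookup m x"
      using A(2)[OF that] A(1) by (auto simp: lookup_add lookup_minus lookup_expo in_keys_iff)
  qed
  have "?c * sqmon A =
    (\<Sum>m\<in>Poly_Mapping.keys p. Poly_Mapping.single (m - expo A + expo A) (Poly_Mapping.lookup p m))"
    unfolding sqmon_def by (simp add: sum_distrib_right mult_single)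
  also have "\<dots> = (\<Sum>m\<in>Poly_Mapping.keys p. Poly_Mapping.single m (Poly_Mapping.lookup p m))"
    using eq by (intro sum.cong) auto
  also have "\<dots> = p"
    by (rule poly_mapping_eqI) (auto simp: lookup_sum lookup_single when_def in_keys_iff)
  finally show "p = ?c * sqmon A" by simp
  show "?c \<in> polys V"
  proof (rule polys_sum)
    fix m assume m: "m \<in> Poly_Mapping.keys p"
    have "Poly_Mapping.keys (m - expo A) \<subseteq> Poly_Mapping.keys m"
      by (auto simp: in_keys_iff lookup_minus)
    then show "Poly_Mapping.single (m - expo A) (Poly_Mapping.lookup p m) \<in> polys V"
      using p m unfolding polys_def by auto
  qed
qed

text \<open>The monomials divisible by a member of \<open>F\<close> make up \<open>u\<close>; all
  others must be divisible by \<open>sqmon A\<close>.\<close>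

lemma mono_ideal_insertE:
  assumes "p \<in> mono_ideal V (insert A F)" "finite A"
  obtains u c where "u \<in> mono_ideal V F" "c \<in> polys V" "p = u + c * sqmon A"
proof -
  let ?P = "\<lambda>m. \<exists>B\<in>F. B \<subseteq> Poly_Mapping.keys m"
  have "restrict_keys ?P p \<in> mono_ideal V F"
    using assms unfolding mono_ideal_def by (auto simp: keys_restrict_keys intro: polys_restrict_keys)
  moreover
  have "\<exists>c\<in>polys V. restrict_keys (\<lambda>m. \<not> ?P m) p = c * sqmon A"
    using assms by (intro sqmon_factor polys_restrict_keys) (auto simp: mono_ideal_def keys_restrict_keys)
  then obtain c where c: "c \<in> polys V" "restrict_keys (\<lambda>m. \<not> ?P m) p = c * sqmon A" by blast
  have "p = restrict_keys ?P p + restrict_keys (\<lambda>m. \<not> ?P m) p" by (rule restrict_keys_split)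
  then have "p = restrict_keys ?P p + c * sqmon A" unfolding c(2) .
  ultimately show ?thesis using that c(1) by blast
qed

section \<open>Vectors with linear quotients by variables\<close>

text \<open>Vectors are infinite sequences, so that modules of all ranks share one type; finite
  support is stated only where it matters.\<close>

type_synonym ('v, 'k) fvec = "nat \<Rightarrow> ('v, 'k) mpoly"

definition smul :: "('v, 'k::field) mpoly \<Rightarrow> ('v, 'k) fvec \<Rightarrow> ('v, 'k) fvec" where
  "smul c g = (\<lambda>a. c * g a)"

lemma smul_simps:
  "smul c (u + v) = smul c u + smul c v" "smul c 0 = 0" "smul 0 g = 0" "smul 1 g = g"
  "smul (c + d) g = smul c g + smul d g" "smul c (smul d g) = smul (c * d) g"
  "smul (- c) g = - smul c g" "smul (c - d) g = smul c g - smul d g"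
  unfolding smul_def by (auto simp: fun_eq_iff algebra_simps)

text \<open>Adding one multiple of a generator at a time gives an induction without families of
  coefficients.\<close>

inductive in_span :: "'v set \<Rightarrow> ('v, 'k::field) fvec set \<Rightarrow> ('v, 'k) fvec \<Rightarrow> bool" for V G where
  zero: "in_span V G 0"
| add: "\<lbrakk>in_span V G u; c \<in> polys V; g \<in> G\<rbrakk> \<Longrightarrow> in_span V G (u + smul c g)"

definition poly_span :: "'v set \<Rightarrow> ('v, 'k::field) fvec set \<Rightarrow> ('v, 'k) fvec set" where
  "poly_span V G = {v. in_span V G v}"

lemma poly_span_zero: "0 \<in> poly_span V G"
  unfolding poly_span_def by (simp add: in_span.zero)

lemma poly_span_step: "\<lbrakk>u \<in> poly_span V G; c \<in> polys V; g \<in> G\<rbrakk> \<Longrightarrow> u + smul c g \<in> poly_span V G"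
  unfolding poly_span_def by (simp add: in_span.add)

lemma poly_span_subsetI:
  assumes "0 \<in> M" "\<And>u c g. \<lbrakk>u \<in> M; c \<in> polys V; g \<in> G\<rbrakk> \<Longrightarrow> u + smul c g \<in> M"
  shows "poly_span V G \<subseteq> M"
proof
  fix v assume "v \<in> poly_span V G"
  then show "v \<in> M"
    using in_span.induct[of V G v "\<lambda>w. w \<in> M"] assms unfolding poly_span_def by blast
qed

lemma poly_span_empty: "poly_span V {} = {0}"
  using poly_span_subsetI[of "{0}" V "{}"] poly_span_zero by blast

lemma poly_span_insert:
  fixes s :: "('v, 'k::field) fvec"
  shows "v \<in> poly_span V (insert s G) \<longleftrightarrow> (\<exists>u\<in>poly_span V G. \<exists>c\<in>polys V. v = u + smul c s)"
proof
  let ?M = "{v. \<exists>u\<in>poly_span V G. \<exists>c\<in>polys V. v = u + smul c s}"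
  have "poly_span V (insert s G) \<subseteq> ?M"
  proof (rule poly_span_subsetI)
    have "0 = 0 + smul 0 s" by (simp add: smul_simps)
    then show "0 \<in> ?M" using poly_span_zero polys_zero by blast
    fix v g :: "('v, 'k) fvec" and c :: "('v, 'k) mpoly" assume "v \<in> ?M" and c: "c \<in> polys V" and g: "g \<in> insert s G"
    then obtain u d where ud: "u \<in> poly_span V G" "d \<in> polys V" "v = u + smul d s" by blast
    show "v + smul c g \<in> ?M"
    proof (cases "g = s")
      case True
      then have "v + smul c g = u + smul (d + c) s" using ud by (simp add: smul_simps add.assoc)
      then show ?thesis using ud c polys_add by blast
    next
      case False
      then have "u + smul c g \<in> poly_span V G" using ud c g by (intro poly_span_step) auto
      moreover have "v + smul c g = (u + smul c g) + smul d s" using ud by (simp add: ac_simps)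
      ultimately show ?thesis using ud by blast
    qed
  qed
  then show "v \<in> poly_span V (insert s G) \<Longrightarrow> \<exists>u\<in>poly_span V G. \<exists>c\<in>polys V. v = u + smul c s"
    by blast
  have mono: "poly_span V G \<subseteq> poly_span V (insert s G)"
    by (rule poly_span_subsetI) (auto intro: poly_span_zero poly_span_step)
  assume "\<exists>u\<in>poly_span V G. \<exists>c\<in>polys V. v = u + smul c s"
  then show "v \<in> poly_span V (insert s G)" using mono by (auto intro: poly_span_step)
qed

section \<open>Linear combinations, syzygies and colon ideals\<close>

definition lincomb :: "('v, 'k::field) fvec list \<Rightarrow> (nat \<Rightarrow> ('v, 'k) mpoly) \<Rightarrow> ('v, 'k) fvec" where
  "lincomb gs z = (\<lambda>a. \<Sum>k<length gs. z k * (gs ! k) a)"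

lemma lincomb_snoc: "lincomb (gs @ [s]) z = lincomb gs z + smul (z (length gs)) s"
proof
  fix a
  have "(\<Sum>k<length gs. z k * ((gs @ [s]) ! k) a) = (\<Sum>k<length gs. z k * (gs ! k) a)"
    by (rule sum.cong) (auto simp: nth_append)
  then show "lincomb (gs @ [s]) z a = (lincomb gs z + smul (z (length gs)) s) a"
    unfolding lincomb_def smul_def by simp
qed

lemma lincomb_cong: "(\<And>k. k < length gs \<Longrightarrow> z k = z' k) \<Longrightarrow> lincomb gs z = lincomb gs z'"
  unfolding lincomb_def by (auto simp: fun_eq_iff intro: sum.cong)

lemma lincomb_add: "lincomb gs (z + z') = lincomb gs z + lincomb gs z'"
  unfolding lincomb_def by (auto simp: fun_eq_iff sum.distrib distrib_right)

lemma lincomb_smul: "lincomb gs (smul c z) = smul c (lincomb gs z)"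
  unfolding lincomb_def smul_def by (auto simp: fun_eq_iff sum_distrib_left mult.assoc)

lemma lincomb_uminus: "lincomb gs (- z) = - lincomb gs z"
  unfolding lincomb_def by (auto simp: fun_eq_iff sum_negf)

lemma poly_span_set_iff:
  "v \<in> poly_span V (set gs) \<longleftrightarrow>
    (\<exists>z. (\<forall>k. z k \<in> polys V) \<and> (\<forall>k\<ge>length gs. z k = 0) \<and> v = lincomb gs z)"
proof (induction gs arbitrary: v rule: rev_induct)
  case Nil
  have "v \<in> poly_span V {} \<longleftrightarrow> v = 0"
    by (simp add: poly_span_empty)
  then show ?case unfolding lincomb_def by (auto simp: fun_eq_iff polys_zero intro: exI[of _ "\<lambda>_. 0"])
next
  case (snoc s gs)
  show ?case
  proof
    assume "v \<in> poly_span V (set (gs @ [s]))"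
    then obtain u c where u: "u \<in> poly_span V (set gs)" and c: "c \<in> polys V" "v = u + smul c s"
      using poly_span_insert[of v V s "set gs"] by auto
    then obtain z where z: "\<forall>k. z k \<in> polys V" "\<forall>k\<ge>length gs. z k = 0" "u = lincomb gs z"
      using snoc by blast
    have "lincomb gs (z(length gs := c)) = lincomb gs z" by (rule lincomb_cong) auto
    then have "v = lincomb (gs @ [s]) (z(length gs := c))" using z c by (simp add: lincomb_snoc)
    moreover have "\<forall>k. (z(length gs := c)) k \<in> polys V" using z c by simp
    moreover have "\<forall>k\<ge>length (gs @ [s]). (z(length gs := c)) k = 0" using z by simp
    ultimately show "\<exists>z. (\<forall>k. z k \<in> polys V) \<and> (\<forall>k\<ge>length (gs @ [s]). z k = 0) \<and>
      v = lincomb (gs @ [s]) z" by blast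
  next
    assume "\<exists>z. (\<forall>k. z k \<in> polys V) \<and> (\<forall>k\<ge>length (gs @ [s]). z k = 0) \<and> v = lincomb (gs @ [s]) z"
    then obtain z where z: "\<forall>k. z k \<in> polys V" "v = lincomb (gs @ [s]) z" by blast
    have "lincomb gs z = lincomb gs (\<lambda>k. if k < length gs then z k else 0)"
      by (rule lincomb_cong) auto
    moreover have "lincomb gs (\<lambda>k. if k < length gs then z k else 0) \<in> poly_span V (set gs)"
      unfolding snoc using z by (intro exI[of _ "\<lambda>k. if k < length gs then z k else 0"]) (auto simp: polys_zero)
    ultimately show "v \<in> poly_span V (set (gs @ [s]))"
      using z poly_span_insert[of v V s "set gs"] by (auto simp: lincomb_snoc)
  qed
qed

definition syzygies :: "'v set \<Rightarrow> ('v, 'k::field) fvec list \<Rightarrow> ('v, 'k) fvec set" where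
  "syzygies V gs = {z. (\<forall>k. z k \<in> polys V) \<and> (\<forall>k\<ge>length gs. z k = 0) \<and> lincomb gs z = 0}"

definition var_ideal :: "'v set \<Rightarrow> 'v set \<Rightarrow> ('v, 'k::field) mpoly set" where
  "var_ideal V X = mono_ideal V ((\<lambda>x. {x}) ` X)"

text \<open>This is the module version of linear quotients: the equivalence says that the colon
  ideal of the span of \<open>gs\<close> by \<open>s\<close> is generated by the variables in
  \<open>X\<close>.\<close>

inductive variable_quotients :: "'v set \<Rightarrow> ('v, 'k::field) fvec list \<Rightarrow> bool" for V where
  Nil: "variable_quotients V []"
| snoc: "\<lbrakk>variable_quotients V gs; finite X; X \<subseteq> V;
    \<And>c. c \<in> polys V \<Longrightarrow> smul c s \<in> poly_span V (set gs) \<longleftrightarrow> c \<in> var_ideal V X\<rbrakk> \<Longrightarrow>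
    variable_quotients V (gs @ [s])"

definition homogeneous_vecs :: "'v set \<Rightarrow> int \<Rightarrow> ('v, 'k::field) fvec list \<Rightarrow> bool" where
  "homogeneous_vecs V e gs \<longleftrightarrow> (\<forall>g\<in>set gs. \<forall>a. g a \<in> polys V \<and> homogeneous (g a) e)"

text \<open>Multiplying a monomial by \<open>x\<close> adds only \<open>x\<close> to its support,
  which is not in \<open>X\<close>. So the ideal generated by \<open>X\<close> is its own colon
  ideal by \<open>x\<close>.\<close>

lemma var_mult_mem_var_ideal:
  assumes "c \<in> polys V" "x \<in> V" "x \<notin> X"
  shows "c * var x \<in> var_ideal V X \<longleftrightarrow> c \<in> var_ideal V X"
proof -
  have "c * var x \<in> polys V"
    using assms polys_mult polys_sqmon[of "{x}" V] unfolding var_eq_sqmon by blast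
  moreover have "\<exists>A\<in>(\<lambda>x. {x}) ` X. A \<subseteq> Poly_Mapping.keys (m + expo {x}) \<longleftrightarrow>
    A \<subseteq> Poly_Mapping.keys m" if "X \<noteq> {}" for m :: "'a \<Rightarrow>\<^sub>0 nat"
    using that assms(3) by (auto simp: keys_add_nat keys_expo)
  ultimately show ?thesis
    using assms unfolding var_ideal_def mono_ideal_def var_eq_sqmon
    by (auto simp: keys_mult_sqmon keys_add_nat keys_expo)
qed

text \<open>The coefficients expressing \<open>var x\<close> times \<open>s\<close> through
  \<open>gs\<close> need not be homogeneous. All vectors have degree \<open>e\<close>, so comparing
  components of degree \<open>1 + e\<close> shows that the linear parts of the coefficients already
  suffice.\<close>

lemma homogeneous_syzygy:
  assumes hom: "homogeneous_vecs V e gs" "homogeneous_vecs V e [s]"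
    and x: "x \<in> V" "smul (var x) s \<in> poly_span V (set gs)"
  obtains z where "z \<in> syzygies V (gs @ [s])" "z (length gs) = var x" "\<And>k. homogeneous (z k) 1"
proof -
  let ?n = "length gs"
  obtain b where b: "\<forall>k. b k \<in> polys V" "smul (var x) s = lincomb gs b"
    using x(2) unfolding poly_span_set_iff by blast
  define z where "z k = (if k < ?n then - hcomp 1 (b k) else if k = ?n then var x else 0)" for k
  have hv: "homogeneous (var x) 1" "var x \<in> polys V"
    using homogeneous_sqmon[of "{x}"] polys_sqmon[of "{x}" V] x unfolding var_eq_sqmon by auto
  have "lincomb (gs @ [s]) z a = 0" for a
  proof -
    have sa: "homogeneous (s a) e" using hom(2) unfolding homogeneous_vecs_def by simp
    have ga: "homogeneous ((gs ! k) a) e" if "k < ?n" for k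
      using hom(1) that unfolding homogeneous_vecs_def by simp
    have "s a * var x = lincomb gs b a"
      using b(2) unfolding smul_def by (metis mult.commute)
    then have "hcomp (1 + e) (s a * var x) = hcomp (1 + e) (\<Sum>k<?n. b k * (gs ! k) a)"
      unfolding lincomb_def by simp
    moreover have "hcomp (1 + e) (s a * var x) = s a * var x"
      unfolding hcomp_mult_homogeneous[OF sa] hcomp_homogeneous[OF hv(1)] ..
    moreover have "hcomp (1 + e) (\<Sum>k<?n. b k * (gs ! k) a) = (\<Sum>k<?n. hcomp 1 (b k) * (gs ! k) a)"
      unfolding hcomp_sum using hcomp_mult_homogeneous[OF ga]
      by (intro sum.cong) (auto simp: mult.commute)
    moreover have "(\<Sum>k<?n. z k * (gs ! k) a) = - (\<Sum>k<?n. hcomp 1 (b k) * (gs ! k) a)"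
      unfolding sum_negf[symmetric] z_def by (rule sum.cong) auto
    ultimately show ?thesis
      unfolding lincomb_snoc by (simp add: lincomb_def smul_def z_def mult.commute)
  qed
  then have "lincomb (gs @ [s]) z = 0" by (simp add: fun_eq_iff)
  then have "z \<in> syzygies V (gs @ [s])"
    unfolding syzygies_def z_def using b(1) hv(2)
    by (auto simp: polys_zero intro!: polys_uminus polys_hcomp)
  moreover have "z ?n = var x" unfolding z_def by simp
  moreover have "homogeneous (z k) 1" for k
    unfolding z_def using hv homogeneous_hcomp homogeneous_uminus by auto
  ultimately show ?thesis using that by blast
qed

lemma syzygies_add: "\<lbrakk>z \<in> syzygies V gs; z' \<in> syzygies V gs\<rbrakk> \<Longrightarrow> z + z' \<in> syzygies V gs"
  unfolding syzygies_def by (auto simp: lincomb_add polys_add)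

lemma syzygies_smul: "\<lbrakk>z \<in> syzygies V gs; c \<in> polys V\<rbrakk> \<Longrightarrow> smul c z \<in> syzygies V gs"
  unfolding syzygies_def by (auto simp: lincomb_smul smul_simps) (auto simp: smul_def polys_mult)

lemma syzygies_uminus: "z \<in> syzygies V gs \<Longrightarrow> - z \<in> syzygies V gs"
  unfolding syzygies_def by (auto simp: lincomb_uminus polys_uminus)

lemma syzygies_snoc_zero:
  "{z \<in> syzygies V (gs @ [s]). z (length gs) = 0} = syzygies V gs"
proof (intro equalityI subsetI)
  fix z assume z: "z \<in> {z \<in> syzygies V (gs @ [s]). z (length gs) = 0}"
  then have "z k = 0" if "k \<ge> length gs" for k
    using that unfolding syzygies_def by (cases "k = length gs") auto
  then show "z \<in> syzygies V gs"
    using z unfolding syzygies_def by (auto simp: lincomb_snoc smul_simps)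
next
  fix z assume "z \<in> syzygies V gs"
  then show "z \<in> {z \<in> syzygies V (gs @ [s]). z (length gs) = 0}"
    unfolding syzygies_def by (auto simp: lincomb_snoc smul_simps)
qed

text \<open>The last coordinate maps the syzygies of \<open>gs @ [s]\<close> onto the ideal \<open>gs : s\<close>, which is
  generated by variables; adding one syzygy for each of these variables in turn gives again
  colon ideals that are generated by variables.\<close>

lemma variable_quotients_syzygies:
  assumes "variable_quotients V gs" "homogeneous_vecs V e gs"
  shows "\<exists>hs. variable_quotients V hs \<and> homogeneous_vecs V 1 hs \<and> poly_span V (set hs) = syzygies V gs"
  using assms
proof (induction rule: variable_quotients.induct)
  case Nil
  have "syzygies V [] = poly_span V {}"
    unfolding poly_span_empty syzygies_def lincomb_def by (auto simp: fun_eq_iff polys_zero)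
  then show ?case
    by (intro exI[of _ "[]"]) (auto simp: variable_quotients.Nil homogeneous_vecs_def)
next
  case (snoc gs X s)
  let ?n = "length gs"
  have hom: "homogeneous_vecs V e gs" "homogeneous_vecs V e [s]"
    using snoc.prems unfolding homogeneous_vecs_def by auto
  have step: "\<exists>hs. variable_quotients V hs \<and> homogeneous_vecs V 1 hs \<and>
      poly_span V (set hs) = {z \<in> syzygies V (gs @ [s]). z ?n \<in> var_ideal V (set xs)}"
    if "distinct xs" "set xs \<subseteq> X" for xs
    using that
  proof (induction xs rule: rev_induct)
    case Nil
    have "var_ideal V (set []) = {0}" unfolding var_ideal_def by (simp add: mono_ideal_empty)
    then show ?case using snoc.IH[OF hom(1)] syzygies_snoc_zero[of V gs s] by auto
  next
    case (snoc x xs)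
    then obtain hs where hs: "variable_quotients V hs" "homogeneous_vecs V 1 hs"
      "poly_span V (set hs) = {z \<in> syzygies V (gs @ [s]). z ?n \<in> var_ideal V (set xs)}" by auto
    have x: "x \<in> X" "x \<in> V" "x \<notin> set xs" using snoc.prems \<open>X \<subseteq> V\<close> by auto
    have pv: "var x \<in> polys V" using polys_sqmon[of "{x}" V] x unfolding var_eq_sqmon by auto
    have "var x \<in> var_ideal V X"
      unfolding var_ideal_def var_eq_sqmon using x by (intro sqmon_in_mono_ideal) auto
    then have "smul (var x) s \<in> poly_span V (set gs)" using \<open>\<And>c. c \<in> polys V \<Longrightarrow> _\<close> pv by blast
    then obtain y where y: "y \<in> syzygies V (gs @ [s])" "y ?n = var x" "\<And>k. homogeneous (y k) 1"
      using homogeneous_syzygy[OF hom x(2)] by blast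
    \<comment> \<open>The last coordinate of \<open>smul c y\<close> is \<open>c * var x\<close>. It
      belongs to the ideal of the earlier variables iff \<open>c\<close> does, so these variables
      generate the new colon ideal.\<close>
    have "variable_quotients V (hs @ [y])"
    proof (rule variable_quotients.snoc[OF hs(1), where X = "set xs"])
      show "set xs \<subseteq> V" using snoc.prems \<open>X \<subseteq> V\<close> by auto
      fix c :: "('a, 'b) mpoly" assume c: "c \<in> polys V"
      have "smul c y ?n = c * var x" using y unfolding smul_def by simp
      then show "smul c y \<in> poly_span V (set hs) \<longleftrightarrow> c \<in> var_ideal V (set xs)"
        using hs(3) syzygies_smul[OF y(1) c] var_mult_mem_var_ideal[OF c x(2,3)] by simp
    qed simp
    moreover have "homogeneous_vecs V 1 (hs @ [y])"
      using hs(2) y unfolding homogeneous_vecs_def syzygies_def by auto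
    moreover have "poly_span V (set (hs @ [y])) =
      {z \<in> syzygies V (gs @ [s]). z ?n \<in> var_ideal V (set (xs @ [x]))}"
    proof (intro equalityI subsetI)
      fix z assume "z \<in> poly_span V (set (hs @ [y]))"
      then obtain u c where u: "u \<in> poly_span V (set hs)" "c \<in> polys V" "z = u + smul c y"
        using poly_span_insert[of z V y "set hs"] by auto
      have "u ?n \<in> var_ideal V (set (xs @ [x]))"
        using u(1) hs(3) mono_ideal_mono[of "(\<lambda>x. {x}) ` set xs" "(\<lambda>x. {x}) ` set (xs @ [x])" V]
        unfolding var_ideal_def by auto
      moreover have "c * var x \<in> var_ideal V (set (xs @ [x]))"
        unfolding var_ideal_def var_eq_sqmon using x u(2)
        by (intro mono_ideal_mult sqmon_in_mono_ideal) auto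
      ultimately have "z ?n \<in> var_ideal V (set (xs @ [x]))"
        using u(3) y(2) mono_ideal_add unfolding var_ideal_def smul_def by simp
      moreover have "z \<in> syzygies V (gs @ [s])"
        using u hs(3) y(1) syzygies_add syzygies_smul by blast
      ultimately show "z \<in> {z \<in> syzygies V (gs @ [s]). z ?n \<in> var_ideal V (set (xs @ [x]))}" by blast
    next
      fix z assume z: "z \<in> {z \<in> syzygies V (gs @ [s]). z ?n \<in> var_ideal V (set (xs @ [x]))}"
      then have "z ?n \<in> mono_ideal V (insert {x} ((\<lambda>x. {x}) ` set xs))"
        unfolding var_ideal_def by simp
      then obtain u c where uc: "u \<in> var_ideal V (set xs)" "c \<in> polys V" "z ?n = u + c * var x"
        unfolding var_ideal_def var_eq_sqmon by (rule mono_ideal_insertE) auto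
      \<comment> \<open>Subtracting this multiple of \<open>y\<close> removes from the last
        coordinate the part that requires \<open>x\<close>.\<close>
      have "z + - smul c y \<in> syzygies V (gs @ [s])"
        using z y uc by (intro syzygies_add syzygies_uminus syzygies_smul) auto
      moreover have "(z + - smul c y) ?n = u" using uc(3) y(2) unfolding smul_def by simp
      ultimately have "z + - smul c y \<in> poly_span V (set hs)" using hs(3) uc(1) by simp
      moreover have "z = (z + - smul c y) + smul c y" by simp
      ultimately show "z \<in> poly_span V (set (hs @ [y]))"
        using poly_span_insert[of z V y "set hs"] uc(2) by (metis insert_is_Un list.simps(15) set_append sup_commute empty_set)
    qed
    ultimately show ?case by blast
  qed
  obtain xs where xs: "distinct xs" "set xs = X"
    using \<open>finite X\<close> finite_distinct_list by blast
  \<comment> \<open>The last coordinate of any syzygy lies in the colon ideal, so once all of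
    \<open>X\<close> has been used the construction has reached every syzygy.\<close>
  have "z ?n \<in> var_ideal V X" if "z \<in> syzygies V (gs @ [s])" for z
  proof -
    have "lincomb gs z + smul (z ?n) s = 0" "z ?n \<in> polys V"
      using that unfolding syzygies_def by (auto simp: lincomb_snoc)
    then have "smul (z ?n) s = lincomb gs (- z)"
      by (simp add: lincomb_uminus eq_neg_iff_add_eq_0 add.commute)
    also have "\<dots> = lincomb gs (\<lambda>k. if k < ?n then - z k else 0)" by (rule lincomb_cong) auto
    finally have "smul (z ?n) s \<in> poly_span V (set gs)"
      unfolding poly_span_set_iff using that unfolding syzygies_def
      by (intro exI[of _ "\<lambda>k. if k < ?n then - z k else 0"]) (auto simp: polys_zero polys_uminus)
    then show ?thesis using \<open>\<And>c. c \<in> polys V \<Longrightarrow> _\<close> \<open>z ?n \<in> polys V\<close> by blast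
  qed
  then have "{z \<in> syzygies V (gs @ [s]). z ?n \<in> var_ideal V X} = syzygies V (gs @ [s])" by blast
  then show ?case using step[OF xs(1)] xs(2) by auto
qed

section \<open>Squarefree monomials as vectors\<close>

text \<open>An ideal becomes a submodule of the first coordinate, so its generators can start the
  same chain as the later syzygies.\<close>

definition coord0 :: "('v, 'k::field) mpoly \<Rightarrow> ('v, 'k) fvec" where
  "coord0 p = (\<lambda>a. if a = 0 then p else 0)"

lemma coord0_simps: "smul c (coord0 p) = coord0 (c * p)" "coord0 p + coord0 q = coord0 (p + q)" "coord0 0 = 0"
  "coord0 p = coord0 q \<longleftrightarrow> p = q"
  unfolding smul_def coord0_def by (auto simp: fun_eq_iff)

lemma poly_span_coord0_sqmon:
  fixes V :: "'v set"
  assumes "finite F" "\<And>A. A \<in> F \<Longrightarrow> finite A \<and> A \<subseteq> V"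
  shows "poly_span V ((\<lambda>A. coord0 (sqmon A)) ` F) = coord0 ` (mono_ideal V F :: ('v, 'k::field) mpoly set)"
  using assms
proof (induction F rule: finite_induct)
  case empty
  have "coord0 0 = (0 :: ('v, 'k) fvec)" by (simp add: coord0_def zero_fun_def)
  then show ?case unfolding mono_ideal_empty image_empty poly_span_empty image_insert by simp
next
  case (insert A F)
  have A: "finite A" "A \<subseteq> V" using insert.prems by auto
  have IH: "poly_span V ((\<lambda>A. coord0 (sqmon A)) ` F) = coord0 ` (mono_ideal V F :: ('v, 'k) mpoly set)"
    using insert by auto
  have "v \<in> poly_span V ((\<lambda>A. coord0 (sqmon A)) ` insert A F) \<longleftrightarrow> v \<in> coord0 ` mono_ideal V (insert A F)"
    for v :: "('v, 'k) fvec"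
  proof -
    have "v \<in> poly_span V ((\<lambda>A. coord0 (sqmon A)) ` insert A F) \<longleftrightarrow>
      (\<exists>u\<in>mono_ideal V F. \<exists>c\<in>polys V. v = coord0 (u + c * sqmon A))"
      by (simp add: IH poly_span_insert coord0_simps)
    also have "\<dots> \<longleftrightarrow> v \<in> coord0 ` mono_ideal V (insert A F)"
    proof
      assume "\<exists>u\<in>mono_ideal V F. \<exists>c\<in>polys V. v = coord0 (u + c * sqmon A)"
      then obtain u c where uc: "u \<in> mono_ideal V F" "c \<in> polys V" "v = coord0 (u + c * sqmon A)"
        by blast
      have "u \<in> mono_ideal V (insert A F)" using uc(1) mono_ideal_mono by blast
      moreover have "c * sqmon A \<in> mono_ideal V (insert A F)"
        using uc(2) A by (intro mono_ideal_mult sqmon_in_mono_ideal) auto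
      ultimately show "v \<in> coord0 ` mono_ideal V (insert A F)" using uc(3) mono_ideal_add by blast
    next
      assume "v \<in> coord0 ` mono_ideal V (insert A F)"
      then obtain p where p: "p \<in> mono_ideal V (insert A F)" "v = coord0 p" by blast
      obtain u c where "u \<in> mono_ideal V F" "c \<in> polys V" "p = u + c * sqmon A"
        using mono_ideal_insertE[OF p(1) A(1)] by blast
      then show "\<exists>u\<in>mono_ideal V F. \<exists>c\<in>polys V. v = coord0 (u + c * sqmon A)" using p(2) by blast
    qed
    finally show ?thesis .
  qed
  then show ?case by blast
qed

text \<open>A monomial lies in the colon ideal by \<open>B\<close> iff its support together with
  \<open>B\<close> contains some earlier \<open>A\<close>. The exchange for \<open>A\<close> then
  supplies a variable \<open>s\<close> in that support for which a single swap is an earlier set, so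
  the variables entering by such swaps form \<open>X\<close>.\<close>

lemma variable_quotients_sqmon:
  assumes "linear_quotients F" "finite V" "F \<subseteq> Pow V"
  shows "\<exists>Ws. set Ws = F \<and>
    variable_quotients V (map (\<lambda>A. coord0 (sqmon A :: ('v, 'k::field) mpoly)) Ws)"
  using assms(1,3)
proof (induction rule: linear_quotients.induct)
  case empty
  show ?case by (intro exI[of _ "[]"]) (simp add: variable_quotients.Nil)
next
  case (insert F B)
  then obtain Ws where Ws: "set Ws = F"
    "variable_quotients V (map (\<lambda>A. coord0 (sqmon A :: ('v, 'k) mpoly)) Ws)" by auto
  have fin: "finite F" using Ws(1) by auto
  have FV: "finite A \<and> A \<subseteq> V" if "A \<in> insert B F" for A
    using that insert.prems finite_subset[OF _ \<open>finite V\<close>] by auto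
  define X where "X = {s \<in> V - B. \<exists>p\<in>B. insert s (B - {p}) \<in> F}"
  have "variable_quotients V (map (\<lambda>A. coord0 (sqmon A :: ('v, 'k) mpoly)) Ws @ [coord0 (sqmon B)])"
  proof (rule variable_quotients.snoc[OF Ws(2), where X = X])
    show "X \<subseteq> V" unfolding X_def by blast
    then show "finite X" using \<open>finite V\<close> finite_subset by blast
    fix c :: "('v, 'k) mpoly" assume c: "c \<in> polys V"
    have "smul c (coord0 (sqmon B)) \<in> poly_span V (set (map (\<lambda>A. coord0 (sqmon A)) Ws)) \<longleftrightarrow>
      c * sqmon B \<in> mono_ideal V F"
      using poly_span_coord0_sqmon[of F V] fin FV Ws(1) by (auto simp: coord0_simps)
    also have "\<dots> \<longleftrightarrow> (\<forall>m\<in>Poly_Mapping.keys c. \<exists>A\<in>F. A \<subseteq> Poly_Mapping.keys m \<union> B)"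
      using c polys_mult polys_sqmon[of B V] FV[of B] unfolding mono_ideal_def
      by (auto simp: keys_mult_sqmon keys_add_nat keys_expo)
    also have "\<dots> \<longleftrightarrow> (\<forall>m\<in>Poly_Mapping.keys c. \<exists>x\<in>X. x \<in> Poly_Mapping.keys m)"
    proof (rule ball_cong[OF refl])
      fix m assume m: "m \<in> Poly_Mapping.keys c"
      show "(\<exists>A\<in>F. A \<subseteq> Poly_Mapping.keys m \<union> B) \<longleftrightarrow> (\<exists>x\<in>X. x \<in> Poly_Mapping.keys m)"
      proof
        assume "\<exists>A\<in>F. A \<subseteq> Poly_Mapping.keys m \<union> B"
        then obtain A where A: "A \<in> F" "A \<subseteq> Poly_Mapping.keys m \<union> B" by blast
        obtain s p where sp: "s \<in> A - B" "p \<in> B" "insert s (B - {p}) \<in> F"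
          using insert.hyps(2)[OF A(1)] by blast
        then have "s \<in> X" "s \<in> Poly_Mapping.keys m" using A FV[of A] unfolding X_def by blast+
        then show "\<exists>x\<in>X. x \<in> Poly_Mapping.keys m" by blast
      next
        assume "\<exists>x\<in>X. x \<in> Poly_Mapping.keys m"
        then obtain s p where "s \<in> Poly_Mapping.keys m" "p \<in> B" "insert s (B - {p}) \<in> F"
          unfolding X_def by blast
        moreover have "insert s (B - {p}) \<subseteq> Poly_Mapping.keys m \<union> B"
          using calculation(1) by blast
        ultimately show "\<exists>A\<in>F. A \<subseteq> Poly_Mapping.keys m \<union> B" by blast
      qed
    qed
    also have "\<dots> \<longleftrightarrow> c \<in> var_ideal V X"
      using c unfolding var_ideal_def mono_ideal_def by auto
    finally show "smul c (coord0 (sqmon B)) \<in> poly_span V (set (map (\<lambda>A. coord0 (sqmon A)) Ws)) \<longleftrightarrow>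
      c \<in> var_ideal V X" .
  qed
  then show ?case using Ws(1) by (intro exI[of _ "Ws @ [B]"]) auto
qed

section \<open>The linear resolution\<close>

definition vec_fun :: "('v, 'k::field) mpoly vec \<Rightarrow> ('v, 'k) fvec" where
  "vec_fun v = (\<lambda>k. if k < dim_vec v then v $ k else 0)"

lemma free_module_iff:
  "v \<in> free_module V n \<longleftrightarrow> dim_vec v = n \<and> (\<forall>k<n. v $ k \<in> polys V)"
  unfolding free_module_def carrier_poly_ring carrier_vec_def by simp

lemma vec_fun_free_module:
  assumes "v \<in> free_module V n"
  shows "\<forall>k. vec_fun v k \<in> polys V" "\<forall>k\<ge>n. vec_fun v k = 0" "vec n (vec_fun v) = v"
  using assms unfolding free_module_iff vec_fun_def by (auto simp: polys_zero)

lemma vec_fun_vec: "\<forall>k\<ge>n. z k = 0 \<Longrightarrow> vec_fun (vec n z) = z"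
  unfolding vec_fun_def by (auto simp: fun_eq_iff)

lemma vec_free_module: "\<forall>k. z k \<in> polys V \<Longrightarrow> vec n z \<in> free_module V n"
  unfolding free_module_iff by simp

definition mat_of :: "nat \<Rightarrow> ('v, 'k::field) fvec list \<Rightarrow> ('v, 'k) mpoly mat" where
  "mat_of n hs = mat n (length hs) (\<lambda>(a, b). (hs ! b) a)"

lemma mat_of_mult_vec:
  assumes "dim_vec w = length hs"
  shows "mat_of n hs *\<^sub>v w = vec n (lincomb hs (vec_fun w))"
proof (rule eq_vecI)
  fix a assume "a < dim_vec (vec n (lincomb hs (vec_fun w)))"
  then have a: "a < n" by simp
  have "(mat_of n hs *\<^sub>v w) $ a = (\<Sum>b = 0..<dim_vec w. (hs ! b) a * w $ b)"
    using a assms unfolding mat_of_def by (simp add: scalar_prod_def)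
  also have "\<dots> = lincomb hs (vec_fun w) a"
    unfolding lincomb_def vec_fun_def using assms
    by (intro sum.cong) (auto simp: mult.commute atLeast0LessThan)
  finally show "(mat_of n hs *\<^sub>v w) $ a = vec n (lincomb hs (vec_fun w)) $ a" using a by simp
qed (simp add: mat_of_def)

text \<open>With generators of the syzygies as columns, the image of the matrix is the kernel of the
  preceding map; every exactness condition is obtained from this.\<close>

lemma image_mat_of:
  assumes "poly_span V (set hs) = syzygies V gs"
  shows "{v \<in> free_module V (length gs). vec_fun v \<in> syzygies V gs} =
    (\<lambda>w. mat_of (length gs) hs *\<^sub>v w) ` free_module V (length hs)"
proof (intro equalityI subsetI)
  fix v assume v: "v \<in> {v \<in> free_module V (length gs). vec_fun v \<in> syzygies V gs}"
  then obtain z where z: "\<forall>k. z k \<in> polys V" "\<forall>k\<ge>length hs. z k = 0" "vec_fun v = lincomb hs z"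
    using assms poly_span_set_iff[of "vec_fun v" V hs] by auto
  have "mat_of (length gs) hs *\<^sub>v vec (length hs) z = vec (length gs) (lincomb hs z)"
    using z(2) by (simp add: mat_of_mult_vec vec_fun_vec)
  also have "\<dots> = v" using v z(3) vec_fun_free_module(3)[of v V "length gs"] by auto
  finally show "v \<in> (\<lambda>w. mat_of (length gs) hs *\<^sub>v w) ` free_module V (length hs)"
    using vec_free_module[OF z(1), of "length hs"] by (intro image_eqI) auto
next
  fix v assume "v \<in> (\<lambda>w. mat_of (length gs) hs *\<^sub>v w) ` free_module V (length hs)"
  then obtain w where w: "w \<in> free_module V (length hs)" "v = mat_of (length gs) hs *\<^sub>v w" by blast
  then have v: "v = vec (length gs) (lincomb hs (vec_fun w))"
    by (simp add: mat_of_mult_vec free_module_iff)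
  have "lincomb hs (vec_fun w) \<in> syzygies V gs"
    unfolding assms[symmetric] poly_span_set_iff
    using vec_fun_free_module(1,2)[OF w(1)] by blast
  moreover from this have "vec_fun v = lincomb hs (vec_fun w)"
    unfolding v syzygies_def by (intro vec_fun_vec) blast
  moreover have "v \<in> free_module V (length gs)"
    unfolding v using calculation(1) unfolding syzygies_def by (intro vec_free_module) blast
  ultimately show "v \<in> {v \<in> free_module V (length gs). vec_fun v \<in> syzygies V gs}" by simp
qed

lemma lincomb_eq_zero_iff:
  assumes "\<And>h a. h \<in> set hs \<Longrightarrow> a \<ge> n \<Longrightarrow> h a = 0"
  shows "lincomb hs z = 0 \<longleftrightarrow> (\<forall>a<n. lincomb hs z a = 0)"
proof -
  have "lincomb hs z a = 0" if "a \<ge> n" for a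
    unfolding lincomb_def using assms[OF nth_mem that] by (intro sum.neutral) simp
  then show ?thesis unfolding fun_eq_iff zero_fun_def by (meson not_less)
qed

text \<open>The lists obtained by repeatedly passing to syzygies are the columns of the
  differentials. Their entries have degree 1, so each step raises the degree of the generators by
  one, starting from \<open>t\<close>.\<close>

lemma linear_resolution_exists:
  fixes V :: "'v set"
  assumes "finite V" and F: "linear_quotients F" "\<And>W. W \<in> F \<Longrightarrow> W \<subseteq> V \<and> card W = t"
  shows "\<exists>L :: ('v, 'k::field) free_complex. graded_free_resolution V (mono_ideal V F) L \<and>
    (\<forall>i. \<forall>b<rk L i. gens L i ! b = int i + int t)"
proof -
  obtain Ws where Ws: "set Ws = F"
    "variable_quotients V (map (\<lambda>A. coord0 (sqmon A :: ('v, 'k) mpoly)) Ws)"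
    using variable_quotients_sqmon[OF F(1) \<open>finite V\<close>] F(2) by blast
  define g :: "('v, 'k) fvec list" where "g = map (\<lambda>A. coord0 (sqmon A)) Ws"
  have fW: "finite W \<and> W \<subseteq> V \<and> card W = t" if "W \<in> F" for W
    using F(2)[OF that] finite_subset[OF _ \<open>finite V\<close>] by blast
  have gh: "homogeneous_vecs V (int t) g"
    unfolding homogeneous_vecs_def
  proof (intro ballI allI)
    fix h a assume "h \<in> set g"
    then obtain A where "A \<in> F" "h = coord0 (sqmon A)" using Ws(1) unfolding g_def by auto
    then show "h a \<in> polys V \<and> homogeneous (h a) (int t)"
      using fW[of A] homogeneous_sqmon[of A] polys_sqmon[of A V] unfolding coord0_def
      by (auto simp: polys_zero)
  qed
  \<comment> \<open>Only the first list has entries of degree \<open>t\<close>; the syzygy lists are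
    linear. The clause for \<open>n = 0\<close> fixes the start of the chosen sequence.\<close>
  let ?P = "\<lambda>n hs. variable_quotients V hs \<and> homogeneous_vecs V (if n = 0 then int t else 1) hs \<and>
    (n = 0 \<longrightarrow> hs = g)"
  have "\<exists>f. \<forall>n. ?P n (f n) \<and> poly_span V (set (f (Suc n))) = syzygies V (f n)"
  proof (rule dependent_nat_choice)
    show "\<exists>hs. ?P 0 hs" using Ws(2) gh unfolding g_def by simp
    fix hs :: "('v, 'k) fvec list" and n :: nat
    assume "?P n hs"
    then have "variable_quotients V hs" "homogeneous_vecs V (if n = 0 then int t else 1) hs" by blast+
    then show "\<exists>hs'. ?P (Suc n) hs' \<and> poly_span V (set hs') = syzygies V hs"
      using variable_quotients_syzygies by fastforce
  qed
  then obtain f where f: "\<And>n. homogeneous_vecs V (if n = 0 then int t else 1) (f n)"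
    "f 0 = g" "\<And>n. poly_span V (set (f (Suc n))) = syzygies V (f n)" by blast
  \<comment> \<open>The columns vanish beyond the rank of their target, so cutting the sequences
    down to finite vectors loses nothing.\<close>
  have supp: "h a = 0" if "h \<in> set (f (Suc n))" "a \<ge> length (f n)" for h a n
  proof -
    have "0 + smul 1 h \<in> poly_span V (set (f (Suc n)))"
      using that(1) by (intro poly_span_step poly_span_zero polys_one)
    then show ?thesis using f(3)[of n] that(2) unfolding syzygies_def by (simp add: smul_simps)
  qed
  define L :: "('v, 'k) free_complex" where "L = \<lparr>gens = (\<lambda>i. replicate (length (f i)) (int i + int t)),
    diff = (\<lambda>i. mat_of (length (f i)) (f (Suc i))), aug = vec (length g) (\<lambda>b. (g ! b) 0)\<rparr>"
  have [simp]: "gens L i = replicate (length (f i)) (int i + int t)"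
    "diff L i = mat_of (length (f i)) (f (Suc i))" "aug L = vec (length g) (\<lambda>b. (g ! b) 0)" for i
    unfolding L_def by simp_all
  have aug: "aug L \<bullet> v = lincomb g (vec_fun v) 0" if "v \<in> free_module V (length g)" for v
    using that unfolding free_module_iff lincomb_def vec_fun_def
    by (auto simp: scalar_prod_def mult.commute atLeast0LessThan intro!: sum.cong)
  have g0: "h a = 0" if "h \<in> set g" "a \<ge> 1" for h a
    using that unfolding g_def coord0_def by auto
  have gF: "set g = (\<lambda>A. coord0 (sqmon A)) ` F" unfolding g_def using Ws(1) by simp
  have "graded_free_resolution V (mono_ideal V F) L"
    unfolding graded_free_resolution_def carrier_poly_ring
  proof (intro conjI allI impI)
    show "aug L \<in> free_module V (rk L 0)"
      using gh f(2) unfolding free_module_iff homogeneous_vecs_def by simp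
    show "homogeneous (aug L $ b) (gens L 0 ! b)" if "b < rk L 0" for b
      using gh f(2) that unfolding homogeneous_vecs_def by simp
    show "diff L i \<in> carrier_mat (rk L i) (rk L (Suc i))" for i
      by (simp add: mat_of_def)
    show "diff L i $$ (a, b) \<in> polys V" "homogeneous (diff L i $$ (a, b)) (gens L (Suc i) ! b - gens L i ! a)"
      if "a < rk L i" "b < rk L (Suc i)" for i a b
      using f(1)[of "Suc i"] that unfolding homogeneous_vecs_def by (auto simp: mat_of_def)
    show "(\<lambda>v. aug L \<bullet> v) ` free_module V (rk L 0) = mono_ideal V F"
    proof (intro equalityI subsetI)
      fix p assume "p \<in> (\<lambda>v. aug L \<bullet> v) ` free_module V (rk L 0)"
      then obtain v where v: "v \<in> free_module V (length g)" "p = lincomb g (vec_fun v) 0"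
        using aug f(2) by auto
      then have "lincomb g (vec_fun v) \<in> poly_span V (set g)"
        unfolding poly_span_set_iff using vec_fun_free_module[OF v(1)] by blast
      then have "lincomb g (vec_fun v) \<in> coord0 ` mono_ideal V F"
        using poly_span_coord0_sqmon[of F V] fW Ws(1) unfolding gF by auto
      then show "p \<in> mono_ideal V F" using v(2) unfolding coord0_def by auto
    next
      fix p :: "('v, 'k) mpoly" assume "p \<in> mono_ideal V F"
      then have "coord0 p \<in> poly_span V (set g)"
        using poly_span_coord0_sqmon[of F V] fW Ws(1) unfolding gF by auto
      then obtain z where z: "\<forall>k. z k \<in> polys V" "\<forall>k\<ge>length g. z k = 0" "coord0 p = lincomb g z"
        unfolding poly_span_set_iff by blast
      have "vec (length g) z \<in> free_module V (length g)" using z(1) by (rule vec_free_module)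
      moreover have "aug L \<bullet> vec (length g) z = p"
        unfolding aug[OF calculation] vec_fun_vec[OF z(2)] z(3)[symmetric] coord0_def by simp
      ultimately show "p \<in> (\<lambda>v. aug L \<bullet> v) ` free_module V (rk L 0)" using f(2) by auto
    qed
    have "{v \<in> free_module V (length g). aug L \<bullet> v = 0} =
        {v \<in> free_module V (length g). vec_fun v \<in> syzygies V g}"
    proof (rule Collect_cong, rule conj_cong[OF refl])
      fix v :: "('v, 'k) mpoly vec" assume v: "v \<in> free_module V (length g)"
      have "aug L \<bullet> v = 0 \<longleftrightarrow> lincomb g (vec_fun v) = 0"
        unfolding aug[OF v] using lincomb_eq_zero_iff[of g 1 "vec_fun v"] g0 by auto
      then show "aug L \<bullet> v = 0 \<longleftrightarrow> vec_fun v \<in> syzygies V g"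
        unfolding syzygies_def using vec_fun_free_module[OF v] by simp
    qed
    then show "{v \<in> free_module V (rk L 0). aug L \<bullet> v = 0} =
      (\<lambda>w. diff L 0 *\<^sub>v w) ` free_module V (rk L 1)"
      using image_mat_of[OF f(3)[of 0]] f(2) by simp
    show "{v \<in> free_module V (rk L (Suc i)). diff L i *\<^sub>v v = 0\<^sub>v (rk L i)} =
      (\<lambda>w. diff L (Suc i) *\<^sub>v w) ` free_module V (rk L (Suc (Suc i)))" for i
    proof -
      have "{v \<in> free_module V (length (f (Suc i))). diff L i *\<^sub>v v = 0\<^sub>v (rk L i)} =
        {v \<in> free_module V (length (f (Suc i))). vec_fun v \<in> syzygies V (f (Suc i))}"
      proof (rule Collect_cong, rule conj_cong[OF refl])
        fix v :: "('v, 'k) mpoly vec" assume v: "v \<in> free_module V (length (f (Suc i)))"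
        have "diff L i *\<^sub>v v = vec (length (f i)) (lincomb (f (Suc i)) (vec_fun v))"
          using v by (simp add: mat_of_mult_vec free_module_iff)
        then have "diff L i *\<^sub>v v = 0\<^sub>v (rk L i) \<longleftrightarrow> (\<forall>a<length (f i). lincomb (f (Suc i)) (vec_fun v) a = 0)"
          by (auto simp: vec_eq_iff)
        also have "\<dots> \<longleftrightarrow> lincomb (f (Suc i)) (vec_fun v) = 0"
          using lincomb_eq_zero_iff[of "f (Suc i)" "length (f i)" "vec_fun v"] supp by blast
        finally show "diff L i *\<^sub>v v = 0\<^sub>v (rk L i) \<longleftrightarrow> vec_fun v \<in> syzygies V (f (Suc i))"
          unfolding syzygies_def using vec_fun_free_module[OF v] by simp
      qed
      then show ?thesis using image_mat_of[OF f(3)[of "Suc i"]] by simp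
    qed
  qed
  then show ?thesis by (intro exI[of _ L]) simp
qed

section \<open>Comparison of resolutions\<close>

text \<open>The matrix of a graded map of degree 0; \<open>rs\<close> lists the degrees of the basis
  of the target and \<open>cs\<close> those of the source.\<close>

definition hmat :: "'v set \<Rightarrow> int list \<Rightarrow> int list \<Rightarrow> ('v, 'k::field) mpoly mat \<Rightarrow> bool" where
  "hmat V rs cs A \<longleftrightarrow> A \<in> carrier_mat (length rs) (length cs) \<and>
    (\<forall>a<length rs. \<forall>b<length cs. A $$ (a, b) \<in> polys V \<and> homogeneous (A $$ (a, b)) (cs ! b - rs ! a))"

lemma hmat_carrier: "hmat V rs cs A \<Longrightarrow> A \<in> carrier_mat (length rs) (length cs)"
  unfolding hmat_def by blast

lemma index_mult_mat_sum:
  assumes "A \<in> carrier_mat n m" "B \<in> carrier_mat m l" "a < n" "c < l"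
  shows "(A * B) $$ (a, c) = (\<Sum>b<m. A $$ (a, b) * B $$ (b, c))"
  using assms by (auto simp: scalar_prod_def atLeast0LessThan)

lemma hmat_mult:
  assumes A: "hmat V rs es A" and B: "hmat V es cs B"
  shows "hmat V rs cs (A * B)"
  unfolding hmat_def
proof (intro conjI allI impI)
  show "A * B \<in> carrier_mat (length rs) (length cs)"
    using A B unfolding hmat_def by (intro mult_carrier_mat[of _ _ "length es"]) auto
  fix a c assume ac: "a < length rs" "c < length cs"
  have eq: "(A * B) $$ (a, c) = (\<Sum>b<length es. A $$ (a, b) * B $$ (b, c))"
    using index_mult_mat_sum[OF hmat_carrier[OF A] hmat_carrier[OF B] ac] .
  show "(A * B) $$ (a, c) \<in> polys V"
    unfolding eq using A B ac unfolding hmat_def by (intro polys_sum polys_mult) auto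
  show "homogeneous ((A * B) $$ (a, c)) (cs ! c - rs ! a)"
    unfolding eq
  proof (rule homogeneous_sum)
    fix b assume "b \<in> {..<length es}"
    then have "homogeneous (A $$ (a, b)) (es ! b - rs ! a)" "homogeneous (B $$ (b, c)) (cs ! c - es ! b)"
      using A B ac unfolding hmat_def by auto
    from homogeneous_mult[OF this] show "homogeneous (A $$ (a, b) * B $$ (b, c)) (cs ! c - rs ! a)"
      by simp
  qed
qed

lemma hmat_minus:
  assumes "hmat V rs cs A" "hmat V rs cs B"
  shows "hmat V rs cs (A - B)"
  using assms unfolding hmat_def by (auto intro!: polys_minus homogeneous_minus)

lemma hmat_one: "hmat V rs rs (1\<^sub>m (length rs))"
  unfolding hmat_def by (auto simp: one_mat_def polys_one polys_zero homogeneous_one)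

lemma hmat_zero: "hmat V rs cs (0\<^sub>m (length rs) (length cs))"
  unfolding hmat_def by (auto simp: polys_zero)

text \<open>Preimages of the columns need not be homogeneous. Since \<open>D\<close> and
  \<open>A\<close> are, replacing each entry by its component of the required degree gives a
  preimage again.\<close>

lemma hmat_lift:
  assumes D: "hmat V rs es D" and A: "hmat V rs cs A"
    and im: "\<And>j. j < length cs \<Longrightarrow> col A j \<in> (\<lambda>w. D *\<^sub>v w) ` free_module V (length es)"
  shows "\<exists>B. hmat V es cs B \<and> D * B = A"
proof -
  have "\<forall>j. \<exists>w. j < length cs \<longrightarrow> w \<in> free_module V (length es) \<and> D *\<^sub>v w = col A j"
    using im by fastforce
  then obtain w where w: "\<And>j. j < length cs \<Longrightarrow> w j \<in> free_module V (length es) \<and> D *\<^sub>v w j = col A j"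
    by metis
  define B where "B = mat (length es) (length cs) (\<lambda>(b, j). hcomp (cs ! j - es ! b) (w j $ b))"
  have B: "hmat V es cs B"
    using w unfolding hmat_def B_def free_module_iff
    by (auto intro: polys_hcomp homogeneous_hcomp)
  moreover have "D * B = A"
  proof (rule eq_matI)
    have DA: "D \<in> carrier_mat (length rs) (length es)" "A \<in> carrier_mat (length rs) (length cs)"
      "B \<in> carrier_mat (length es) (length cs)"
      using D A B unfolding hmat_def by auto
    then show "dim_row (D * B) = dim_row A" "dim_col (D * B) = dim_col A" by auto
    fix a j assume "a < dim_row A" "j < dim_col A"
    then have aj: "a < length rs" "j < length cs" using DA by auto
    have "(D * B) $$ (a, j) = (\<Sum>b<length es. D $$ (a, b) * hcomp (cs ! j - es ! b) (w j $ b))"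
      using index_mult_mat_sum[OF DA(1,3) aj] aj by (simp add: B_def)
    also have "\<dots> = (\<Sum>b<length es. hcomp (cs ! j - rs ! a) (D $$ (a, b) * w j $ b))"
    proof (rule sum.cong[OF refl])
      fix b assume "b \<in> {..<length es}"
      then have "homogeneous (D $$ (a, b)) (es ! b - rs ! a)" using D aj unfolding hmat_def by auto
      from hcomp_mult_homogeneous[OF this, of "cs ! j - es ! b" "w j $ b"]
      show "D $$ (a, b) * hcomp (cs ! j - es ! b) (w j $ b) =
        hcomp (cs ! j - rs ! a) (D $$ (a, b) * w j $ b)" by simp
    qed
    also have "\<dots> = hcomp (cs ! j - rs ! a) (\<Sum>b<length es. D $$ (a, b) * w j $ b)"
      unfolding hcomp_sum ..
    also have "(\<Sum>b<length es. D $$ (a, b) * w j $ b) = (D *\<^sub>v w j) $ a"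
    proof -
      have "dim_vec (w j) = length es" using w[OF aj(2)] unfolding free_module_iff by blast
      then show ?thesis using DA aj by (simp add: scalar_prod_def atLeast0LessThan)
    qed
    also have "(D *\<^sub>v w j) $ a = A $$ (a, j)" using w[OF aj(2)] DA aj by simp
    also have "hcomp (cs ! j - rs ! a) (A $$ (a, j)) = A $$ (a, j)" using A aj unfolding hmat_def by (intro hcomp_homogeneous) auto
    finally show "(D * B) $$ (a, j) = A $$ (a, j)" .
  qed
  ultimately show ?thesis by blast
qed

lemma hmat_col: "\<lbrakk>hmat V rs cs A; j < length cs\<rbrakk> \<Longrightarrow> col A j \<in> free_module V (length rs)"
  unfolding hmat_def free_module_iff by auto

lemma col_in_image:
  fixes A :: "('v, 'k::field) mpoly mat"
  assumes A: "A \<in> carrier_mat n m" and j: "j < m"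
  shows "col A j \<in> (\<lambda>w. A *\<^sub>v w) ` free_module V m"
proof -
  have "unit_vec m j \<in> free_module V m"
    unfolding free_module_iff using j by (auto simp: unit_vec_def polys_one polys_zero)
  moreover have "A *\<^sub>v unit_vec m j = col A j"
    using A j by (intro eq_vecI) (auto simp: scalar_prod_right_unit)
  ultimately show ?thesis by (metis imageI)
qed

section \<open>Lifting along exact complexes\<close>

text \<open>Exactness is stated from index 1 on, so that the complex may have any cokernel at index
  0.\<close>

definition exact_complex :: "'v set \<Rightarrow> (nat \<Rightarrow> int list) \<Rightarrow> (nat \<Rightarrow> ('v, 'k::field) mpoly mat) \<Rightarrow> bool" where
  "exact_complex V G D \<longleftrightarrow> (\<forall>i. hmat V (G i) (G (Suc i)) (D i)) \<and>
    (\<forall>i. {v \<in> free_module V (length (G (Suc i))). D i *\<^sub>v v = 0\<^sub>v (length (G i))} =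
      (\<lambda>w. D (Suc i) *\<^sub>v w) ` free_module V (length (G (Suc (Suc i)))))"

lemma exact_lift:
  assumes E: "exact_complex V G D" and A: "hmat V (G (Suc i)) cs A"
    and zero: "D i * A = 0\<^sub>m (length (G i)) (length cs)"
  shows "\<exists>B. hmat V (G (Suc (Suc i))) cs B \<and> D (Suc i) * B = A"
proof (rule hmat_lift[OF _ A])
  have D: "hmat V (G i) (G (Suc i)) (D i)" for i using E unfolding exact_complex_def by blast
  show "hmat V (G (Suc i)) (G (Suc (Suc i))) (D (Suc i))" by (rule D)
  fix j assume j: "j < length cs"
  have "D i *\<^sub>v col A j = col (D i * A) j"
    using hmat_carrier[OF D] hmat_carrier[OF A] j by (intro col_mult2[symmetric]) auto
  also have "\<dots> = 0\<^sub>v (length (G i))" unfolding zero using j by simp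
  finally show "col A j \<in> (\<lambda>w. D (Suc i) *\<^sub>v w) ` free_module V (length (G (Suc (Suc i))))"
    using E hmat_col[OF A j] unfolding exact_complex_def by blast
qed

lemma exact_complex_comp:
  assumes E: "exact_complex V G D"
  shows "D i * D (Suc i) = 0\<^sub>m (length (G i)) (length (G (Suc (Suc i))))"
proof (rule eq_matI)
  have D: "D i \<in> carrier_mat (length (G i)) (length (G (Suc i)))" for i
    using E hmat_carrier unfolding exact_complex_def by blast
  let ?n = "length (G (Suc (Suc i)))"
  show "dim_row (D i * D (Suc i)) = dim_row (0\<^sub>m (length (G i)) ?n)"
    "dim_col (D i * D (Suc i)) = dim_col (0\<^sub>m (length (G i)) ?n)"
    using D[of i] D[of "Suc i"] by auto
  fix a j assume "a < dim_row (0\<^sub>m (length (G i)) ?n)" "j < dim_col (0\<^sub>m (length (G i)) ?n)"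
  then have aj: "a < length (G i)" "j < ?n" by auto
  have "col (D (Suc i)) j \<in> (\<lambda>w. D (Suc i) *\<^sub>v w) ` free_module V ?n"
    by (rule col_in_image[OF D aj(2)])
  then have "D i *\<^sub>v col (D (Suc i)) j = 0\<^sub>v (length (G i))"
    using E unfolding exact_complex_def by blast
  moreover have "D i *\<^sub>v col (D (Suc i)) j = col (D i * D (Suc i)) j"
    by (rule col_mult2[OF D D aj(2), symmetric])
  ultimately have "col (D i * D (Suc i)) j $ a = 0" using aj by simp
  then show "(D i * D (Suc i)) $$ (a, j) = 0\<^sub>m (length (G i)) ?n $$ (a, j)"
    using D[of i] D[of "Suc i"] aj by simp
qed

text \<open>This is the comparison theorem over the identity at index 0. Equal images of the two
  first differentials allow the first lift, and exactness of the target allows all later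
  ones.\<close>

lemma chain_map_exists:
  fixes D D' :: "nat \<Rightarrow> ('v, 'k::field) mpoly mat"
  assumes E: "exact_complex V G D" and E': "exact_complex V G' D'"
    and G0: "G' 0 = G 0"
    and im: "(\<lambda>v. D 0 *\<^sub>v v) ` free_module V (length (G 1)) =
      (\<lambda>v. D' 0 *\<^sub>v v) ` free_module V (length (G' 1))"
  shows "\<exists>\<phi>. \<phi> 0 = 1\<^sub>m (length (G 0)) \<and> (\<forall>i. hmat V (G' i) (G i) (\<phi> i)) \<and>
    (\<forall>i. D' i * \<phi> (Suc i) = \<phi> i * D i)"
proof -
  have D: "hmat V (G i) (G (Suc i)) (D i)" and D': "hmat V (G' i) (G' (Suc i)) (D' i)" for i
    using E E' unfolding exact_complex_def by blast+
  note c = hmat_carrier[OF D] and c' = hmat_carrier[OF D']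
  \<comment> \<open>The sequence chosen here starts at index 1 of the chain map. The vanishing
    product is what the next lift requires, and the clause for \<open>i = 0\<close> ties the first
    map to the identity.\<close>
  let ?P = "\<lambda>i x. hmat V (G' (Suc i)) (G (Suc i)) x \<and>
    D' i * (x * D (Suc i)) = 0\<^sub>m (length (G' i)) (length (G (Suc (Suc i)))) \<and> (i = 0 \<longrightarrow> D' 0 * x = D 0)"
  have "\<exists>f. \<forall>i. ?P i (f i) \<and> D' (Suc i) * f (Suc i) = f i * D (Suc i)"
  proof (rule dependent_nat_choice)
    have "\<exists>x. hmat V (G' (Suc 0)) (G (Suc 0)) x \<and> D' 0 * x = D 0"
    proof (rule hmat_lift[OF D'])
      show "hmat V (G' 0) (G (Suc 0)) (D 0)" unfolding G0 by (rule D)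
      fix j assume j: "j < length (G (Suc 0))"
      have "col (D 0) j \<in> (\<lambda>v. D 0 *\<^sub>v v) ` free_module V (length (G 1))"
        using col_in_image[OF c[of 0] j, of V] by simp
      then show "col (D 0) j \<in> (\<lambda>v. D' 0 *\<^sub>v v) ` free_module V (length (G' (Suc 0)))"
        using im by simp
    qed
    then obtain x where x: "hmat V (G' (Suc 0)) (G (Suc 0)) x" "D' 0 * x = D 0" by blast
    have "D' 0 * (x * D (Suc 0)) = D' 0 * x * D (Suc 0)"
      by (rule assoc_mult_mat[OF c' hmat_carrier[OF x(1)] c, symmetric])
    then show "\<exists>x. ?P 0 x" using x exact_complex_comp[OF E, of 0] G0 by auto
    fix x i assume x: "?P i x"
    have "hmat V (G' (Suc i)) (G (Suc (Suc i))) (x * D (Suc i))"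
      using x hmat_mult D by blast
    then obtain y where y: "hmat V (G' (Suc (Suc i))) (G (Suc (Suc i))) y"
      "D' (Suc i) * y = x * D (Suc i)"
      using exact_lift[OF E'] x by blast
    have xc: "x \<in> carrier_mat (length (G' (Suc i))) (length (G (Suc i)))" using x hmat_carrier by blast
    have "D' (Suc i) * (y * D (Suc (Suc i))) = D' (Suc i) * y * D (Suc (Suc i))"
      by (rule assoc_mult_mat[OF c' hmat_carrier[OF y(1)] c, symmetric])
    also have "\<dots> = x * (D (Suc i) * D (Suc (Suc i)))"
      unfolding y(2) by (rule assoc_mult_mat[OF xc c c])
    also have "\<dots> = 0\<^sub>m (length (G' (Suc i))) (length (G (Suc (Suc (Suc i)))))"
      unfolding exact_complex_comp[OF E] by (rule right_mult_zero_mat[OF xc])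
    finally show "\<exists>y. ?P (Suc i) y \<and> D' (Suc i) * y = x * D (Suc i)" using y by blast
  qed
  then obtain f where f: "\<And>i. hmat V (G' (Suc i)) (G (Suc i)) (f i)" "D' 0 * f 0 = D 0"
    "\<And>i. D' (Suc i) * f (Suc i) = f i * D (Suc i)" by blast
  define \<phi> where "\<phi> i = (case i of 0 \<Rightarrow> 1\<^sub>m (length (G 0)) | Suc i \<Rightarrow> f i)" for i
  have "D' i * \<phi> (Suc i) = \<phi> i * D i" for i
    using f(2,3) left_mult_one_mat[OF c[of 0]] by (cases i) (auto simp: \<phi>_def)
  moreover have "hmat V (G' i) (G i) (\<phi> i)" for i
    using f(1) hmat_one G0 by (cases i) (auto simp: \<phi>_def)
  moreover have "\<phi> 0 = 1\<^sub>m (length (G 0))" unfolding \<phi>_def by simp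
  ultimately show ?thesis by blast
qed

text \<open>As \<open>\<theta>\<close> is the identity at index 0, the homotopy can start with zero.
  Because \<open>\<theta>\<close> commutes with \<open>D\<close>, each later error term is killed by
  \<open>D\<close> and can be lifted.\<close>

lemma homotopy_exists:
  fixes D :: "nat \<Rightarrow> ('v, 'k::field) mpoly mat"
  assumes E: "exact_complex V G D"
    and \<theta>: "\<theta> 0 = 1\<^sub>m (length (G 0))" "\<And>i. hmat V (G i) (G i) (\<theta> i)"
      "\<And>i. D i * \<theta> (Suc i) = \<theta> i * D i"
  shows "\<exists>h. (\<forall>i. hmat V (G (Suc i)) (G i) (h i)) \<and>
    (\<forall>i. D (Suc i) * h (Suc i) = \<theta> (Suc i) - 1\<^sub>m (length (G (Suc i))) - h i * D i)"
proof -
  let ?n = "\<lambda>i. length (G i)"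
  have D: "hmat V (G i) (G (Suc i)) (D i)" for i
    using E unfolding exact_complex_def by blast
  note c = hmat_carrier[OF D] and t = hmat_carrier[OF \<theta>(2)]
  have o: "1\<^sub>m (?n i) \<in> carrier_mat (?n i) (?n i)" for i by simp
  let ?P = "\<lambda>i x. hmat V (G (Suc i)) (G i) x \<and>
    (\<theta> i - 1\<^sub>m (?n i) - D i * x) * D i = 0\<^sub>m (?n i) (?n (Suc i))"
  have "\<exists>h. \<forall>i. ?P i (h i) \<and> D (Suc i) * h (Suc i) = \<theta> (Suc i) - 1\<^sub>m (?n (Suc i)) - h i * D i"
  proof (rule dependent_nat_choice)
    have "\<theta> 0 - 1\<^sub>m (?n 0) - D 0 * 0\<^sub>m (?n (Suc 0)) (?n 0) = 0\<^sub>m (?n 0) (?n 0)"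
      unfolding \<theta>(1) right_mult_zero_mat[OF c] by auto
    then show "\<exists>x. ?P 0 x" using hmat_zero left_mult_zero_mat[OF c] by metis
    fix x i assume x: "?P i x"
    then have xc: "x \<in> carrier_mat (?n (Suc i)) (?n i)" using hmat_carrier by blast
    define M where "M = \<theta> (Suc i) - 1\<^sub>m (?n (Suc i)) - x * D i"
    have xD: "x * D i \<in> carrier_mat (?n (Suc i)) (?n (Suc i))" using xc c by (rule mult_carrier_mat)
    have Dx: "D i * x \<in> carrier_mat (?n i) (?n i)" using c xc by (rule mult_carrier_mat)
    have M: "hmat V (G (Suc i)) (G (Suc i)) M"
      unfolding M_def using x \<theta>(2) hmat_one hmat_mult D by (intro hmat_minus) blast+
    have "D i * M = D i * \<theta> (Suc i) - D i * 1\<^sub>m (?n (Suc i)) - D i * (x * D i)"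
      unfolding M_def using c[of i] t[of "Suc i"] o[of "Suc i"] xD
      by (simp add: mult_minus_distrib_mat[of _ "?n i" "?n (Suc i)" _ "?n (Suc i)"] minus_carrier_mat)
    also have "\<dots> = \<theta> i * D i - 1\<^sub>m (?n i) * D i - D i * x * D i"
      unfolding \<theta>(3) right_mult_one_mat[OF c] left_mult_one_mat[OF c] assoc_mult_mat[OF c xc c] ..
    also have "\<dots> = (\<theta> i - 1\<^sub>m (?n i) - D i * x) * D i"
      using c[of i] t[of i] o[of i] Dx
      by (simp add: minus_mult_distrib_mat[of _ "?n i" "?n i" _ _ "?n (Suc i)"] minus_carrier_mat)
    finally have "D i * M = 0\<^sub>m (?n i) (?n (Suc i))" using x by simp
    then obtain y where y: "hmat V (G (Suc (Suc i))) (G (Suc i)) y" "D (Suc i) * y = M"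
      using exact_lift[OF E M] by blast
    \<comment> \<open>The error left after the lift is \<open>x * D i\<close>; composing with the
      next differential makes it vanish, which restores the invariant.\<close>
    have "\<theta> (Suc i) - 1\<^sub>m (?n (Suc i)) - D (Suc i) * y = x * D i"
    proof (rule eq_matI)
      fix a b assume "a < dim_row (x * D i)" "b < dim_col (x * D i)"
      then show "(\<theta> (Suc i) - 1\<^sub>m (?n (Suc i)) - D (Suc i) * y) $$ (a, b) = (x * D i) $$ (a, b)"
        unfolding y(2) M_def using xD t[of "Suc i"] by auto
    qed (use y M hmat_carrier[OF M] xD in auto)
    then have "(\<theta> (Suc i) - 1\<^sub>m (?n (Suc i)) - D (Suc i) * y) * D (Suc i) = x * (D i * D (Suc i))"
      by (simp only: assoc_mult_mat[OF xc c c])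
    also have "\<dots> = 0\<^sub>m (?n (Suc i)) (?n (Suc (Suc i)))"
      unfolding exact_complex_comp[OF E] by (rule right_mult_zero_mat[OF xc])
    finally show "\<exists>y. ?P (Suc i) y \<and> D (Suc i) * y = \<theta> (Suc i) - 1\<^sub>m (?n (Suc i)) - x * D i"
      using y unfolding M_def by blast
  qed
  then show ?thesis by blast
qed

section \<open>The augmented complex\<close>

text \<open>Index 0 is the polynomial ring itself, with one generator of degree 0, and the
  resolution is shifted by one. The augmentation thereby becomes an ordinary differential, and
  exactness at \<open>F 0\<close> fits the general pattern.\<close>

definition aug_gens :: "('v, 'k::zero) free_complex \<Rightarrow> nat \<Rightarrow> int list" where
  "aug_gens F i = (case i of 0 \<Rightarrow> [0] | Suc i \<Rightarrow> gens F i)"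

definition aug_diff :: "('v, 'k::zero) free_complex \<Rightarrow> nat \<Rightarrow> ('v, 'k) mpoly mat" where
  "aug_diff F i = (case i of 0 \<Rightarrow> mat 1 (rk F 0) (\<lambda>(a, b). aug F $ b) | Suc i \<Rightarrow> diff F i)"

lemma aug_simps [simp]:
  "aug_gens F 0 = [0]" "aug_gens F (Suc i) = gens F i" "aug_diff F (Suc i) = diff F i"
  unfolding aug_gens_def aug_diff_def by simp_all

lemma aug_diff_zero_mult:
  assumes "graded_free_resolution V J F" "v \<in> free_module V (rk F 0)"
  shows "aug_diff F 0 *\<^sub>v v = vec 1 (\<lambda>_. aug F \<bullet> v)"
proof (rule eq_vecI)
  have "dim_vec (aug F) = rk F 0"
    using assms(1) unfolding graded_free_resolution_def free_module_iff by blast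
  then have "row (mat 1 (rk F 0) (\<lambda>(a, b). aug F $ b)) 0 = aug F" by (intro eq_vecI) auto
  then show "(aug_diff F 0 *\<^sub>v v) $ a = vec 1 (\<lambda>_. aug F \<bullet> v) $ a"
    if "a < dim_vec (vec 1 (\<lambda>_. aug F \<bullet> v))" for a
    using that unfolding aug_diff_def by simp
qed (simp add: aug_diff_def)

lemma exact_complex_aug:
  assumes F: "graded_free_resolution V J F"
  shows "exact_complex V (aug_gens F) (aug_diff F)"
  unfolding exact_complex_def
proof (intro conjI allI)
  note R = F[unfolded graded_free_resolution_def carrier_poly_ring]
  fix i
  show "hmat V (aug_gens F i) (aug_gens F (Suc i)) (aug_diff F i)"
    using R unfolding hmat_def free_module_iff by (cases i) (auto simp: aug_diff_def)
  show "{v \<in> free_module V (length (aug_gens F (Suc i))). aug_diff F i *\<^sub>v v = 0\<^sub>v (length (aug_gens F i))} =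
    (\<lambda>w. aug_diff F (Suc i) *\<^sub>v w) ` free_module V (length (aug_gens F (Suc (Suc i))))"
  proof (cases i)
    case 0
    have "vec 1 (\<lambda>_. x) = 0\<^sub>v 1 \<longleftrightarrow> x = 0" for x :: "('a, 'b) mpoly" by (auto simp: vec_eq_iff)
    then have "{v \<in> free_module V (rk F 0). aug_diff F 0 *\<^sub>v v = 0\<^sub>v 1} =
      {v \<in> free_module V (rk F 0). aug F \<bullet> v = 0}"
      using aug_diff_zero_mult[OF F] by auto
    then show ?thesis using R 0 by simp
  next
    case (Suc n)
    then show ?thesis using R by simp
  qed
qed

text \<open>Both augmented complexes end in the same polynomial ring with the same image
  \<open>J\<close>, so the identity there can be lifted.\<close>

lemma resolution_chain_map:
  assumes "graded_free_resolution V J F" "graded_free_resolution V J L"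
  shows "\<exists>\<phi>. \<phi> 0 = 1\<^sub>m 1 \<and> (\<forall>i. hmat V (aug_gens L i) (aug_gens F i) (\<phi> i)) \<and>
    (\<forall>i. aug_diff L i * \<phi> (Suc i) = \<phi> i * aug_diff F i)"
proof -
  have im: "(\<lambda>v. aug_diff F 0 *\<^sub>v v) ` free_module V (rk F 0) = (\<lambda>x. vec 1 (\<lambda>_. x)) ` J"
    if "graded_free_resolution V J F" for F :: "('a, 'b) free_complex"
  proof -
    have "(\<lambda>v. aug F \<bullet> v) ` free_module V (rk F 0) = J"
      using that unfolding graded_free_resolution_def by blast
    then show ?thesis using aug_diff_zero_mult[OF that] by (force simp: image_iff)
  qed
  show ?thesis
    using chain_map_exists[OF exact_complex_aug[OF assms(1)] exact_complex_aug[OF assms(2)]]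
      im[OF assms(1)] im[OF assms(2)] by simp
qed

section \<open>Reduction to the residue field\<close>

lemma residue_mat_mult_vec:
  assumes "A \<in> carrier_mat n m" "B \<in> carrier_mat m l" "u \<in> carrier_vec l"
  shows "residue_mat (A * B) *\<^sub>v u = residue_mat A *\<^sub>v (residue_mat B *\<^sub>v u)"
proof -
  have "residue_mat (A * B) = residue_mat A * residue_mat B"
  proof (rule eq_matI)
    fix a c assume "a < dim_row (residue_mat A * residue_mat B)" "c < dim_col (residue_mat A * residue_mat B)"
    then have ac: "a < n" "c < l" using assms unfolding residue_mat_def by auto
    have "residue_mat (A * B) $$ (a, c) = Poly_Mapping.lookup (\<Sum>b<m. A $$ (a, b) * B $$ (b, c)) 0"
      using index_mult_mat_sum[OF assms(1,2) ac] assms ac unfolding residue_mat_def by simp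
    also have "\<dots> = (\<Sum>b<m. residue_mat A $$ (a, b) * residue_mat B $$ (b, c))"
      using assms ac unfolding residue_mat_def by (simp add: lookup_sum lookup_mult_zero)
    also have "\<dots> = (residue_mat A * residue_mat B) $$ (a, c)"
      by (rule index_mult_mat_sum[symmetric]) (use assms ac in \<open>auto simp: residue_mat_def\<close>)
    finally show "residue_mat (A * B) $$ (a, c) = (residue_mat A * residue_mat B) $$ (a, c)" .
  qed (use assms in \<open>auto simp: residue_mat_def\<close>)
  then show ?thesis
    using assms assoc_mult_mat_vec[of "residue_mat A" n m "residue_mat B" l u]
    unfolding residue_mat_def by auto
qed

lemma residue_mat_minus_one:
  assumes "A \<in> carrier_mat n n" "B \<in> carrier_mat n n"
  shows "residue_mat (A - 1\<^sub>m n - B) = residue_mat A - 1\<^sub>m n - residue_mat B"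
  using assms unfolding residue_mat_def by (intro eq_matI) (auto simp: lookup_minus)

text \<open>An entry with nonzero constant coefficient is homogeneous of degree 0, so it connects
  generators of equal degree.\<close>

lemma residue_mult_vec_entry:
  assumes A: "hmat V rs cs A" and u: "u \<in> carrier_vec (length cs)"
    "\<And>b. b < length cs \<Longrightarrow> u $ b \<noteq> 0 \<Longrightarrow> cs ! b = j"
    and a: "a < length rs" "(residue_mat A *\<^sub>v u) $ a \<noteq> 0"
  shows "rs ! a = j"
proof -
  have "(residue_mat A *\<^sub>v u) $ a = (\<Sum>b<length cs. Poly_Mapping.lookup (A $$ (a, b)) 0 * u $ b)"
    using hmat_carrier[OF A] u(1) a(1) unfolding residue_mat_def
    by (auto simp: scalar_prod_def atLeast0LessThan intro!: sum.cong)
  then obtain b where b: "b < length cs" "Poly_Mapping.lookup (A $$ (a, b)) 0 * u $ b \<noteq> 0"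
    using a(2) by (metis (no_types, lifting) lessThan_iff sum.neutral)
  then have "0 \<in> Poly_Mapping.keys (A $$ (a, b))" "u $ b \<noteq> 0" by (auto simp: in_keys_iff)
  moreover have "homogeneous (A $$ (a, b)) (cs ! b - rs ! a)" using A a b unfolding hmat_def by auto
  ultimately have "cs ! b - rs ! a = 0" unfolding homogeneous_def by force
  then show ?thesis using u(2)[OF b(1)] \<open>u $ b \<noteq> 0\<close> by simp
qed

lemma residue_chains_mult:
  assumes "hmat V (gens F i) (gens F' i') A" "u \<in> residue_chains F' i' j"
  shows "residue_mat A *\<^sub>v u \<in> residue_chains F i j"
  unfolding residue_chains_def
proof (intro CollectI conjI allI impI)
  show "residue_mat A *\<^sub>v u \<in> carrier_vec (rk F i)"
    using hmat_carrier[OF assms(1)] unfolding residue_mat_def carrier_vec_def by simp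
  fix b assume "b < rk F i" "(residue_mat A *\<^sub>v u) $ b \<noteq> 0"
  then show "gens F i ! b = j"
    using residue_mult_vec_entry[OF assms(1)] assms(2) unfolding residue_chains_def by blast
qed

text \<open>Over the residue field the homotopy relation, applied to the cycle \<open>u\<close>,
  loses two terms: the composite through \<open>L\<close>, which has no generator in degree
  \<open>j\<close> here, and the term that begins with the differential of \<open>u\<close>. What is
  left expresses \<open>- u\<close> as a boundary.\<close>

lemma cycle_is_boundary:
  assumes F: "graded_free_resolution V J F" and L: "graded_free_resolution V J L"
    and lin: "\<And>b. b < rk L (Suc n) \<Longrightarrow> gens L (Suc n) ! b \<noteq> j"
    and u: "u \<in> residue_cycles F (Suc n) j"
  shows "u \<in> residue_boundaries F (Suc n) j"
proof -
  obtain \<phi> where \<phi>: "\<phi> 0 = 1\<^sub>m 1" "\<And>i. hmat V (aug_gens L i) (aug_gens F i) (\<phi> i)"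
    "\<And>i. aug_diff L i * \<phi> (Suc i) = \<phi> i * aug_diff F i"
    using resolution_chain_map[OF F L] by blast
  obtain \<psi> where \<psi>: "\<psi> 0 = 1\<^sub>m 1" "\<And>i. hmat V (aug_gens F i) (aug_gens L i) (\<psi> i)"
    "\<And>i. aug_diff F i * \<psi> (Suc i) = \<psi> i * aug_diff L i"
    using resolution_chain_map[OF L F] by blast
  have EF: "exact_complex V (aug_gens F) (aug_diff F)" and EL: "exact_complex V (aug_gens L) (aug_diff L)"
    using exact_complex_aug F L by blast+
  have D: "hmat V (aug_gens F i) (aug_gens F (Suc i)) (aug_diff F i)"
    and D': "hmat V (aug_gens L i) (aug_gens L (Suc i)) (aug_diff L i)" for i
    using EF EL unfolding exact_complex_def by blast+
  define \<theta> where "\<theta> i = \<psi> i * \<phi> i" for i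
  have "\<exists>h. (\<forall>i. hmat V (aug_gens F (Suc i)) (aug_gens F i) (h i)) \<and>
    (\<forall>i. aug_diff F (Suc i) * h (Suc i) =
      \<theta> (Suc i) - 1\<^sub>m (length (aug_gens F (Suc i))) - h i * aug_diff F i)"
  proof (rule homotopy_exists[OF EF])
    show "\<theta> 0 = 1\<^sub>m (length (aug_gens F 0))" unfolding \<theta>_def \<phi>(1) \<psi>(1) by simp
    show "hmat V (aug_gens F i) (aug_gens F i) (\<theta> i)" for i
      unfolding \<theta>_def using \<phi>(2) \<psi>(2) hmat_mult by blast
    show "aug_diff F i * \<theta> (Suc i) = \<theta> i * aug_diff F i" for i
    proof -
      note cs = hmat_carrier[OF \<phi>(2)] hmat_carrier[OF \<psi>(2)] hmat_carrier[OF D] hmat_carrier[OF D']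
      have "aug_diff F i * \<theta> (Suc i) = aug_diff F i * \<psi> (Suc i) * \<phi> (Suc i)"
        unfolding \<theta>_def by (rule assoc_mult_mat[OF cs(3,2,1), symmetric])
      also have "\<dots> = \<psi> i * (aug_diff L i * \<phi> (Suc i))"
        unfolding \<psi>(3) by (rule assoc_mult_mat[OF cs(2,4,1)])
      also have "\<dots> = \<theta> i * aug_diff F i"
        unfolding \<phi>(3) \<theta>_def by (rule assoc_mult_mat[OF cs(2,1,3), symmetric])
      finally show ?thesis .
    qed
  qed
  then obtain h where h: "\<And>i. hmat V (aug_gens F (Suc i)) (aug_gens F i) (h i)"
    "\<And>i. aug_diff F (Suc i) * h (Suc i) =
      \<theta> (Suc i) - 1\<^sub>m (length (aug_gens F (Suc i))) - h i * aug_diff F i" by blast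
  \<comment> \<open>The augmentation shifts indices by one, so \<open>Suc n\<close> in the
    resolution is \<open>?m\<close> in the augmented complex.\<close>
  let ?m = "Suc (Suc n)"
  have uc: "u \<in> residue_chains F (Suc n) j" and uk: "residue_mat (diff F n) *\<^sub>v u = 0\<^sub>v (rk F n)"
    using u hmat_carrier[OF D[of "Suc n"]] unfolding residue_cycles_def mat_kernel_def residue_mat_def by auto
  have ucar: "u \<in> carrier_vec (rk F (Suc n))" using uc unfolding residue_chains_def by blast
  have hm: "hmat V (gens F (Suc n)) (gens F n) (h (Suc n))"
    and hm': "hmat V (gens F (Suc (Suc n))) (gens F (Suc n)) (h ?m)"
    and \<phi>m: "hmat V (gens L (Suc n)) (gens F (Suc n)) (\<phi> ?m)"
    and \<psi>m: "hmat V (gens F (Suc n)) (gens L (Suc n)) (\<psi> ?m)"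
    and dn: "hmat V (gens F n) (gens F (Suc n)) (diff F n)"
    and dn': "hmat V (gens F (Suc n)) (gens F (Suc (Suc n))) (diff F (Suc n))"
    using h(1)[of "Suc n"] h(1)[of ?m] \<phi>(2)[of ?m] \<psi>(2)[of ?m] D[of "Suc n"] D[of ?m] by simp_all
  have "residue_mat (\<phi> ?m) *\<^sub>v u = 0\<^sub>v (rk L (Suc n))"
  proof (rule eq_vecI)
    fix a assume "a < dim_vec (0\<^sub>v (rk L (Suc n)))"
    then show "(residue_mat (\<phi> ?m) *\<^sub>v u) $ a = 0\<^sub>v (rk L (Suc n)) $ a"
      using residue_chains_mult[OF \<phi>m uc] lin[of a] unfolding residue_chains_def by auto
  qed (use hmat_carrier[OF \<phi>m] in \<open>auto simp: residue_mat_def\<close>)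
  then have \<theta>u: "residue_mat (\<theta> ?m) *\<^sub>v u = 0\<^sub>v (rk F (Suc n))"
    unfolding \<theta>_def residue_mat_mult_vec[OF hmat_carrier[OF \<psi>m] hmat_carrier[OF \<phi>m] ucar]
    using hmat_carrier[OF \<psi>m] by (auto simp: residue_mat_def)
  have hu: "residue_mat (h (Suc n) * diff F n) *\<^sub>v u = 0\<^sub>v (rk F (Suc n))"
    unfolding residue_mat_mult_vec[OF hmat_carrier[OF hm] hmat_carrier[OF dn] ucar] uk
    using hmat_carrier[OF hm] by (auto simp: residue_mat_def)
  let ?A = "diff F (Suc n) * h ?m"
  define y where "y = residue_mat (h ?m) *\<^sub>v u"
  have y: "y \<in> residue_chains F (Suc (Suc n)) j"
    unfolding y_def by (rule residue_chains_mult[OF hm' uc])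
  have ycar: "y \<in> carrier_vec (rk F (Suc (Suc n)))" using y unfolding residue_chains_def by blast
  have A: "?A = \<theta> ?m - 1\<^sub>m (rk F (Suc n)) - h (Suc n) * diff F n"
    using h(2)[of "Suc n"] by simp
  have \<theta>c: "\<theta> ?m \<in> carrier_mat (rk F (Suc n)) (rk F (Suc n))"
    unfolding \<theta>_def using hmat_carrier[OF \<psi>m] hmat_carrier[OF \<phi>m] by (rule mult_carrier_mat)
  have hdc: "h (Suc n) * diff F n \<in> carrier_mat (rk F (Suc n)) (rk F (Suc n))"
    using hmat_carrier[OF hm] hmat_carrier[OF dn] by (rule mult_carrier_mat)
  have rA: "residue_mat ?A = residue_mat (\<theta> ?m) - 1\<^sub>m (rk F (Suc n)) - residue_mat (h (Suc n) * diff F n)"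
    unfolding A by (rule residue_mat_minus_one[OF \<theta>c hdc])
  have "residue_mat (diff F (Suc n)) *\<^sub>v y = residue_mat ?A *\<^sub>v u"
    unfolding y_def
    by (rule residue_mat_mult_vec[OF hmat_carrier[OF dn'] hmat_carrier[OF hm'] ucar, symmetric])
  also have "\<dots> = residue_mat (\<theta> ?m) *\<^sub>v u - 1\<^sub>m (rk F (Suc n)) *\<^sub>v u - residue_mat (h (Suc n) * diff F n) *\<^sub>v u"
    unfolding rA using \<theta>c hdc ucar
    by (simp add: minus_mult_distrib_mat_vec[of _ "rk F (Suc n)" "rk F (Suc n)"] residue_mat_def minus_carrier_mat)
  also have "\<dots> = - u" unfolding \<theta>u hu using ucar by auto
  finally have yu: "residue_mat (diff F (Suc n)) *\<^sub>v y = - u" .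
  have "residue_mat (diff F (Suc n)) *\<^sub>v (- y) = - (residue_mat (diff F (Suc n)) *\<^sub>v y)"
    using hmat_carrier[OF dn'] ycar
    by (intro eq_vecI) (auto simp: residue_mat_def)
  then have "u = residue_mat (diff F (Suc n)) *\<^sub>v (- y)" unfolding yu using ucar by auto
  moreover have "- y \<in> residue_chains F (Suc (Suc n)) j"
    using y unfolding residue_chains_def by auto
  ultimately show ?thesis unfolding residue_boundaries_def by blast
qed

lemma residue_homology_singleton:
  assumes F: "graded_free_resolution V J F" and L: "graded_free_resolution V J L"
    and lin: "\<And>b. b < rk L (Suc n) \<Longrightarrow> gens L (Suc n) ! b \<noteq> j"
  shows "is_singleton (residue_homology F (Suc n) j)"
proof -
  let ?Z = "residue_cycles F (Suc n) j"
  have d: "diff F n \<in> carrier_mat (rk F n) (rk F (Suc n))"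
    using F unfolding graded_free_resolution_def by blast
  have rd: "residue_mat (diff F n) \<in> carrier_mat (rk F n) (rk F (Suc n))"
    using d unfolding residue_mat_def by simp
  have Z: "u \<in> ?Z \<longleftrightarrow> u \<in> residue_chains F (Suc n) j \<and> residue_mat (diff F n) *\<^sub>v u = 0\<^sub>v (rk F n)" for u
    using rd unfolding residue_cycles_def mat_kernel_def residue_chains_def by auto
  have "u - w \<in> ?Z" if "u \<in> ?Z" "w \<in> ?Z" for u w
  proof -
    have uw: "u \<in> carrier_vec (rk F (Suc n))" "w \<in> carrier_vec (rk F (Suc n))"
      using that unfolding Z residue_chains_def by auto
    have "residue_mat (diff F n) *\<^sub>v (u - w) = residue_mat (diff F n) *\<^sub>v u - residue_mat (diff F n) *\<^sub>v w"
      using rd uw by (rule mult_minus_distrib_mat_vec)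
    then have "residue_mat (diff F n) *\<^sub>v (u - w) = 0\<^sub>v (rk F n)" using that unfolding Z by auto
    moreover have "u - w \<in> residue_chains F (Suc n) j"
      using that uw unfolding Z residue_chains_def by auto
    ultimately show ?thesis unfolding Z by blast
  qed
  then have "{(u, w). u \<in> ?Z \<and> w \<in> ?Z \<and> u - w \<in> residue_boundaries F (Suc n) j} = ?Z \<times> ?Z"
    using cycle_is_boundary[OF F L lin] by auto
  \<comment> \<open>An empty set of cycles would have no class at all instead of exactly
    one.\<close>
  moreover have "0\<^sub>v (rk F (Suc n)) \<in> ?Z"
    unfolding Z residue_chains_def using rd by auto
  ultimately have "residue_homology F (Suc n) j = {?Z}"
    unfolding residue_homology_def quotient_def by auto
  then show ?thesis by (simp add: is_singleton_def)
qed

section \<open>The path ideal\<close>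

lemma poly_ring_simps [simp]:
  "carrier (poly_ring V) = polys V" "\<zero>\<^bsub>poly_ring V\<^esub> = 0" "\<one>\<^bsub>poly_ring V\<^esub> = 1"
  "p \<oplus>\<^bsub>poly_ring V\<^esub> q = p + q" "p \<otimes>\<^bsub>poly_ring V\<^esub> q = p * q"
  unfolding poly_ring_def polys_def by simp_all

lemma ring_poly_ring: "ring (poly_ring V :: ('v, 'k::field) mpoly ring)"
proof (rule ringI)
  show "abelian_group (poly_ring V :: ('v, 'k) mpoly ring)"
  proof (rule abelian_groupI)
    fix x :: "('v, 'k) mpoly" assume "x \<in> carrier (poly_ring V)"
    then show "\<exists>y\<in>carrier (poly_ring V). y \<oplus>\<^bsub>poly_ring V\<^esub> x = \<zero>\<^bsub>poly_ring V\<^esub>"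
      using polys_uminus[of x V] by (intro bexI[of _ "- x"]) simp_all
  qed (simp_all add: polys_add polys_zero ac_simps)
  show "monoid (poly_ring V :: ('v, 'k) mpoly ring)"
    by (rule monoidI) (simp_all add: polys_one polys_mult mult.assoc)
qed (simp_all add: algebra_simps)

text \<open>The set described by divisibility of monomials is an ideal containing the generators,
  and \<open>mono_ideal_insertE\<close> shows, one generator at a time, that it lies in every such
  ideal.\<close>

lemma path_ideal_eq:
  assumes "finite (verts G)"
  shows "(path_ideal t G :: ('v, 'k::field) mpoly set) =
    mono_ideal (verts G) {set p |p. vpath p G \<and> length p = t}"
proof -
  let ?V = "verts G"
  define F where "F = {set p |p. vpath p G \<and> length p = t}"
  let ?R = "poly_ring ?V :: ('v, 'k) mpoly ring"
  let ?S = "{prod_list (map var p) |p. vpath p G \<and> length p = t} :: ('v, 'k) mpoly set"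
  have FV: "A \<subseteq> ?V" "finite A" if "A \<in> F" for A
    using that unfolding F_def vpath_def vwalk_def by blast+
  have "F \<subseteq> Pow ?V" using FV by blast
  then have finF: "finite F" by (rule finite_subset) (use assms in simp)
  have "prod_list (map var p) = sqmon (set p)" if "vpath p G" for p
    using that prod_list_var unfolding vpath_def by blast
  then have S: "?S = sqmon ` F" unfolding F_def by (intro equalityI subsetI) (auto, metis)
  have I: "ideal (mono_ideal ?V F) ?R"
  proof (rule idealI)
    show "ring ?R" by (rule ring_poly_ring)
    interpret ring ?R by (rule ring_poly_ring)
    show "subgroup (mono_ideal ?V F) (add_monoid ?R)"
    proof (rule add.subgroupI)
      show "mono_ideal ?V F \<subseteq> carrier ?R"
        unfolding poly_ring_simps mono_ideal_def by blast
      show "mono_ideal ?V F \<noteq> {}" using mono_ideal_zero by blast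
      fix a b :: "('v, 'k) mpoly" assume a: "a \<in> mono_ideal ?V F"
      have "- a \<in> carrier ?R" "a \<in> carrier ?R"
        using mono_ideal_uminus[OF a] a unfolding poly_ring_simps mono_ideal_def by blast+
      moreover have "- a \<oplus>\<^bsub>?R\<^esub> a = \<zero>\<^bsub>?R\<^esub>" by simp
      ultimately have "\<ominus>\<^bsub>?R\<^esub> a = - a" by (simp add: minus_equality)
      then show "\<ominus>\<^bsub>?R\<^esub> a \<in> mono_ideal ?V F" using mono_ideal_uminus[OF a] by simp
      assume "b \<in> mono_ideal ?V F"
      then show "a \<oplus>\<^bsub>?R\<^esub> b \<in> mono_ideal ?V F"
        using mono_ideal_add[OF a] by simp
    qed
    fix a x :: "('v, 'k) mpoly" assume ax: "a \<in> mono_ideal ?V F" "x \<in> carrier ?R"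
    then have "x * a \<in> mono_ideal ?V F"
      using mono_ideal_mult unfolding poly_ring_simps by blast
    then show "x \<otimes>\<^bsub>?R\<^esub> a \<in> mono_ideal ?V F" "a \<otimes>\<^bsub>?R\<^esub> x \<in> mono_ideal ?V F"
      by (simp_all add: mult.commute)
  qed
  have "?S \<subseteq> mono_ideal ?V F"
    unfolding S using sqmon_in_mono_ideal FV by blast
  moreover have "mono_ideal ?V F \<subseteq> J" if J: "ideal J ?R" "?S \<subseteq> J" for J
  proof -
    interpret ideal J ?R by fact
    have "mono_ideal ?V F' \<subseteq> J" if "finite F'" "F' \<subseteq> F" for F'
      using that
    proof (induction F' rule: finite_induct)
      case empty
      have "\<zero>\<^bsub>?R\<^esub> \<in> J" by (rule additive_subgroup.zero_closed[OF is_additive_subgroup])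
      then show ?case by (simp add: mono_ideal_empty)
    next
      case (insert A F')
      show ?case
      proof
        fix p :: "('v, 'k) mpoly" assume "p \<in> mono_ideal ?V (insert A F')"
        then obtain u c where uc: "u \<in> mono_ideal ?V F'" "c \<in> polys ?V" "p = u + c * sqmon A"
          using mono_ideal_insertE FV(2) insert.prems by blast
        have "sqmon A \<in> J" using J(2) insert.prems unfolding S by blast
        then have "c \<otimes>\<^bsub>?R\<^esub> sqmon A \<in> J" using uc(2) I_l_closed[of "sqmon A" c] by simp
        moreover have "u \<in> J" using uc(1) insert by blast
        ultimately have "u \<oplus>\<^bsub>?R\<^esub> (c \<otimes>\<^bsub>?R\<^esub> sqmon A) \<in> J"
          by (intro additive_subgroup.a_closed[OF is_additive_subgroup])
        then show "p \<in> J" using uc(3) by simp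
      qed
    qed
    then show ?thesis using finF by blast
  qed
  ultimately show ?thesis
    unfolding path_ideal_def genideal_def F_def[symmetric] using I by blast
qed

section \<open>From directed graphs to the combinatorial setting\<close>

lemma successively_vwalk_arcs: "set (vwalk_arcs p) \<subseteq> arcs_ends G \<longleftrightarrow> successively (dominates G) p"
  by (induction p rule: vwalk_arcs.induct) auto

lemma gap_claw_free_graph_of:
  assumes "graph G" "gap_free G" "claw_free G"
  shows "gap_claw_free_graph {v \<in> verts G. \<exists>u. v \<rightarrow>\<^bsub>G\<^esub> u} (dominates G)"
proof -
  interpret graph G by fact
  have sym: "v \<rightarrow>\<^bsub>G\<^esub> u" if "u \<rightarrow>\<^bsub>G\<^esub> v" for u v
    using sym_arcs that unfolding symmetric_def by (auto dest: symD)
  have irr: "\<not> u \<rightarrow>\<^bsub>G\<^esub> u" for u using adj_not_same by blast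
  show ?thesis
  proof
    show "finite {v \<in> verts G. \<exists>u. v \<rightarrow>\<^bsub>G\<^esub> u}" by simp
    fix u v x y c z
    show "u \<rightarrow>\<^bsub>G\<^esub> v \<Longrightarrow> u \<in> {v \<in> verts G. \<exists>u. v \<rightarrow>\<^bsub>G\<^esub> u}" by (auto simp: adj_in_verts)
    show "u \<rightarrow>\<^bsub>G\<^esub> v \<Longrightarrow> v \<rightarrow>\<^bsub>G\<^esub> u" by (rule sym)
    show "\<not> u \<rightarrow>\<^bsub>G\<^esub> u" by (rule irr)
    show "v \<in> {v \<in> verts G. \<exists>u. v \<rightarrow>\<^bsub>G\<^esub> u} \<Longrightarrow> \<exists>u. v \<rightarrow>\<^bsub>G\<^esub> u" by blast
    show "u \<rightarrow>\<^bsub>G\<^esub> x \<or> u \<rightarrow>\<^bsub>G\<^esub> y \<or> v \<rightarrow>\<^bsub>G\<^esub> x \<or> v \<rightarrow>\<^bsub>G\<^esub> y"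
      if "u \<rightarrow>\<^bsub>G\<^esub> v" "x \<rightarrow>\<^bsub>G\<^esub> y" "u \<noteq> x" "u \<noteq> y" "v \<noteq> x" "v \<noteq> y"
    proof -
      have "{u, v} \<inter> {x, y} = {}" using that by auto
      then show ?thesis using assms(2) that(1,2) unfolding gap_free_def by blast
    qed
    show "x \<rightarrow>\<^bsub>G\<^esub> y \<or> x \<rightarrow>\<^bsub>G\<^esub> z \<or> y \<rightarrow>\<^bsub>G\<^esub> z"
      if c: "c \<rightarrow>\<^bsub>G\<^esub> x" "c \<rightarrow>\<^bsub>G\<^esub> y" "c \<rightarrow>\<^bsub>G\<^esub> z" and neq: "x \<noteq> y" "x \<noteq> z" "y \<noteq> z"
    proof (rule ccontr)
      assume no: "\<not> ?thesis"
      let ?S = "{c, x, y, z}"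
      have S: "?S \<subseteq> verts G" using c adj_in_verts by blast
      have ind: "induced_subgraph (G \<restriction> ?S) G" using S by (rule induced_induce)
      have "c \<noteq> x" "c \<noteq> y" "c \<noteq> z" using c irr by auto
      have dom: "arcs_ends (G \<restriction> ?S) = {(a, b). a \<rightarrow>\<^bsub>G\<^esub> b \<and> a \<in> ?S \<and> b \<in> ?S}"
        unfolding arcs_ends_conv by (auto simp: image_iff)
      have "arcs_ends (G \<restriction> ?S) = {c} \<times> {x, y, z} \<union> {x, y, z} \<times> {c}"
        unfolding dom using c no sym irr by blast
      moreover have "graph (G \<restriction> ?S)"
        using digraphI_induced[OF ind] induced_graph_imp_graph[OF ind]
        by (simp add: graph_def pseudo_graph_def digraph_def)
      moreover have "{c} \<inter> {x, y, z} = {}" "card {c} = 1" "card {x, y, z} = 3"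
        using neq \<open>c \<noteq> x\<close> \<open>c \<noteq> y\<close> \<open>c \<noteq> z\<close> by auto
      moreover have "verts (G \<restriction> ?S) = {c} \<union> {x, y, z}" by auto
      ultimately have "K\<^bsub>1,3\<^esub> (G \<restriction> ?S)" unfolding complete_bipartite_digraph_def by blast
      then show False using ind assms(3) unfolding claw_free_def by blast
    qed
  qed
qed

text \<open>Every vertex of a path of length at least two has a neighbour, so removing the isolated
  vertices loses no path.\<close>

lemma linear_quotients_vpaths:
  assumes "graph G" "gap_free G" "claw_free G" "t \<ge> 3"
  shows "linear_quotients {set p |p. vpath p G \<and> length p = t}"
proof -
  let ?V = "{v \<in> verts G. \<exists>u. v \<rightarrow>\<^bsub>G\<^esub> u}"
  interpret gap_claw_free_graph ?V "dominates G" using assms by (intro gap_claw_free_graph_of)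
  have "{set p |p. vpath p G \<and> length p = t} = paths t"
  proof (intro equalityI subsetI)
    fix W assume "W \<in> {set p |p. vpath p G \<and> length p = t}"
    then obtain p where p: "W = set p" "vpath p G" "length p = t" by blast
    then have path: "path_on (dominates G) p" and "set p \<subseteq> verts G"
      unfolding vpath_def vwalk_def path_on_def successively_vwalk_arcs by auto
    moreover have "\<exists>u. v \<rightarrow>\<^bsub>G\<^esub> u" if "v \<in> W" for v
      using path_on_nbr[OF path _ sym, of v] p assms(4) that by auto
    ultimately show "W \<in> paths t"
      unfolding paths_def traceable_def using p distinct_card[of p] by (auto simp: path_on_def)
  next
    fix W assume W: "W \<in> paths t"
    then obtain p where p: "path_on (dominates G) p" "set p = W"
      unfolding paths_def traceable_def by blast
    have len: "length p = t" using p W distinct_card[of p] unfolding paths_def path_on_def by auto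
    have "vpath p G"
      unfolding vpath_def vwalk_def successively_vwalk_arcs
      using p W len assms(4) unfolding paths_def path_on_def by auto
    then show "W \<in> {set p |p. vpath p G \<and> length p = t}" using p len by blast
  qed
  then show ?thesis using linear_quotients_paths[OF assms(4)] by simp
qed

theorem theorem1p1:
  fixes G :: "('v, 'e) pre_digraph" and t :: nat
  assumes "graph G" and "gap_free G" and "claw_free G" and "t \<ge> 3"
  shows "(path_ideal t G :: ('v, 'k::field) mpoly set) = {0} \<or>
    linear_minimal_free_resolution (verts G) t (path_ideal t G :: ('v, 'k) mpoly set)"
proof -
  interpret graph G by fact
  let ?F = "{set p |p. vpath p G \<and> length p = t}"
  let ?J = "path_ideal t G :: ('v, 'k) mpoly set"
  have "W \<subseteq> verts G \<and> card W = t" if "W \<in> ?F" for W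
    using that distinct_card unfolding vpath_def vwalk_def by auto
  then obtain L :: "('v, 'k) free_complex" where
    L: "graded_free_resolution (verts G) ?J L" "\<forall>i. \<forall>b<rk L i. gens L i ! b = int i + int t"
    using linear_resolution_exists[OF finite_verts linear_quotients_vpaths[OF assms], where ?'k = 'k]
    unfolding path_ideal_eq[OF finite_verts, where ?'k = 'k] by blast
  \<comment> \<open>\<open>Tor\<close> uses a resolution given by the choice operator. The existence
    of \<open>L\<close> ensures that it is a resolution; all else must be transferred from
    \<open>L\<close>.\<close>
  define F where "F = (SOME F. graded_free_resolution (verts G) ?J F)"
  have F: "graded_free_resolution (verts G) ?J F" unfolding F_def using L(1) by (rule someI)
  have "is_singleton (Tor (verts G) ?J i j)" if ij: "i \<ge> 1" "j \<noteq> int i + int t" for i j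
  proof -
    obtain n where n: "i = Suc n" using ij(1) by (cases i) auto
    have "gens L (Suc n) ! b \<noteq> j" if "b < rk L (Suc n)" for b
      using L(2) ij(2) n that by simp
    then have "is_singleton (residue_homology F (Suc n) j)"
      by (rule residue_homology_singleton[OF F L(1)])
    then show ?thesis unfolding Tor_def F_def[symmetric] n .
  qed
  then show ?thesis unfolding linear_minimal_free_resolution_def by blast
qed

end
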